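(* Let $\mathbb H=\mathbb H(\Phi,c)$ be a graded affine Hecke algebra, let $(\pi,X)$ be an irreducible unitary $\mathbb H$-module with central character $\chi_\nu$, $\nu\in V$, and let $(\gamma,S)$ be a spin module for $C(V^\vee)$. Let $(\widetilde\sigma,\widetilde U)$ be an irreducible representation of $\widetilde W$ such that $\mathrm{Hom}_{\widetilde W}(\widetilde U,X\otimes S)\neq0$. Then $$\langle\nu,\nu\rangle\le c(\widetilde\sigma),$$ where $$c(\widetilde\sigma)=\frac14\sum_{\alpha>0}c_\alpha^2\langle\alpha,\alpha\rangle-\frac14\sum_{\alpha>0,\ \beta>0,\ \alpha\ne\beta,\ s_\alpha(\beta)<0}c_\alpha c_\beta|\alpha||\beta|\frac{\mathrm{tr}_{\widetilde\sigma}(f_\alpha f_\beta)}{\mathrm{tr}_{\widetilde\sigma}(1)}$$ is the scalar by which $\Omega_{\widetilde W}$ acts in $\widetilde U$, and $\mathrm{tr}_{\widetilde\sigma}$ denotes the character of $\widetilde\sigma$.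
   Context: Root system: $\Phi=(V_0,R,V_0^\vee,R^\vee)$ is a reduced real root system, not necessarily crystallographic: $V_0,V_0^\vee$ are finite-dimensional real vector spaces with a perfect bilinear pairing $(\cdot,\cdot):V_0\times V_0^\vee\to\mathbb R$; $R\subset V_0\setminus\{0\}$ and $R^\vee\subset V_0^\vee\setminus\{0\}$ are finite spanning sets with a bijection $\alpha\mapsto\alpha^\vee$, $(\alpha,\alpha^\vee)=2$; the reflections $s_\alpha(v)=v-(v,\alpha^\vee)\alpha$ and $s_\alpha(v')=v'-(\alpha,v')\alpha^\vee$ preserve $R$ and $R^\vee$; $\alpha\in R$ implies $2\alpha\notin R$. $W$ is the group generated by the $s_\alpha$, acting on both spaces. Fix positive roots $R^+$ with simple roots $\Pi$; $\beta>0$ means $\beta\in R^+$, $\beta<0$ means $-\beta\in R^+$. Fix a $W$-invariant inner product $\langle\cdot,\cdot\rangle$ on $V_0^\vee$; dual bases $\{\omega_i\},\{\omega^i\}$ of $V_0^\vee$ are bases with $\langle\omega_i,\omega^j\rangle=\delta_{ij}$, and $\langle v_1,v_2\rangle=\sum_i(v_1,\omega_i)(v_2,\omega^i)$ is the dual inner product on $V_0$. Put $|v|=\langle v,v\rangle^{1/2}$, $V=V_0\otimes_{\mathbb R}\mathbb C$, $V^\vee=V_0^\vee\otimes_{\mathbb R}\mathbb C$; forms are extended complex bilinearly. Hecke algebra: fix a $W$-invariant function $c:R\to\mathbb R$, $c_\alpha=c(\alpha)$. $\mathbb H(\Phi,c)$ is the unital associative complex algebra generated by $t_w$ ($w\in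 W$) and $S(V^\vee)$, such that $w\mapsto t_w$ and the inclusion of $S(V^\vee)$ are injective algebra maps from $\mathbb C[W]$ and $S(V^\vee)$, with relations $\omega t_{s_\alpha}-t_{s_\alpha}s_\alpha(\omega)=c_\alpha(\alpha,\omega)$ for $\alpha\in\Pi$, $\omega\in V^\vee$; as a vector space $\mathbb H\simeq\mathbb C[W]\otimes S(V^\vee)$. Its center is $S(V^\vee)^W$; $\chi_\nu$ is evaluation at $\nu\in V$ on $S(V^\vee)^W$, and a module has central character $\chi_\nu$ if the center acts by $\chi_\nu$. $\mathbb H$ has the conjugate-linear anti-involution $*$ with $t_w^*=t_{w^{-1}}$ and $\omega^*=-\omega+\sum_{\beta>0}c_\beta(\beta,\omega)t_{s_\beta}$ for $\omega\in V_0^\vee$. A module $(\pi,X)$ is Hermitian if it has a Hermitian form with $(\pi(h)x,y)_X=(x,\pi(h^* )y)_X$ for all $h,x,y$; it is unitary if such a form exists that is positive definite. Clifford algebra and $\widetilde W$: $C(V^\vee)$ is the complex algebra generated by $V^\vee$ with relations $\omega\omega'+\omega'\omega=-2\langle\omega,\omega'\rangle$. Let $\epsilon$ be its automorphism with $\epsilon(\omega)=-\omega$ and ${}^t$ its antiautomorphism with $\omega^t=-\omega$ ($\omega\in V^\vee$). $\mathrm{Pin}(V^\vee)=\{a:\epsilon(a)V^\vee a^{-1}\subset V^\vee,\ a^t=a^{-1}\}$, $p:\mathrm{Pin}(V^\vee)\to O(V^\vee)$, $p(a)(\omega)=\epsilon(a)\omega a^{-1}$, with kernel $\{\pm1\}$.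 $\widetilde W=p^{-1}(W)$, generated by $f_\alpha=\alpha^\vee/|\alpha^\vee|$, $\alpha\in R$; $f_\alpha^2=-1$. A spin module $(\gamma,S)$ is a simple $C(V^\vee)$-module (dimension $2^{[\dim V/2]}$). $\widetilde W$ acts on $X\otimes S$ by $\widetilde w\mapsto\pi(t_{p(\widetilde w)})\otimes\gamma(\widetilde w)$. Finally $$\Omega_{\widetilde W}=-\frac14\sum_{\alpha>0,\ \beta>0,\ s_\alpha(\beta)<0}c_\alpha c_\beta|\alpha||\beta|f_\alpha f_\beta\in\mathbb C[\widetilde W],$$ which is invariant under conjugation by $\widetilde W$. *)

theory Defs
  imports "HOL-Analysis.Analysis" "HOL-Library.Poly_Mapping"
begin

section \<open>Complexification\<close>

text \<open>A pair \<open>(a, b)\<close> of vectors stands for \<open>a + i b\<close>, so \<open>'a \<times> 'a\<close> is the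
  complexification of the real vector space \<open>'a\<close>.\<close>

definition cpx_scale :: "complex \<Rightarrow> 'a::real_vector \<times> 'a \<Rightarrow> 'a \<times> 'a" where
  "cpx_scale z v = (Re z *\<^sub>R fst v - Im z *\<^sub>R snd v, Re z *\<^sub>R snd v + Im z *\<^sub>R fst v)"

definition cpx_lift :: "('a \<Rightarrow> 'b) \<Rightarrow> 'a \<times> 'a \<Rightarrow> 'b \<times> 'b" where
  "cpx_lift f = map_prod f f"

definition cpx_form :: "('a \<Rightarrow> 'b \<Rightarrow> real) \<Rightarrow> 'a \<times> 'a \<Rightarrow> 'b \<times> 'b \<Rightarrow> complex" where
  "cpx_form B v w =
     Complex (B (fst v) (fst w) - B (snd v) (snd w)) (B (fst v) (snd w) + B (snd v) (fst w))"


section \<open>Root systems\<close>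

record ('v, 'u) root_data =
  pairing :: "'v \<Rightarrow> 'u \<Rightarrow> real"
  roots :: "'v set"
  coroots :: "'u set"
  coroot :: "'v \<Rightarrow> 'u"

definition reflect :: "('v::real_vector, 'u::real_inner) root_data \<Rightarrow> 'v \<Rightarrow> 'v \<Rightarrow> 'v" where
  "reflect \<Phi> \<alpha> v = v - pairing \<Phi> v (coroot \<Phi> \<alpha>) *\<^sub>R \<alpha>"

definition coreflect :: "('v::real_vector, 'u::real_inner) root_data \<Rightarrow> 'v \<Rightarrow> 'u \<Rightarrow> 'u" where
  "coreflect \<Phi> \<alpha> u = u - pairing \<Phi> \<alpha> u *\<^sub>R coroot \<Phi> \<alpha>"

text \<open>Finite-dimensionality of the two spaces comes from the finite spanning sets of roots and
  coroots. Perfectness of the pairing: it identifies each space with the dual of the other.\<close>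

definition root_system :: "('v::real_vector, 'u::real_inner) root_data \<Rightarrow> bool" where
  "root_system \<Phi> \<longleftrightarrow>
     bilinear (pairing \<Phi>) \<and>
     bij_betw (\<lambda>v u. pairing \<Phi> v u) UNIV {f. linear f} \<and>
     bij_betw (\<lambda>u v. pairing \<Phi> v u) UNIV {f. linear f} \<and>
     finite (roots \<Phi>) \<and> 0 \<notin> roots \<Phi> \<and> span (roots \<Phi>) = UNIV \<and>
     finite (coroots \<Phi>) \<and> 0 \<notin> coroots \<Phi> \<and> span (coroots \<Phi>) = UNIV \<and>
     bij_betw (coroot \<Phi>) (roots \<Phi>) (coroots \<Phi>) \<and>
     (\<forall>\<alpha>\<in>roots \<Phi>. pairing \<Phi> \<alpha> (coroot \<Phi> \<alpha>) = 2) \<and>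
     (\<forall>\<alpha>\<in>roots \<Phi>. reflect \<Phi> \<alpha> ` roots \<Phi> = roots \<Phi>) \<and>
     (\<forall>\<alpha>\<in>roots \<Phi>. coreflect \<Phi> \<alpha> ` coroots \<Phi> = coroots \<Phi>) \<and>
     (\<forall>\<alpha>\<in>roots \<Phi>. 2 *\<^sub>R \<alpha> \<notin> roots \<Phi>)"

text \<open>An element of the Weyl group is recorded as the pair of its actions on \<open>V\<^sub>0\<close> and
  \<open>V\<^sub>0\<^sup>\<or>\<close>. Since reflections are involutions, the monoid they generate is the group.\<close>

type_synonym ('v, 'u) weyl_elt = "('v \<Rightarrow> 'v) \<times> ('u \<Rightarrow> 'u)"

definition w_one :: "('v, 'u) weyl_elt" where
  "w_one = (id, id)"

definition w_mult :: "('v, 'u) weyl_elt \<Rightarrow> ('v, 'u) weyl_elt \<Rightarrow> ('v, 'u) weyl_elt" where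
  "w_mult w w' = (fst w \<circ> fst w', snd w \<circ> snd w')"

definition w_inv :: "('v, 'u) weyl_elt \<Rightarrow> ('v, 'u) weyl_elt" where
  "w_inv w = (inv (fst w), inv (snd w))"

definition w_refl ::
    "('v::real_vector, 'u::real_inner) root_data \<Rightarrow> 'v \<Rightarrow> ('v, 'u) weyl_elt" where
  "w_refl \<Phi> \<alpha> = (reflect \<Phi> \<alpha>, coreflect \<Phi> \<alpha>)"

inductive_set weyl :: "('v::real_vector, 'u::real_inner) root_data \<Rightarrow> ('v, 'u) weyl_elt set"
  for \<Phi> :: "('v, 'u) root_data" where
  one: "w_one \<in> weyl \<Phi>"
| refl: "\<alpha> \<in> roots \<Phi> \<Longrightarrow> w \<in> weyl \<Phi> \<Longrightarrow> w_mult (w_refl \<Phi> \<alpha>) w \<in> weyl \<Phi>"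

definition positive_system ::
    "('v::real_vector, 'u::real_inner) root_data \<Rightarrow> 'v set \<Rightarrow> 'v set \<Rightarrow> bool" where
  "positive_system \<Phi> Pos Simple \<longleftrightarrow>
     roots \<Phi> = Pos \<union> uminus ` Pos \<and> Pos \<inter> uminus ` Pos = {} \<and>
     Simple \<subseteq> Pos \<and> independent Simple \<and>
     (\<forall>\<beta>\<in>Pos. \<exists>k. (\<forall>\<delta>\<in>Simple. k \<delta> \<ge> (0::real)) \<and> \<beta> = (\<Sum>\<delta>\<in>Simple. k \<delta> *\<^sub>R \<delta>))"

text \<open>The inner product on \<open>V\<^sub>0\<^sup>\<or>\<close> is the one of the class \<^class>\<open>real_inner\<close>.\<close>

definition inner_invariant :: "('v::real_vector, 'u::real_inner) root_data \<Rightarrow> bool" where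
  "inner_invariant \<Phi> \<longleftrightarrow> (\<forall>w\<in>weyl \<Phi>. \<forall>x y. inner (snd w x) (snd w y) = inner x y)"

definition param_invariant ::
    "('v::real_vector, 'u::real_inner) root_data \<Rightarrow> ('v \<Rightarrow> real) \<Rightarrow> bool" where
  "param_invariant \<Phi> c \<longleftrightarrow> (\<forall>w\<in>weyl \<Phi>. \<forall>\<alpha>\<in>roots \<Phi>. c (fst w \<alpha>) = c \<alpha>)"

definition dual_bases :: "nat \<Rightarrow> (nat \<Rightarrow> 'u::real_inner) \<Rightarrow> (nat \<Rightarrow> 'u) \<Rightarrow> bool" where
  "dual_bases n a b \<longleftrightarrow>
     inj_on a {..<n} \<and> independent (a ` {..<n}) \<and> span (a ` {..<n}) = UNIV \<and>
     inj_on b {..<n} \<and> independent (b ` {..<n}) \<and> span (b ` {..<n}) = UNIV \<and>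
     (\<forall>i<n. \<forall>j<n. inner (a i) (b j) = (if i = j then 1 else 0))"

text \<open>The value does not depend on the chosen dual bases.\<close>

definition dual_inner ::
    "('v::real_vector, 'u::real_inner) root_data \<Rightarrow> 'v \<Rightarrow> 'v \<Rightarrow> real" where
  "dual_inner \<Phi> v w =
     (let (n, a, b) = (SOME (n, a, b). dual_bases n a b)
      in \<Sum>i<n. pairing \<Phi> v (a i) * pairing \<Phi> w (b i))"

definition dual_norm :: "('v::real_vector, 'u::real_inner) root_data \<Rightarrow> 'v \<Rightarrow> real" where
  "dual_norm \<Phi> v = sqrt (dual_inner \<Phi> v v)"

text \<open>\<open>S(V\<^sup>\<or>)\<close> is realised as the algebra of polynomial functions on \<open>V\<close>; the vector
  \<open>\<omega> \<in> V\<^sup>\<or>\<close> is the function \<open>\<nu> \<mapsto> (\<nu>, \<omega>)\<close>, and \<open>w \<in> W\<close> acts by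
  \<open>p \<mapsto> p \<circ> w\<inverse>\<close>.\<close>

definition lin_fun ::
    "('v::real_vector, 'u::real_inner) root_data \<Rightarrow> 'u \<times> 'u \<Rightarrow> 'v \<times> 'v \<Rightarrow> complex" where
  "lin_fun \<Phi> \<omega> = (\<lambda>\<nu>. cpx_form (pairing \<Phi>) \<nu> \<omega>)"

inductive_set sym_alg ::
    "('v::real_vector, 'u::real_inner) root_data \<Rightarrow> ('v \<times> 'v \<Rightarrow> complex) set"
  for \<Phi> :: "('v, 'u) root_data" where
  const: "(\<lambda>_. z) \<in> sym_alg \<Phi>"
| lin: "lin_fun \<Phi> \<omega> \<in> sym_alg \<Phi>"
| add: "p \<in> sym_alg \<Phi> \<Longrightarrow> q \<in> sym_alg \<Phi> \<Longrightarrow> (\<lambda>\<nu>. p \<nu> + q \<nu>) \<in> sym_alg \<Phi>"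
| mult: "p \<in> sym_alg \<Phi> \<Longrightarrow> q \<in> sym_alg \<Phi> \<Longrightarrow> (\<lambda>\<nu>. p \<nu> * q \<nu>) \<in> sym_alg \<Phi>"

definition sym_alg_inv ::
    "('v::real_vector, 'u::real_inner) root_data \<Rightarrow> ('v \<times> 'v \<Rightarrow> complex) set" where
  "sym_alg_inv \<Phi> = {p \<in> sym_alg \<Phi>. \<forall>w\<in>weyl \<Phi>. p \<circ> cpx_lift (fst w) = p}"


section \<open>Complex algebras given by generators and relations\<close>

definition complex_algebra :: "(complex \<Rightarrow> 'a::ring_1 \<Rightarrow> 'a) \<Rightarrow> bool" where
  "complex_algebra sc \<longleftrightarrow> vector_space sc \<and>
     (\<forall>z a b. sc z (a * b) = sc z a * b \<and> sc z (a * b) = a * sc z b)"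

text \<open>The free algebra on \<open>'g\<close> is the monoid algebra of the free monoid on \<open>'g\<close>; the monoid
  is written additively because \<^type>\<open>poly_mapping\<close> builds convolution from addition of keys.\<close>

datatype 'g gen_word = Gen_Word (letters: "'g list")

instantiation gen_word :: (type) monoid_add
begin
definition zero_gen_word :: "'a gen_word" where
  "zero_gen_word = Gen_Word []"
definition plus_gen_word :: "'a gen_word \<Rightarrow> 'a gen_word \<Rightarrow> 'a gen_word" where
  "plus_gen_word u v = Gen_Word (letters u @ letters v)"
instance
  by standard (simp_all add: zero_gen_word_def plus_gen_word_def)
end

type_synonym 'g free_algebra = "'g gen_word \<Rightarrow>\<^sub>0 complex"

definition fgen :: "'g \<Rightarrow> 'g free_algebra" where
  "fgen g = Poly_Mapping.single (Gen_Word [g]) 1"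

definition fconst :: "complex \<Rightarrow> 'g free_algebra" where
  "fconst z = Poly_Mapping.single 0 z"

definition free_on :: "'g set \<Rightarrow> 'g free_algebra set" where
  "free_on G = {a. \<forall>w\<in>Poly_Mapping.keys a. set (letters w) \<subseteq> G}"

inductive_set gen_ideal :: "'g set \<Rightarrow> 'g free_algebra set \<Rightarrow> 'g free_algebra set"
  for G :: "'g set" and rels :: "'g free_algebra set" where
  zero: "0 \<in> gen_ideal G rels"
| rel: "r \<in> rels \<Longrightarrow> a \<in> free_on G \<Longrightarrow> b \<in> free_on G \<Longrightarrow> a * r * b \<in> gen_ideal G rels"
| add: "x \<in> gen_ideal G rels \<Longrightarrow> y \<in> gen_ideal G rels \<Longrightarrow> x + y \<in> gen_ideal G rels"

definition free_eval :: "(complex \<Rightarrow> 'a::ring_1 \<Rightarrow> 'a) \<Rightarrow> ('g \<Rightarrow> 'a) \<Rightarrow> 'g free_algebra \<Rightarrow> 'a" where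
  "free_eval sc \<phi> a =
     (\<Sum>w\<in>Poly_Mapping.keys a. sc (Poly_Mapping.lookup a w) (prod_list (map \<phi> (letters w))))"

text \<open>The algebra, with generators \<open>\<phi> g\<close> for \<open>g \<in> G\<close>, is (isomorphic to) the quotient of the
  free algebra on \<open>G\<close> by the two-sided ideal generated by \<open>rels\<close>.\<close>

definition presented_algebra ::
    "(complex \<Rightarrow> 'a::ring_1 \<Rightarrow> 'a) \<Rightarrow> 'g set \<Rightarrow> 'g free_algebra set \<Rightarrow> ('g \<Rightarrow> 'a) \<Rightarrow> bool" where
  "presented_algebra sc G rels \<phi> \<longleftrightarrow>
     complex_algebra sc \<and>
     free_eval sc \<phi> ` free_on G = UNIV \<and>
     {a \<in> free_on G. free_eval sc \<phi> a = 0} = gen_ideal G rels"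


section \<open>Modules and representations\<close>

definition algebra_module ::
    "(complex \<Rightarrow> 'a::ring_1 \<Rightarrow> 'a) \<Rightarrow> (complex \<Rightarrow> 'x::ab_group_add \<Rightarrow> 'x) \<Rightarrow> ('a \<Rightarrow> 'x \<Rightarrow> 'x) \<Rightarrow> bool"
  where
  "algebra_module sc sX \<pi> \<longleftrightarrow>
     vector_space sX \<and>
     (\<forall>a. Vector_Spaces.linear sX sX (\<pi> a)) \<and>
     (\<forall>x. \<pi> 1 x = x) \<and>
     (\<forall>a b x. \<pi> (a * b) x = \<pi> a (\<pi> b x)) \<and>
     (\<forall>a b x. \<pi> (a + b) x = \<pi> a x + \<pi> b x) \<and>
     (\<forall>z a x. \<pi> (sc z a) x = sX z (\<pi> a x))"

text \<open>Here \<open>G\<close> is a group under the multiplication of the ring \<open>'k\<close>.\<close>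

definition group_rep ::
    "'k::ring_1 set \<Rightarrow> (complex \<Rightarrow> 'x::ab_group_add \<Rightarrow> 'x) \<Rightarrow> ('k \<Rightarrow> 'x \<Rightarrow> 'x) \<Rightarrow> bool" where
  "group_rep G sX \<sigma> \<longleftrightarrow>
     vector_space sX \<and>
     (\<forall>g\<in>G. Vector_Spaces.linear sX sX (\<sigma> g)) \<and>
     (\<forall>x. \<sigma> 1 x = x) \<and>
     (\<forall>g\<in>G. \<forall>h\<in>G. \<forall>x. \<sigma> (g * h) x = \<sigma> g (\<sigma> h x))"

definition irreducible_under ::
    "(complex \<Rightarrow> 'x::ab_group_add \<Rightarrow> 'x) \<Rightarrow> ('x \<Rightarrow> 'x) set \<Rightarrow> bool" where
  "irreducible_under sX ops \<longleftrightarrow>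
     (UNIV :: 'x set) \<noteq> {0} \<and>
     (\<forall>Y. module.subspace sX Y \<and> (\<forall>f\<in>ops. f ` Y \<subseteq> Y) \<longrightarrow> Y = {0} \<or> Y = UNIV)"

definition irreducible_module ::
    "(complex \<Rightarrow> 'a::ring_1 \<Rightarrow> 'a) \<Rightarrow> (complex \<Rightarrow> 'x::ab_group_add \<Rightarrow> 'x) \<Rightarrow> ('a \<Rightarrow> 'x \<Rightarrow> 'x) \<Rightarrow> bool"
  where
  "irreducible_module sc sX \<pi> \<longleftrightarrow> algebra_module sc sX \<pi> \<and> irreducible_under sX (range \<pi>)"

definition irreducible_rep ::
    "'k::ring_1 set \<Rightarrow> (complex \<Rightarrow> 'x::ab_group_add \<Rightarrow> 'x) \<Rightarrow> ('k \<Rightarrow> 'x \<Rightarrow> 'x) \<Rightarrow> bool" where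
  "irreducible_rep G sX \<sigma> \<longleftrightarrow> group_rep G sX \<sigma> \<and> irreducible_under sX (\<sigma> ` G)"

text \<open>Trace of an endomorphism of a finite-dimensional space; independent of the basis chosen.\<close>

definition endo_trace ::
    "(complex \<Rightarrow> 'x::ab_group_add \<Rightarrow> 'x) \<Rightarrow> ('x \<Rightarrow> 'x) \<Rightarrow> complex" where
  "endo_trace sX f =
     (let B = (SOME B. \<not> module.dependent sX B \<and> module.span sX B = UNIV)
      in \<Sum>b\<in>B. module.representation sX B (f b) b)"

text \<open>An element of the group algebra of \<open>G\<close> is a finitely supported function on \<open>G\<close>.\<close>

definition group_alg_act ::
    "(complex \<Rightarrow> 'x::ab_group_add \<Rightarrow> 'x) \<Rightarrow> ('k \<Rightarrow> 'x \<Rightarrow> 'x) \<Rightarrow> ('k \<Rightarrow>\<^sub>0 complex) \<Rightarrow> 'x \<Rightarrow> 'x" where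
  "group_alg_act sX \<sigma> a x =
     (\<Sum>g\<in>Poly_Mapping.keys a. sX (Poly_Mapping.lookup a g) (\<sigma> g x))"

text \<open>Tensor product: the free vector space on \<open>'x \<times> 's\<close> modulo the bilinearity relations.\<close>

definition free_scale :: "complex \<Rightarrow> ('i \<Rightarrow>\<^sub>0 complex) \<Rightarrow> ('i \<Rightarrow>\<^sub>0 complex)" where
  "free_scale z a = Poly_Mapping.map (\<lambda>y. z * y) a"

definition tensor_rels ::
    "(complex \<Rightarrow> 'x::ab_group_add \<Rightarrow> 'x) \<Rightarrow> (complex \<Rightarrow> 's::ab_group_add \<Rightarrow> 's) \<Rightarrow>
     ('x \<times> 's \<Rightarrow>\<^sub>0 complex) set" where
  "tensor_rels sX sS =
     (let e = (\<lambda>x s. Poly_Mapping.single (x, s) 1) in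
      {e (x + x') s - e x s - e x' s | x x' s. True} \<union>
      {e x (s + s') - e x s - e x s' | x s s'. True} \<union>
      {e (sX z x) s - free_scale z (e x s) | z x s. True} \<union>
      {e x (sS z s) - free_scale z (e x s) | z x s. True})"

definition tensor_eval ::
    "(complex \<Rightarrow> 't::ab_group_add \<Rightarrow> 't) \<Rightarrow> ('x \<Rightarrow> 's \<Rightarrow> 't) \<Rightarrow> ('x \<times> 's \<Rightarrow>\<^sub>0 complex) \<Rightarrow> 't" where
  "tensor_eval sT tens a =
     (\<Sum>(x, s)\<in>Poly_Mapping.keys a. sT (Poly_Mapping.lookup a (x, s)) (tens x s))"

definition tensor_product ::
    "(complex \<Rightarrow> 'x::ab_group_add \<Rightarrow> 'x) \<Rightarrow> (complex \<Rightarrow> 's::ab_group_add \<Rightarrow> 's) \<Rightarrow>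
     (complex \<Rightarrow> 't::ab_group_add \<Rightarrow> 't) \<Rightarrow> ('x \<Rightarrow> 's \<Rightarrow> 't) \<Rightarrow> bool" where
  "tensor_product sX sS sT tens \<longleftrightarrow>
     vector_space sT \<and>
     range (tensor_eval sT tens) = UNIV \<and>
     {a. tensor_eval sT tens a = 0} = module.span free_scale (tensor_rels sX sS)"

definition tensor_map ::
    "(complex \<Rightarrow> 't::ab_group_add \<Rightarrow> 't) \<Rightarrow> ('x \<Rightarrow> 's \<Rightarrow> 't) \<Rightarrow> ('x \<Rightarrow> 'x) \<Rightarrow> ('s \<Rightarrow> 's) \<Rightarrow> 't \<Rightarrow> 't" where
  "tensor_map sT tens f g =
     (THE F. Vector_Spaces.linear sT sT F \<and> (\<forall>x s. F (tens x s) = tens (f x) (g s)))"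


section \<open>The graded affine Hecke algebra\<close>

datatype ('v, 'u) hecke_gen =
    GenT "('v, 'u) weyl_elt"
  | GenS "'v \<times> 'v \<Rightarrow> complex"

definition hecke_gens :: "('v::real_vector, 'u::real_inner) root_data \<Rightarrow> ('v, 'u) hecke_gen set" where
  "hecke_gens \<Phi> = GenT ` weyl \<Phi> \<union> GenS ` sym_alg \<Phi>"

text \<open>The first two families make \<open>w \<mapsto> t\<^sub>w\<close> an algebra map on the group algebra of \<open>W\<close>, the next
  three make \<open>S(V\<^sup>\<or>)\<close> map in by an algebra map, the last one is the cross relation
  \<open>\<omega> t\<^sub>s - t\<^sub>s s(\<omega>) = c\<^sub>\<alpha> (\<alpha>, \<omega>)\<close>, \<open>s = s\<^sub>\<alpha>\<close>.\<close>

definition hecke_rels ::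
    "('v::real_vector, 'u::real_inner) root_data \<Rightarrow> 'v set \<Rightarrow> ('v \<Rightarrow> real) \<Rightarrow>
     ('v, 'u) hecke_gen free_algebra set" where
  "hecke_rels \<Phi> Simple c =
     {fgen (GenT w_one) - 1} \<union>
     {fgen (GenT w) * fgen (GenT w') - fgen (GenT (w_mult w w')) | w w'.
        w \<in> weyl \<Phi> \<and> w' \<in> weyl \<Phi>} \<union>
     {fgen (GenS (\<lambda>_. z)) - fconst z | z. True} \<union>
     {fgen (GenS p) + fgen (GenS q) - fgen (GenS (\<lambda>\<nu>. p \<nu> + q \<nu>)) | p q.
        p \<in> sym_alg \<Phi> \<and> q \<in> sym_alg \<Phi>} \<union>
     {fgen (GenS p) * fgen (GenS q) - fgen (GenS (\<lambda>\<nu>. p \<nu> * q \<nu>)) | p q.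
        p \<in> sym_alg \<Phi> \<and> q \<in> sym_alg \<Phi>} \<union>
     {fgen (GenS (lin_fun \<Phi> \<omega>)) * fgen (GenT (w_refl \<Phi> \<alpha>))
        - fgen (GenT (w_refl \<Phi> \<alpha>)) * fgen (GenS (lin_fun \<Phi> (cpx_lift (coreflect \<Phi> \<alpha>) \<omega>)))
        - fconst (of_real (c \<alpha>) * cpx_form (pairing \<Phi>) (\<alpha>, 0) \<omega>) | \<alpha> \<omega>. \<alpha> \<in> Simple}"

record ('v, 'u, 'h) hecke_data =
  hscale :: "complex \<Rightarrow> 'h \<Rightarrow> 'h"
  ht :: "('v, 'u) weyl_elt \<Rightarrow> 'h"
  hpoly :: "('v \<times> 'v \<Rightarrow> complex) \<Rightarrow> 'h"
  hstar :: "'h \<Rightarrow> 'h"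

definition graded_hecke_algebra ::
    "('v::real_vector, 'u::real_inner) root_data \<Rightarrow> 'v set \<Rightarrow> ('v \<Rightarrow> real) \<Rightarrow>
     ('v, 'u, 'h::ring_1) hecke_data \<Rightarrow> bool" where
  "graded_hecke_algebra \<Phi> Simple c H \<longleftrightarrow>
     presented_algebra (hscale H) (hecke_gens \<Phi>) (hecke_rels \<Phi> Simple c)
       (case_hecke_gen (ht H) (hpoly H)) \<and>
     inj_on (ht H) (weyl \<Phi>) \<and> \<not> module.dependent (hscale H) (ht H ` weyl \<Phi>) \<and>
     inj_on (hpoly H) (sym_alg \<Phi>)"

text \<open>The conjugate-linear anti-involution \<open>*\<close>; it is determined by its values on generators.\<close>

definition hecke_star ::
    "('v::real_vector, 'u::real_inner) root_data \<Rightarrow> 'v set \<Rightarrow> ('v \<Rightarrow> real) \<Rightarrow>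
     ('v, 'u, 'h::ring_1) hecke_data \<Rightarrow> bool" where
  "hecke_star \<Phi> Pos c H \<longleftrightarrow>
     (\<forall>a b. hstar H (a + b) = hstar H a + hstar H b) \<and>
     (\<forall>z a. hstar H (hscale H z a) = hscale H (cnj z) (hstar H a)) \<and>
     (\<forall>a b. hstar H (a * b) = hstar H b * hstar H a) \<and>
     (\<forall>a. hstar H (hstar H a) = a) \<and>
     (\<forall>w\<in>weyl \<Phi>. hstar H (ht H w) = ht H (w_inv w)) \<and>
     (\<forall>u. hstar H (hpoly H (lin_fun \<Phi> (u, 0))) =
        - hpoly H (lin_fun \<Phi> (u, 0)) +
        (\<Sum>\<beta>\<in>Pos. hscale H (of_real (c \<beta> * pairing \<Phi> \<beta> u)) (ht H (w_refl \<Phi> \<beta>))))"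

text \<open>The centre of the Hecke algebra is the image of \<open>S(V\<^sup>\<or>)\<^sup>W\<close>.\<close>

definition has_central_character ::
    "('v::real_vector, 'u::real_inner) root_data \<Rightarrow> ('v, 'u, 'h::ring_1) hecke_data \<Rightarrow>
     (complex \<Rightarrow> 'x::ab_group_add \<Rightarrow> 'x) \<Rightarrow> ('h \<Rightarrow> 'x \<Rightarrow> 'x) \<Rightarrow> 'v \<times> 'v \<Rightarrow> bool" where
  "has_central_character \<Phi> H sX \<pi> \<nu> \<longleftrightarrow>
     (\<forall>p\<in>sym_alg_inv \<Phi>. \<forall>x. \<pi> (hpoly H p) x = sX (p \<nu>) x)"

definition hermitian_form ::
    "(complex \<Rightarrow> 'x::ab_group_add \<Rightarrow> 'x) \<Rightarrow> ('x \<Rightarrow> 'x \<Rightarrow> complex) \<Rightarrow> bool" where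
  "hermitian_form sX B \<longleftrightarrow>
     (\<forall>x y z. B (x + y) z = B x z + B y z) \<and>
     (\<forall>k x y. B (sX k x) y = k * B x y) \<and>
     (\<forall>x y. B y x = cnj (B x y))"

definition unitary_module ::
    "('v, 'u, 'h) hecke_data \<Rightarrow> (complex \<Rightarrow> 'x::ab_group_add \<Rightarrow> 'x) \<Rightarrow> ('h \<Rightarrow> 'x \<Rightarrow> 'x) \<Rightarrow> bool" where
  "unitary_module H sX \<pi> \<longleftrightarrow>
     (\<exists>B. hermitian_form sX B \<and>
          (\<forall>h x y. B (\<pi> h x) y = B x (\<pi> (hstar H h) y)) \<and>
          (\<forall>x. x \<noteq> 0 \<longrightarrow> Re (B x x) > 0))"


section \<open>The Clifford algebra and the pin cover of the Weyl group\<close>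

text \<open>The generators are the vectors of \<open>V\<^sup>\<or>\<close>; the first two families of relations express that
  \<open>V\<^sup>\<or>\<close> maps in linearly.\<close>

definition clifford_rels :: "('u::real_inner \<times> 'u) free_algebra set" where
  "clifford_rels =
     {fgen \<omega> + fgen \<omega>' - fgen (\<omega> + \<omega>') | \<omega> \<omega>'. True} \<union>
     {fconst z * fgen \<omega> - fgen (cpx_scale z \<omega>) | z \<omega>. True} \<union>
     {fgen \<omega> * fgen \<omega>' + fgen \<omega>' * fgen \<omega> + fconst (2 * cpx_form inner \<omega> \<omega>') | \<omega> \<omega>'. True}"

record ('u, 'k) clifford_data =
  kscale :: "complex \<Rightarrow> 'k \<Rightarrow> 'k"
  kvec :: "'u \<times> 'u \<Rightarrow> 'k"
  keps :: "'k \<Rightarrow> 'k"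
  ktr :: "'k \<Rightarrow> 'k"

definition clifford_algebra :: "('u::real_inner, 'k::ring_1) clifford_data \<Rightarrow> bool" where
  "clifford_algebra K \<longleftrightarrow> presented_algebra (kscale K) UNIV clifford_rels (kvec K)"

text \<open>The automorphism \<open>\<epsilon>\<close> and the antiautomorphism \<open>\<^sup>t\<close>, both determined by their values on \<open>V\<^sup>\<or>\<close>.\<close>

definition clifford_involutions :: "('u::real_inner, 'k::ring_1) clifford_data \<Rightarrow> bool" where
  "clifford_involutions K \<longleftrightarrow>
     Vector_Spaces.linear (kscale K) (kscale K) (keps K) \<and> bij (keps K) \<and>
     keps K 1 = 1 \<and> (\<forall>a b. keps K (a * b) = keps K a * keps K b) \<and>
     (\<forall>\<omega>. keps K (kvec K \<omega>) = - kvec K \<omega>) \<and>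
     Vector_Spaces.linear (kscale K) (kscale K) (ktr K) \<and> bij (ktr K) \<and>
     ktr K 1 = 1 \<and> (\<forall>a b. ktr K (a * b) = ktr K b * ktr K a) \<and>
     (\<forall>\<omega>. ktr K (kvec K \<omega>) = - kvec K \<omega>)"

text \<open>The condition \<open>a\<^sup>t = a\<inverse>\<close> is stated as \<open>a\<^sup>t\<close> being a two-sided inverse of \<open>a\<close>.\<close>

definition pin :: "('u::real_inner, 'k::ring_1) clifford_data \<Rightarrow> 'k set" where
  "pin K = {a. a * ktr K a = 1 \<and> ktr K a * a = 1 \<and>
               (\<forall>\<omega>. keps K a * kvec K \<omega> * ktr K a \<in> range (kvec K))}"

definition pin_proj :: "('u::real_inner, 'k::ring_1) clifford_data \<Rightarrow> 'k \<Rightarrow> 'u \<times> 'u \<Rightarrow> 'u \<times> 'u" where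
  "pin_proj K a \<omega> = (THE \<omega>'. kvec K \<omega>' = keps K a * kvec K \<omega> * ktr K a)"

definition weyl_cover ::
    "('v::real_vector, 'u::real_inner) root_data \<Rightarrow> ('u, 'k::ring_1) clifford_data \<Rightarrow> 'k set" where
  "weyl_cover \<Phi> K = {a \<in> pin K. \<exists>w\<in>weyl \<Phi>. pin_proj K a = cpx_lift (snd w)}"

definition weyl_proj ::
    "('v::real_vector, 'u::real_inner) root_data \<Rightarrow> ('u, 'k::ring_1) clifford_data \<Rightarrow>
     'k \<Rightarrow> ('v, 'u) weyl_elt" where
  "weyl_proj \<Phi> K a = (THE w. w \<in> weyl \<Phi> \<and> pin_proj K a = cpx_lift (snd w))"

definition f_elt ::
    "('v::real_vector, 'u::real_inner) root_data \<Rightarrow> ('u, 'k::ring_1) clifford_data \<Rightarrow> 'v \<Rightarrow> 'k" where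
  "f_elt \<Phi> K \<alpha> = kvec K ((1 / norm (coroot \<Phi> \<alpha>)) *\<^sub>R coroot \<Phi> \<alpha>, 0)"

definition cover_act ::
    "('v::real_vector, 'u::real_inner) root_data \<Rightarrow> ('v, 'u, 'h) hecke_data \<Rightarrow>
     ('u, 'k::ring_1) clifford_data \<Rightarrow> (complex \<Rightarrow> 't::ab_group_add \<Rightarrow> 't) \<Rightarrow> ('x \<Rightarrow> 's \<Rightarrow> 't) \<Rightarrow>
     ('h \<Rightarrow> 'x \<Rightarrow> 'x) \<Rightarrow> ('k \<Rightarrow> 's \<Rightarrow> 's) \<Rightarrow> 'k \<Rightarrow> 't \<Rightarrow> 't" where
  "cover_act \<Phi> H K sT tens \<pi> \<gamma> a =
     tensor_map sT tens (\<pi> (ht H (weyl_proj \<Phi> K a))) (\<gamma> a)"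

definition intertwiners ::
    "'k set \<Rightarrow> (complex \<Rightarrow> 'x::ab_group_add \<Rightarrow> 'x) \<Rightarrow> ('k \<Rightarrow> 'x \<Rightarrow> 'x) \<Rightarrow>
     (complex \<Rightarrow> 'y::ab_group_add \<Rightarrow> 'y) \<Rightarrow> ('k \<Rightarrow> 'y \<Rightarrow> 'y) \<Rightarrow> ('x \<Rightarrow> 'y) set" where
  "intertwiners G sX \<sigma> sY \<rho> =
     {\<phi>. Vector_Spaces.linear sX sY \<phi> \<and> (\<forall>g\<in>G. \<forall>x. \<phi> (\<sigma> g x) = \<rho> g (\<phi> x))}"

definition inversion_pairs ::
    "('v::real_vector, 'u::real_inner) root_data \<Rightarrow> 'v set \<Rightarrow> ('v \<times> 'v) set" where
  "inversion_pairs \<Phi> Pos = {(\<alpha>, \<beta>). \<alpha> \<in> Pos \<and> \<beta> \<in> Pos \<and> - reflect \<Phi> \<alpha> \<beta> \<in> Pos}"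

definition omega_cover ::
    "('v::real_vector, 'u::real_inner) root_data \<Rightarrow> 'v set \<Rightarrow> ('v \<Rightarrow> real) \<Rightarrow>
     ('u, 'k::ring_1) clifford_data \<Rightarrow> 'k \<Rightarrow>\<^sub>0 complex" where
  "omega_cover \<Phi> Pos c K =
     (\<Sum>(\<alpha>, \<beta>)\<in>inversion_pairs \<Phi> Pos.
        Poly_Mapping.single (f_elt \<Phi> K \<alpha> * f_elt \<Phi> K \<beta>)
          (of_real (- (1/4) * (c \<alpha> * c \<beta> * dual_norm \<Phi> \<alpha> * dual_norm \<Phi> \<beta>))))"

definition c_scalar ::
    "('v::real_vector, 'u::real_inner) root_data \<Rightarrow> 'v set \<Rightarrow> ('v \<Rightarrow> real) \<Rightarrow>
     ('u, 'k::ring_1) clifford_data \<Rightarrow> (complex \<Rightarrow> 'm::ab_group_add \<Rightarrow> 'm) \<Rightarrow> ('k \<Rightarrow> 'm \<Rightarrow> 'm) \<Rightarrow>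
     complex" where
  "c_scalar \<Phi> Pos c K sU \<sigma> =
     1/4 * (\<Sum>\<alpha>\<in>Pos. of_real ((c \<alpha>)\<^sup>2 * dual_inner \<Phi> \<alpha> \<alpha>))
     - 1/4 * (\<Sum>(\<alpha>, \<beta>)\<in>{(\<alpha>, \<beta>) \<in> inversion_pairs \<Phi> Pos. \<alpha> \<noteq> \<beta>}.
         of_real (c \<alpha> * c \<beta> * dual_norm \<Phi> \<alpha> * dual_norm \<Phi> \<beta>)
         * (endo_trace sU (\<sigma> (f_elt \<Phi> K \<alpha> * f_elt \<Phi> K \<beta>)) / endo_trace sU (\<sigma> 1)))"

end

theory Submission
  imports Defs "HOL-Computational_Algebra.Fundamental_Theorem_Algebra"
begin

text \<open>On \<open>X \<otimes> S\<close> consider the Dirac operator \<open>D = \<Sum>\<^sub>e (e - e\<^sup>*)/2 \<otimes> e\<close>, the sum over an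
  orthonormal basis of \<open>V\<^sub>0\<^sup>\<or>\<close>, and \<open>A = 1/2 \<Sum>\<^sub>\<beta>\<^sub>>\<^sub>0 c\<^sub>\<beta> |\<beta>| t\<^sub>s\<^sub>\<beta> \<otimes> f\<^sub>\<beta>\<close>. Then \<open>D + A = \<Sum>\<^sub>e e \<otimes> e\<close> squares to
  \<open>-\<langle>\<nu>, \<nu>\<rangle>\<close>, and \<open>DA + AD = 0\<close> because \<open>t\<^sub>w\<close> intertwines \<open>\<omega> - \<omega>\<^sup>*\<close> with \<open>w(\<omega>) - w(\<omega>)\<^sup>*\<close>; hence
  \<open>D\<^sup>2 = -\<langle>\<nu>, \<nu>\<rangle> - A\<^sup>2\<close>. The operator \<open>-A\<^sup>2\<close> is the action of \<open>\<Omega>\<close>: the pairs with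
  \<open>s\<^sub>\<alpha>(\<beta>) > 0\<close> cancel. Since \<open>D\<^sup>2\<close> commutes with the pin cover of \<open>W\<close>, so does \<open>\<Omega>\<close>, which
  acts by a scalar on \<open>U\<close> by Schur's lemma; the scalar is found by taking traces. For a positive definite
  invariant form \<open>D\<close> is self-adjoint, so \<open>D\<^sup>2 \<ge> 0\<close> on the image of \<open>U\<close>, which is the inequality.\<close>

section \<open>Linear extension from free vector spaces\<close>

text \<open>X, S and U are not assumed finite-dimensional, and S carries no given Hermitian form;
  this shapes the proof. S is finite-dimensional because finitely many anticommuting vectors with
  square -1 enlarge a finite set to a finite set. A positive form on X \<otimes> S is obtained by
  declaring a basis of S orthonormal and then averaging over one Clifford basis vector at a time.
  Finiteness of U does not go through X: since W is finite, the orbit of a single tensor under the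
  cover lies in a finite-dimensional space, and U embeds there. Only then are Schur's lemma and
  traces available. The constants have one origin: half of e minus its star differs from e by half
  of the reflection sum e + star e, and this half squares to the 1/4 in \<Omega>. The norms
  |\<beta>| enter because the sum of (\<beta>, e) e over an orthonormal basis represents \<beta>,
  and is |\<beta>| times the unit coroot. As \<nu> may be complex, reality of its square is part of
  the result; it comes out of the eigenvalue equations.\<close>

definition lin_ext :: "(complex \<Rightarrow> 'z::ab_group_add \<Rightarrow> 'z) \<Rightarrow> ('i \<Rightarrow> 'z) \<Rightarrow> ('i \<Rightarrow>\<^sub>0 complex) \<Rightarrow> 'z" where
  "lin_ext s f a = (\<Sum>k\<in>Poly_Mapping.keys a. s (Poly_Mapping.lookup a k) (f k))"

text \<open>Evaluation in free algebras, in tensor products and in group algebras is in each case a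
  linear extension, so linearity is proved once, for \<open>lin_ext\<close>.\<close>

lemma free_eval_lin_ext: "free_eval s \<phi> = lin_ext s (\<lambda>w. prod_list (map \<phi> (letters w)))"
  by (simp add: fun_eq_iff free_eval_def lin_ext_def)

lemma tensor_eval_lin_ext: "tensor_eval s f = lin_ext s (\<lambda>(x, y). f x y)"
  by (auto simp: fun_eq_iff tensor_eval_def lin_ext_def intro!: sum.cong)

lemma group_alg_act_lin_ext: "group_alg_act s \<sigma> a x = lin_ext s (\<lambda>g. \<sigma> g x) a"
  by (simp add: group_alg_act_def lin_ext_def)

lemma poly_mapping_eq_sum_single:
  "a = (\<Sum>k\<in>Poly_Mapping.keys a. Poly_Mapping.single k (Poly_Mapping.lookup a k))"
proof (rule poly_mapping_eqI)
  fix k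
  have "(\<Sum>i\<in>Poly_Mapping.keys a. Poly_Mapping.lookup (Poly_Mapping.single i (Poly_Mapping.lookup a i)) k)
      = (\<Sum>i\<in>Poly_Mapping.keys a. if i = k then Poly_Mapping.lookup a k else 0)"
    by (rule sum.cong) (auto simp: lookup_single when_def)
  also have "\<dots> = Poly_Mapping.lookup a k"
    by (simp add: in_keys_iff)
  finally show "Poly_Mapping.lookup a k = Poly_Mapping.lookup
      (\<Sum>i\<in>Poly_Mapping.keys a. Poly_Mapping.single i (Poly_Mapping.lookup a i)) k"
    by (simp add: lookup_sum)
qed

lemma lookup_free_scale [simp]: "Poly_Mapping.lookup (free_scale z a) k = z * Poly_Mapping.lookup a k"
  by (simp add: free_scale_def Poly_Mapping.map.rep_eq when_def)

lemma free_scale_single: "free_scale z (Poly_Mapping.single k y) = Poly_Mapping.single k (z * y)"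
  by (rule poly_mapping_eqI) (simp add: lookup_single when_def)

lemma vector_space_free_scale: "vector_space (free_scale :: complex \<Rightarrow> ('i \<Rightarrow>\<^sub>0 complex) \<Rightarrow> _)"
  by unfold_locales (auto intro!: poly_mapping_eqI simp: lookup_add algebra_simps)

context
  fixes s :: "complex \<Rightarrow> 'z::ab_group_add \<Rightarrow> 'z"
  assumes vs: "vector_space s"
begin

interpretation vector_space s by (fact vs)

text \<open>Keys can cancel in a sum, so two evaluations are compared over a common finite set
  containing all supports.\<close>

lemma lin_ext_superset:
  assumes "finite A" "Poly_Mapping.keys a \<subseteq> A"
  shows "lin_ext s f a = (\<Sum>k\<in>A. s (Poly_Mapping.lookup a k) (f k))"
  unfolding lin_ext_def using assms by (intro sum.mono_neutral_left) (auto simp: in_keys_iff)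

lemma lin_ext_add: "lin_ext s f (a + b) = lin_ext s f a + lin_ext s f b"
proof -
  let ?A = "Poly_Mapping.keys a \<union> Poly_Mapping.keys b"
  have "lin_ext s f (a + b) = (\<Sum>k\<in>?A. s (Poly_Mapping.lookup (a + b) k) (f k))"
    by (rule lin_ext_superset) (auto simp: keys_add)
  also have "\<dots> = (\<Sum>k\<in>?A. s (Poly_Mapping.lookup a k) (f k)) + (\<Sum>k\<in>?A. s (Poly_Mapping.lookup b k) (f k))"
    by (simp add: lookup_add scale_left_distrib sum.distrib)
  also have "\<dots> = lin_ext s f a + lin_ext s f b"
    by (simp add: lin_ext_superset[of ?A])
  finally show ?thesis .
qed

lemma lin_ext_single: "lin_ext s f (Poly_Mapping.single k z) = s z (f k)"
  by (subst lin_ext_superset[of "{k}"]) auto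

lemma lin_ext_scale: "lin_ext s f (free_scale z a) = s z (lin_ext s f a)"
  by (subst lin_ext_superset[of "Poly_Mapping.keys a"])
    (auto simp: in_keys_iff lin_ext_def scale_sum_right)

lemma lin_ext_zero [simp]: "lin_ext s f 0 = 0"
  by (simp add: lin_ext_def)

lemma lin_ext_sum: "lin_ext s f (\<Sum>i\<in>I. a i) = (\<Sum>i\<in>I. lin_ext s f (a i))"
  by (induction I rule: infinite_finite_induct) (simp_all add: lin_ext_add)

lemma lin_ext_uminus: "lin_ext s f (- a) = - lin_ext s f a"
  using lin_ext_add[of f a "- a"] by (simp add: eq_neg_iff_add_eq_0 add.commute)

lemma lin_ext_diff: "lin_ext s f (a - b) = lin_ext s f a - lin_ext s f b"
  using lin_ext_add[of f a "- b"] by (simp add: lin_ext_uminus)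

end

section \<open>Presented algebras\<close>

lemma complex_algebraD:
  assumes "complex_algebra sc"
  shows "vector_space sc" "sc z a * b = sc z (a * b)" "a * sc z b = sc z (a * b)"
  using assms unfolding complex_algebra_def by metis+

lemma letters_zero [simp]: "letters 0 = []"
  by (simp add: zero_gen_word_def)

lemma letters_add [simp]: "letters (u + v) = letters u @ letters v"
  by (simp add: plus_gen_word_def)

context
  fixes sc :: "complex \<Rightarrow> 'a::ring_1 \<Rightarrow> 'a"
  assumes alg: "complex_algebra sc"
begin

interpretation vector_space sc by (rule complex_algebraD[OF alg])

lemmas sc_vs = complex_algebraD(1)[OF alg]

lemma free_eval_mult: "free_eval sc \<phi> (a * b) = free_eval sc \<phi> a * free_eval sc \<phi> b"
proof -
  let ?L = "free_eval sc \<phi>" and ?s = Poly_Mapping.single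
  let ?A = "\<lambda>k. ?s k (Poly_Mapping.lookup a k)" and ?B = "\<lambda>k. ?s k (Poly_Mapping.lookup b k)"
  \<comment> \<open>On monomials, concatenation of words becomes multiplication of their values; the
    rest is bilinearity.\<close>
  have single: "?L (?s k x * ?s l y) = ?L (?s k x) * ?L (?s l y)" for k l x y
    by (simp add: free_eval_lin_ext mult_single lin_ext_single[OF sc_vs] complex_algebraD(2,3)[OF alg] mult.commute)
  have "?L (a * b) = ?L ((\<Sum>k\<in>Poly_Mapping.keys a. ?A k) * (\<Sum>l\<in>Poly_Mapping.keys b. ?B l))"
    by (simp flip: poly_mapping_eq_sum_single)
  also have "\<dots> = (\<Sum>k\<in>Poly_Mapping.keys a. ?L (?A k)) * (\<Sum>l\<in>Poly_Mapping.keys b. ?L (?B l))"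
    by (simp add: sum_product free_eval_lin_ext lin_ext_sum[OF sc_vs] single[unfolded free_eval_lin_ext])
  also have "\<dots> = ?L (\<Sum>k\<in>Poly_Mapping.keys a. ?A k) * ?L (\<Sum>l\<in>Poly_Mapping.keys b. ?B l)"
    by (simp add: free_eval_lin_ext lin_ext_sum[OF sc_vs])
  also have "\<dots> = ?L a * ?L b"
    by (simp flip: poly_mapping_eq_sum_single)
  finally show ?thesis .
qed

lemma free_eval_simps:
  "free_eval sc \<phi> (a + b) = free_eval sc \<phi> a + free_eval sc \<phi> b"
  "free_eval sc \<phi> (a - b) = free_eval sc \<phi> a - free_eval sc \<phi> b"
  "free_eval sc \<phi> (fgen g) = \<phi> g"
  "free_eval sc \<phi> (fconst z) = sc z 1"
  "free_eval sc \<phi> 1 = 1"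
  by (simp_all add: free_eval_lin_ext lin_ext_add[OF sc_vs] lin_ext_diff[OF sc_vs] fgen_def
      fconst_def lin_ext_single[OF sc_vs] flip: single_one)

end

lemma presented_algebra_rel:
  assumes "presented_algebra sc G rels \<phi>" "r \<in> rels"
  shows "free_eval sc \<phi> r = 0"
proof -
  have "1 \<in> free_on G" by (simp add: free_on_def)
  then have "1 * r * 1 \<in> gen_ideal G rels" using assms(2) by (intro gen_ideal.rel)
  then show ?thesis using assms(1) unfolding presented_algebra_def by auto
qed

text \<open>Evaluation of the free algebra is onto, so an element is a finite sum of scaled products
  of generators.\<close>

lemma presented_algebra_induct [consumes 1, case_names scale one add mult gen]:
  assumes "presented_algebra sc G rels \<phi>"
    and scale: "\<And>z a. P a \<Longrightarrow> P (sc z a)"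
    and one: "P 1"
    and add: "\<And>a b. P a \<Longrightarrow> P b \<Longrightarrow> P (a + b)"
    and mult: "\<And>a b. P a \<Longrightarrow> P b \<Longrightarrow> P (a * b)"
    and gen: "\<And>g. g \<in> G \<Longrightarrow> P (\<phi> g)"
  shows "P a"
proof -
  have alg: "complex_algebra sc" using assms(1) by (simp add: presented_algebra_def)
  interpret vector_space sc by (rule complex_algebraD[OF alg])
  \<comment> \<open>Empty sums are covered because 0 is the scalar 0 times 1.\<close>
  have zero: "P 0" using scale[OF one, of 0] by simp
  have "a \<in> free_eval sc \<phi> ` free_on G"
    using assms(1) by (simp add: presented_algebra_def)
  then obtain b where b: "b \<in> free_on G" "a = free_eval sc \<phi> b"
    by blast
  have prod: "P (prod_list (map \<phi> ws))" if "set ws \<subseteq> G" for ws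
    using that by (induction ws) (auto intro: one mult gen)
  have sum: "P (sum f A)" if "\<And>w. w \<in> A \<Longrightarrow> P (f w)" for A and f :: "'b gen_word \<Rightarrow> 'a"
    using that by (induction A rule: infinite_finite_induct) (auto intro: zero add)
  show ?thesis
    unfolding b(2) free_eval_def using b(1) by (intro sum scale prod) (simp add: free_on_def)
qed

section \<open>Tensor products\<close>

locale tensor =
  X: vector_space sX + S: vector_space sS + T: vector_space sT
  for sX :: "complex \<Rightarrow> 'x::ab_group_add \<Rightarrow> 'x"
    and sS :: "complex \<Rightarrow> 's::ab_group_add \<Rightarrow> 's"
    and sT :: "complex \<Rightarrow> 't::ab_group_add \<Rightarrow> 't" +
  fixes tens :: "'x \<Rightarrow> 's \<Rightarrow> 't"
  assumes tensor: "tensor_product sX sS sT tens"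
begin

lemma tensor_eval_rel: "r \<in> tensor_rels sX sS \<Longrightarrow> tensor_eval sT tens r = 0"
proof -
  interpret free: vector_space "free_scale :: complex \<Rightarrow> ('x \<times> 's \<Rightarrow>\<^sub>0 complex) \<Rightarrow> _"
    by (rule vector_space_free_scale)
  show "r \<in> tensor_rels sX sS \<Longrightarrow> tensor_eval sT tens r = 0"
    using tensor free.span_base[of r "tensor_rels sX sS"] unfolding tensor_product_def by blast
qed

lemma tens_add_left: "tens (x + x') s = tens x s + tens x' s"
proof -
  let ?e = "\<lambda>x s. Poly_Mapping.single (x, s) (1::complex)"
  have "?e (x + x') s - ?e x s - ?e x' s \<in> tensor_rels sX sS"
    unfolding tensor_rels_def Let_def by blast
  from tensor_eval_rel[OF this] show ?thesis
    by (simp add: tensor_eval_lin_ext lin_ext_add[OF T.vector_space_axioms]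
        lin_ext_diff[OF T.vector_space_axioms] lin_ext_single[OF T.vector_space_axioms] algebra_simps)
qed

lemma tens_add_right: "tens x (s + s') = tens x s + tens x s'"
proof -
  let ?e = "\<lambda>x s. Poly_Mapping.single (x, s) (1::complex)"
  have "?e x (s + s') - ?e x s - ?e x s' \<in> tensor_rels sX sS"
    unfolding tensor_rels_def Let_def by blast
  from tensor_eval_rel[OF this] show ?thesis
    by (simp add: tensor_eval_lin_ext lin_ext_add[OF T.vector_space_axioms]
        lin_ext_diff[OF T.vector_space_axioms] lin_ext_single[OF T.vector_space_axioms] algebra_simps)
qed

lemma tens_scale_left: "tens (sX z x) s = sT z (tens x s)"
proof -
  let ?e = "\<lambda>x s. Poly_Mapping.single (x, s) (1::complex)"
  have "?e (sX z x) s - free_scale z (?e x s) \<in> tensor_rels sX sS"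
    unfolding tensor_rels_def Let_def by blast
  from tensor_eval_rel[OF this] show ?thesis
    by (simp add: tensor_eval_lin_ext lin_ext_diff[OF T.vector_space_axioms] free_scale_single
        lin_ext_single[OF T.vector_space_axioms] algebra_simps)
qed

lemma tens_scale_right: "tens x (sS z s) = sT z (tens x s)"
proof -
  let ?e = "\<lambda>x s. Poly_Mapping.single (x, s) (1::complex)"
  have "?e x (sS z s) - free_scale z (?e x s) \<in> tensor_rels sX sS"
    unfolding tensor_rels_def Let_def by blast
  from tensor_eval_rel[OF this] show ?thesis
    by (simp add: tensor_eval_lin_ext lin_ext_diff[OF T.vector_space_axioms] free_scale_single
        lin_ext_single[OF T.vector_space_axioms] algebra_simps)
qed

lemma tens_sum_right: "tens x (\<Sum>i\<in>I. f i) = (\<Sum>i\<in>I. tens x (f i))"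
proof (induction I rule: infinite_finite_induct)
  case (insert i I)
  then show ?case by (simp add: tens_add_right)
qed (use tens_scale_right[of x 0 0] in auto)

lemma tens_zero [simp]: "tens 0 s = 0"
  using tens_scale_left[of 0 0 s] by simp

text \<open>A scalar can be absorbed into the left factor, and 0 is a pure tensor, so neither needs
  a case of its own.\<close>

lemma tensor_induct [case_names pure add]:
  assumes pure: "\<And>x s. P (tens x s)" and add: "\<And>t t'. P t \<Longrightarrow> P t' \<Longrightarrow> P (t + t')"
  shows "P t"
proof -
  have "t \<in> range (tensor_eval sT tens)"
    using tensor by (simp add: tensor_product_def)
  then obtain a where a: "t = tensor_eval sT tens a" by blast
  have "P 0" using pure[of 0 0] by simp
  then have sum: "P (sum f A)" if "\<And>i. i \<in> A \<Longrightarrow> P (f i)" for A and f :: "'x \<times> 's \<Rightarrow> 't"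
    using that by (induction A rule: infinite_finite_induct) (auto intro: add)
  show ?thesis
    unfolding a tensor_eval_def by (rule sum) (auto simp: pure simp flip: tens_scale_left)
qed

lemma linear_eq_on_tens:
  assumes "Vector_Spaces.linear sT sZ F" "Vector_Spaces.linear sT sZ G"
    and "\<And>x s. F (tens x s) = G (tens x s)"
  shows "F t = G t"
  using assms by (induction t rule: tensor_induct) (auto simp: Vector_Spaces.linear_iff)

text \<open>A bilinear map kills the defining relations, hence the whole kernel of evaluation, and
  therefore descends. All maps out of the tensor product are built this way.\<close>

lemma tensor_universal:
  assumes vs: "vector_space sZ"
    and f: "\<And>x x' s. f (x + x') s = f x s + f x' s" "\<And>x s s'. f x (s + s') = f x s + f x s'"
      "\<And>z x s. f (sX z x) s = sZ z (f x s)" "\<And>z x s. f x (sS z s) = sZ z (f x s)"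
  obtains F where "Vector_Spaces.linear sT sZ F" "\<And>x s. F (tens x s) = f x s"
proof -
  interpret Z: vector_space sZ by (fact vs)
  interpret free: vector_space "free_scale :: complex \<Rightarrow> ('x \<times> 's \<Rightarrow>\<^sub>0 complex) \<Rightarrow> _"
    by (rule vector_space_free_scale)
  let ?T = "tensor_eval sT tens" and ?Z = "tensor_eval sZ f"
  note lins = tensor_eval_lin_ext lin_ext_add[OF vs] lin_ext_diff[OF vs] lin_ext_scale[OF vs]
    lin_ext_single[OF vs] lin_ext_zero[OF vs] lin_ext_add[OF T.vector_space_axioms]
    lin_ext_diff[OF T.vector_space_axioms] lin_ext_scale[OF T.vector_space_axioms]
    lin_ext_single[OF T.vector_space_axioms]
  have "free.span (tensor_rels sX sS) \<subseteq> {a. ?Z a = 0}"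
  proof (rule free.span_minimal)
    show "tensor_rels sX sS \<subseteq> {a. ?Z a = 0}"
      unfolding tensor_rels_def Let_def by (auto simp: lins f free_scale_single)
    show "free.subspace {a. ?Z a = 0}"
      by (auto simp: free.subspace_def lins)
  qed
  then have ker: "?Z a = 0" if "?T a = 0" for a
    using tensor that unfolding tensor_product_def by blast
  have wd: "?Z a = ?Z b" if "?T a = ?T b" for a b
    using ker[of "a - b"] that by (simp add: lins)
  \<comment> \<open>By \<open>wd\<close> the value does not depend on the representative that is
    chosen.\<close>
  define F where "F t = ?Z (SOME a. ?T a = t)" for t
  have F: "F (?T a) = ?Z a" for a
    unfolding F_def by (rule wd) (rule someI[of "\<lambda>b. ?T b = ?T a"], simp)
  have rep: "\<exists>a. t = ?T a" for t
    using tensor unfolding tensor_product_def by blast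
  have "F (t + u) = F t + F u" "F (sT z t) = sZ z (F t)" for t u z
  proof -
    obtain a b where ab: "t = ?T a" "u = ?T b" using rep by metis
    have "t + u = ?T (a + b)" "sT z t = ?T (free_scale z a)"
      by (simp_all add: ab lins)
    then show "F (t + u) = F t + F u" "F (sT z t) = sZ z (F t)"
      by (simp_all only: F ab) (simp_all add: lins)
  qed
  then have lin: "Vector_Spaces.linear sT sZ F"
    by (simp add: Vector_Spaces.linear_iff vs T.vector_space_axioms)
  have "F (tens x s) = f x s" for x s
    using F[of "Poly_Mapping.single (x, s) 1"] by (simp add: lins)
  with lin show thesis by (rule that)
qed

lemma
  assumes f: "Vector_Spaces.linear sX sX f" and g: "Vector_Spaces.linear sS sS g"
  shows linear_tensor_map: "Vector_Spaces.linear sT sT (tensor_map sT tens f g)"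
    and tensor_map_tens: "tensor_map sT tens f g (tens x s) = tens (f x) (g s)"
proof -
  interpret f: Vector_Spaces.linear sX sX f by (fact f)
  interpret g: Vector_Spaces.linear sS sS g by (fact g)
  obtain F where F: "Vector_Spaces.linear sT sT F" "\<And>x s. F (tens x s) = tens (f x) (g s)"
    by (rule tensor_universal[OF T.vector_space_axioms, of "\<lambda>x s. tens (f x) (g s)"])
      (simp_all add: f.add g.add f.scale g.scale tens_add_left tens_add_right
        tens_scale_left tens_scale_right)
  have "\<exists>!F. Vector_Spaces.linear sT sT F \<and> (\<forall>x s. F (tens x s) = tens (f x) (g s))"
  proof (intro ex1I[of _ F] conjI allI F)
    fix G assume G: "Vector_Spaces.linear sT sT G \<and> (\<forall>x s. G (tens x s) = tens (f x) (g s))"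
    show "G = F"
      by (rule ext, rule linear_eq_on_tens[of sT]) (use F G in auto)
  qed
  from theI'[OF this] show "Vector_Spaces.linear sT sT (tensor_map sT tens f g)"
    and "tensor_map sT tens f g (tens x s) = tens (f x) (g s)"
    unfolding tensor_map_def by auto
qed

text \<open>A finite basis of S splits X \<otimes> S into copies of X; \<open>q b\<close> is the
  projection to the copy at \<open>b\<close>. Forms on X can then be moved to X \<otimes> S
  coordinate by coordinate.\<close>

lemma tensor_coordinates:
  assumes B: "S.independent B" "S.span B = UNIV" and fin: "finite B"
  obtains q where "\<And>b. b \<in> B \<Longrightarrow> Vector_Spaces.linear sT sX (q b)"
    "\<And>b x s. b \<in> B \<Longrightarrow> q b (tens x s) = sX (S.representation B s b) x"
    "\<And>t. t = (\<Sum>b\<in>B. tens (q b t) b)"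
proof -
  have "\<exists>F. Vector_Spaces.linear sT sX F \<and> (\<forall>x s. F (tens x s) = sX (S.representation B s b) x)" for b
  proof -
    obtain F where "Vector_Spaces.linear sT sX F" "\<And>x s. F (tens x s) = sX (S.representation B s b) x"
      by (rule tensor_universal[OF X.vector_space_axioms, of "\<lambda>x s. sX (S.representation B s b) x"])
        (simp_all add: X.scale_right_distrib X.scale_left_distrib S.representation_add
          S.representation_scale B mult.commute)
    then show ?thesis by blast
  qed
  then obtain q where q: "\<And>b. Vector_Spaces.linear sT sX (q b)"
    "\<And>b x s. q b (tens x s) = sX (S.representation B s b) x" by metis
  have "t = (\<Sum>b\<in>B. tens (q b t) b)" for t
  proof (induction t rule: tensor_induct)
    case (pure x s)
    have "(\<Sum>b\<in>B. tens (q b (tens x s)) b) = tens x (\<Sum>b\<in>B. sS (S.representation B s b) b)"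
      by (simp add: tens_sum_right q tens_scale_left tens_scale_right)
    then show ?case
      using S.sum_representation_eq[OF B(1) _ fin, of s] B(2) by simp
  next
    case (add t u)
    have "q b (t + u) = q b t + q b u" for b
      using q(1)[of b] by (simp add: Vector_Spaces.linear_iff)
    then have "(\<Sum>b\<in>B. tens (q b (t + u)) b) = (\<Sum>b\<in>B. tens (q b t) b) + (\<Sum>b\<in>B. tens (q b u) b)"
      by (simp add: tens_add_left sum.distrib)
    with add show ?case by simp
  qed
  with q show thesis by (intro that)
qed

end

section \<open>Hermitian forms\<close>

definition pos_form :: "(complex \<Rightarrow> 'x::ab_group_add \<Rightarrow> 'x) \<Rightarrow> ('x \<Rightarrow> 'x \<Rightarrow> complex) \<Rightarrow> bool" where
  "pos_form s B \<longleftrightarrow> hermitian_form s B \<and> (\<forall>x. x \<noteq> 0 \<longrightarrow> Re (B x x) > 0)"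

lemma hermitian_formD:
  assumes "hermitian_form s B"
  shows "B (x + y) z = B x z + B y z" "B x (y + z) = B x y + B x z"
    "B (s k x) y = k * B x y" "B x (s k y) = cnj k * B x y" "B y x = cnj (B x y)"
proof -
  have *: "B (x + y) z = B x z + B y z" "B (s k x) y = k * B x y" "B y x = cnj (B x y)" for x y z k
    using assms unfolding hermitian_form_def by blast+
  show "B (x + y) z = B x z + B y z" "B (s k x) y = k * B x y" "B y x = cnj (B x y)" by (fact *)+
  show "B x (y + z) = B x y + B x z" "B x (s k y) = cnj k * B x y"
    by (subst *(3), simp add: *(1,2) flip: *(3))+
qed

lemma hermitian_form_more:
  assumes "hermitian_form s B"
  shows "B 0 y = 0" "B x 0 = 0" "B (- x) y = - B x y" "B x (- y) = - B x y"
    "B (x - x') y = B x y - B x' y" "B x (y - y') = B x y - B x y'"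
    "B (\<Sum>i\<in>I. f i) y = (\<Sum>i\<in>I. B (f i) y)" "B x (\<Sum>i\<in>I. g i) = (\<Sum>i\<in>I. B x (g i))"
proof -
  note a = hermitian_formD(1,2)[OF assms]
  show z: "B 0 y = 0" "B x 0 = 0" for x y using a(1)[of 0 0] a(2)[of _ 0 0] by simp_all
  show n: "B (- x) y = - B x y" "B x (- y) = - B x y" for x y
    using a(1)[of x "- x" y] a(2)[of x y "- y"] by (simp_all add: z eq_neg_iff_add_eq_0 add.commute)
  show "B (x - x') y = B x y - B x' y" "B x (y - y') = B x y - B x y'"
    using a(1)[of x "- x'" y] a(2)[of x y "- y'"] by (simp_all add: n)
  show "B (\<Sum>i\<in>I. f i) y = (\<Sum>i\<in>I. B (f i) y)" "B x (\<Sum>i\<in>I. g i) = (\<Sum>i\<in>I. B x (g i))"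
    by (induction I rule: infinite_finite_induct) (simp_all add: z a)
qed

lemma hermitian_form_self:
  assumes "hermitian_form s B"
  shows "B x x = of_real (Re (B x x))"
  using hermitian_formD(5)[OF assms, of x x] by (simp add: complex_eq_iff)

lemma pos_form_nonneg:
  assumes "pos_form s B"
  shows "Re (B x x) \<ge> 0"
proof (cases "x = 0")
  case True
  have "hermitian_form s B" using assms by (simp add: pos_form_def)
  from hermitian_form_more(1)[OF this] True show ?thesis by simp
qed (use assms in \<open>auto simp: pos_form_def intro: less_imp_le\<close>)

text \<open>The basis of S is declared orthonormal: the form is the sum of \<open>B\<close> over the
  coordinates. Operators acting on the left factor act on each coordinate, which preserves their
  adjoints. Compatibility with the Clifford action is arranged later, in
  \<open>invariant_form\<close>.\<close>

lemma (in tensor) pos_form_tensor: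
  assumes B: "pos_form sX B"
    and adj: "\<And>h. h \<in> A \<Longrightarrow> Vector_Spaces.linear sX sX (f h)"
      "\<And>h x y. h \<in> A \<Longrightarrow> B (f h x) y = B x (f (star h) y)" "\<And>h. h \<in> A \<Longrightarrow> star h \<in> A"
    and fin: "finite F" "S.span F = UNIV"
  obtains C where "pos_form sT C"
    "\<And>h t u. h \<in> A \<Longrightarrow> C (tensor_map sT tens (f h) (\<lambda>s. s) t) u = C t (tensor_map sT tens (f (star h)) (\<lambda>s. s) u)"
proof -
  obtain b where b: "S.independent b" "b \<subseteq> F" "F \<subseteq> S.span b"
    using S.maximal_independent_subset[of F] by blast
  have fb: "finite b" by (rule finite_subset[OF b(2) fin(1)])
  have sp: "S.span b = UNIV"
    using S.span_mono[OF b(3)] fin(2) by (simp add: S.span_span top.extremum_unique)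
  obtain q where q: "\<And>i. i \<in> b \<Longrightarrow> Vector_Spaces.linear sT sX (q i)"
    "\<And>i x s. i \<in> b \<Longrightarrow> q i (tens x s) = sX (S.representation b s i) x"
    "\<And>t. t = (\<Sum>i\<in>b. tens (q i t) i)"
    by (rule tensor_coordinates[OF b(1) sp fb]) (rule that)
  define C where "C t u = (\<Sum>i\<in>b. B (q i t) (q i u))" for t u
  have herm: "hermitian_form sX B" using B by (simp add: pos_form_def)
  note bil = hermitian_formD(1-4)[OF herm]
  have idl: "Vector_Spaces.linear sS sS (\<lambda>s. s)"
    by (simp add: Vector_Spaces.linear_iff S.vector_space_axioms)
  have q': "q i (t + u) = q i t + q i u" "q i (sT z t) = sX z (q i t)" if "i \<in> b" for i t u z
    using q(1)[OF that] by (simp_all add: Vector_Spaces.linear_iff)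
  have "C (t + t') u = C t u + C t' u" "C (sT z t) u = z * C t u" for t t' u z
    by (simp_all add: C_def q' bil sum.distrib sum_distrib_left)
  moreover have "C u t = cnj (C t u)" for t u
    unfolding C_def cnj_sum by (rule sum.cong) (simp_all flip: hermitian_formD(5)[OF herm])
  moreover have "Re (C t t) > 0" if "t \<noteq> 0" for t
  proof -
    \<comment> \<open>Definiteness: the coordinates determine the tensor.\<close>
    have "t = 0" if "\<forall>i\<in>b. q i t = 0"
      by (subst q(3)) (simp add: that)
    with that obtain i where "i \<in> b" "q i t \<noteq> 0" by blast
    then show ?thesis using B fb unfolding C_def Re_sum
      by (intro sum_pos2[of b i]) (auto simp: pos_form_nonneg[OF B], auto simp: pos_form_def)
  qed
  ultimately have "pos_form sT C"
    unfolding pos_form_def hermitian_form_def by blast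
  moreover have "C (tensor_map sT tens (f h) (\<lambda>s. s) t) u = C t (tensor_map sT tens (f (star h)) (\<lambda>s. s) u)"
    if h: "h \<in> A" for h t u
  proof -
    have "q i (tensor_map sT tens (f k) (\<lambda>s. s) v) = f k (q i v)" if k: "k \<in> A" and i: "i \<in> b" for i v k
    proof (induction v rule: tensor_induct)
      case (pure x s)
      show ?case using adj(1)[OF k]
        unfolding tensor_map_tens[OF adj(1)[OF k] idl] q(2)[OF i]
        by (simp add: Vector_Spaces.linear_iff)
    next
      case (add v w)
      then show ?case
        using linear_tensor_map[OF adj(1)[OF k] idl] adj(1)[OF k]
        by (simp add: Vector_Spaces.linear_iff q' i)
    qed
    then show ?thesis unfolding C_def
      using adj h by (intro sum.cong) auto
  qed
  ultimately show thesis by (rule that)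
qed

section \<open>Eigenvalues and traces\<close>

locale finite_span = vector_space s
  for s :: "complex \<Rightarrow> 'x::ab_group_add \<Rightarrow> 'x" +
  fixes F :: "'x set"
  assumes finite_F: "finite F" and span_F: "span F = UNIV"
begin

lemma finite_independent: "independent B \<Longrightarrow> finite B"
  using independent_span_bound[OF finite_F, of B] by (simp add: span_F)

text \<open>If each vector were outside the span of its predecessors, all initial segments would be
  independent, which the finite spanning set forbids.\<close>

lemma krylov_dependent:
  fixes w :: "nat \<Rightarrow> 'x"
  shows "\<exists>n. w n \<in> span (w ` {..<n})"
proof (rule ccontr)
  assume "\<nexists>n. w n \<in> span (w ` {..<n})"
  then have new: "w n \<notin> span (w ` {..<n})" for n by blast
  have "independent (w ` {..<n}) \<and> card (w ` {..<n}) = n" for n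
  proof (induction n)
    case (Suc n)
    have "w n \<notin> w ` {..<n}" 
      using new[of n] span_base[of "w n" "w ` {..<n}"] by blast
    then have "card (insert (w n) (w ` {..<n})) = Suc n" using Suc by simp
    moreover have "independent (insert (w n) (w ` {..<n}))"
      using Suc independent_insertI[OF new] by blast
    ultimately show ?case unfolding lessThan_Suc image_insert by blast
  qed (simp add: independent_empty)
  \<comment> \<open>One vector more than \<open>F\<close> has elements gives the
    contradiction.\<close>
  from this[of "Suc (card F)"] independent_span_bound[OF finite_F, of "w ` {..<Suc (card F)}"]
  show False by (simp add: span_F)
qed

text \<open>Take a nonzero polynomial p of least degree with p(A) v = 0. It has a root z, so p = (X
  - z) r, and r(A) v is nonzero by minimality; it is the eigenvector.\<close>

lemma eigenvector_exists:
  assumes A: "Vector_Spaces.linear s s A" and nz: "v \<noteq> (0::'x)"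
  obtains z x where "x \<noteq> 0" "A x = s z x"
proof -
  interpret A: Vector_Spaces.linear s s A by (fact A)
  define w where "w n = (A ^^ n) v" for n
  have w_simps: "w 0 = v" "A (w n) = w (Suc n)" for n by (simp_all add: w_def)
  \<comment> \<open>This is p(A) v, as a function of p for the fixed vector v.\<close>
  define act where "act p = (\<Sum>i\<le>degree p. s (coeff p i) (w i))" for p :: "complex poly"
  have act: "act p = (\<Sum>i\<le>n. s (coeff p i) (w i))" if "degree p \<le> n" for p n
    unfolding act_def using that
    by (intro sum.mono_neutral_left) (auto simp: coeff_eq_0)
  have act_diff: "act (p - q) = act p - act q" for p q
  proof -
    define n where "n = max (degree p) (degree q)"
    have "degree p \<le> n" "degree q \<le> n" "degree (p - q) \<le> n"
      by (auto simp: n_def intro: degree_diff_le)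
    then show ?thesis by (simp add: act[of _ n] scale_left_diff_distrib sum_subtractf)
  qed
  have act_smult: "act (smult a p) = s a (act p)" for a p
    by (simp add: act[OF degree_smult_le] act_def scale_sum_right)
  have act_add: "act (p + q) = act p + act q" for p q
    using act_diff[of p "smult (-1) q"] act_smult[of "-1" q] by simp
  have act_pCons: "act (pCons 0 p) = A (act p)" for p
  proof -
    have "act (pCons 0 p) = (\<Sum>i\<le>Suc (degree p). s (coeff (pCons 0 p) i) (w i))"
      by (rule act) (simp add: degree_pCons_le)
    also have "\<dots> = A (act p)"
      by (simp only: sum.atMost_Suc_shift)
        (simp add: act_def A.sum A.scale w_simps)
    finally show ?thesis .
  qed
  have act_monom: "act (monom a n) = s a (w n)" for a n
  proof -
    have "act (monom a n) = (\<Sum>i\<le>n. s (coeff (monom a n) i) (w i))"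
      by (rule act) (rule degree_monom_le)
    also have "\<dots> = (\<Sum>i\<le>n. if i = n then s a (w n) else 0)"
      by (rule sum.cong) auto
    finally show ?thesis by simp
  qed
  obtain n where n: "w n \<in> span (w ` {..<n})" using krylov_dependent by blast
  \<comment> \<open>The dependence of \<open>w n\<close> on its predecessors is recorded by a
    polynomial of degree below n, so that subtracting it from the monomial of degree n leaves
    something nonzero.\<close>
  have "\<exists>q. (\<forall>i\<ge>n. coeff q i = 0) \<and> w n = act q"
    using n
  proof (induction rule: span_induct_alt)
    case base
    show ?case by (rule exI[of _ 0]) (simp add: act_def)
  next
    case (step c x y)
    from step(1) obtain i where i: "i < n" "x = w i" by auto
    from step(2) obtain q where q: "\<forall>i\<ge>n. coeff q i = 0" "y = act q" by blast
    show ?case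
      by (rule exI[of _ "monom c i + q"]) (use i q in \<open>auto simp: act_add act_monom\<close>)
  qed
  then obtain q where q: "\<forall>i\<ge>n. coeff q i = 0" "w n = act q" by blast
  define p0 where "p0 = monom 1 n - q"
  have "coeff p0 n = 1" using q by (simp add: p0_def)
  then have "p0 \<noteq> 0" by auto
  moreover have "act p0 = 0" by (simp add: p0_def act_diff act_monom q)
  ultimately obtain p where p: "p \<noteq> 0" "act p = 0"
    and min: "\<And>r. r \<noteq> 0 \<Longrightarrow> act r = 0 \<Longrightarrow> degree p \<le> degree r"
    using ex_has_least_nat[of "\<lambda>p. p \<noteq> 0 \<and> act p = 0" p0 degree] by blast
  have "degree p \<noteq> 0"
  proof
    assume "degree p = 0"
    then obtain a where "p = [:a:]" by (rule degree_eq_zeroE)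
    with p nz show False by (simp add: act_def w_simps)
  qed
  then have "\<not> constant (poly p)" by (simp add: constant_degree)
  then obtain z where "poly p z = 0" using fundamental_theorem_of_algebra by blast
  then obtain r where r: "p = [:-z, 1:] * r" by (auto simp: poly_eq_0_iff_dvd)
  then have "r \<noteq> 0" using p(1) by auto
  then have "degree r < degree p"
    unfolding r by (subst degree_mult_eq) auto
  with \<open>r \<noteq> 0\<close> have ne: "act r \<noteq> 0" using min[of r] by force
  have "p = pCons 0 r - smult z r" by (simp add: r)
  with p(2) have "A (act r) = s z (act r)" by (simp add: act_diff act_pCons act_smult)
  with ne show thesis by (rule that)
qed

text \<open>The eigenspace for one eigenvalue is nonzero and stable under all operators that commute
  with \<open>A\<close>.\<close>

lemma schur:
  assumes irr: "irreducible_under s ops"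
    and ops: "\<And>f. f \<in> ops \<Longrightarrow> Vector_Spaces.linear s s f"
    and A: "Vector_Spaces.linear s s A" and comm: "\<And>f x. f \<in> ops \<Longrightarrow> A (f x) = f (A x)"
  obtains z where "\<And>x. A x = s z x"
proof -
  interpret A: Vector_Spaces.linear s s A by (fact A)
  obtain v :: 'x where "v \<noteq> 0" using irr unfolding irreducible_under_def by blast
  then obtain z x where x: "x \<noteq> 0" "A x = s z x" by (rule eigenvector_exists[OF A])
  let ?Y = "{y. A y = s z y}"
  have "subspace ?Y"
    by (auto simp: subspace_def A.zero A.add A.scale scale_right_distrib mult.commute)
  moreover have "f ` ?Y \<subseteq> ?Y" if "f \<in> ops" for f
  proof -
    interpret f: Vector_Spaces.linear s s f using ops that .
    show ?thesis by (auto simp: comm[OF that] f.scale)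
  qed
  ultimately have "?Y = {0} \<or> ?Y = UNIV"
    using irr unfolding irreducible_under_def by blast
  with x have "?Y = UNIV" by blast
  then show thesis by (intro that[of z]) blast
qed

text \<open>This is the choice made inside \<open>endo_trace\<close>. As all traces are read in this
  one basis, linearity of the trace is linearity of coordinates.\<close>

definition trace_basis :: "'x set" where
  "trace_basis = (SOME B. independent B \<and> span B = UNIV)"

lemma trace_basis: "independent trace_basis" "span trace_basis = UNIV" "finite trace_basis"
proof -
  obtain B where "independent B" "UNIV \<subseteq> span B"
    using maximal_independent_subset[of UNIV] by blast
  then have "\<exists>B. independent B \<and> span B = UNIV" by (auto intro!: exI[of _ B])
  from someI_ex[OF this] show "independent trace_basis" "span trace_basis = UNIV"
    by (simp_all add: trace_basis_def)
  then show "finite trace_basis" by (simp add: finite_independent)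
qed

lemma endo_trace_alt: "endo_trace s f = (\<Sum>b\<in>trace_basis. representation trace_basis (f b) b)"
  by (simp add: endo_trace_def trace_basis_def Let_def)

lemma endo_trace_add: "endo_trace s (\<lambda>x. f x + g x) = endo_trace s f + endo_trace s g"
  by (simp add: endo_trace_alt representation_add trace_basis sum.distrib)

lemma endo_trace_scale: "endo_trace s (\<lambda>x. s z (f x)) = z * endo_trace s f"
  by (simp add: endo_trace_alt representation_scale trace_basis sum_distrib_left)

lemma endo_trace_sum: "endo_trace s (\<lambda>x. \<Sum>i\<in>I. f i x) = (\<Sum>i\<in>I. endo_trace s (f i))"
  by (induction I rule: infinite_finite_induct)
    (simp_all add: endo_trace_add, simp_all add: endo_trace_alt representation_zero)

lemma endo_trace_ident:
  assumes "v \<noteq> (0 :: 'x)"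
  shows "endo_trace s (\<lambda>x. x) \<noteq> 0"
proof -
  have "endo_trace s (\<lambda>x. x) = of_nat (card trace_basis)"
    by (simp add: endo_trace_alt representation_basis[OF trace_basis(1)])
  moreover have "trace_basis \<noteq> {}"
    using trace_basis(2) assms by (metis UNIV_I empty_iff insert_iff span_empty)
  ultimately show ?thesis using trace_basis(3) by simp
qed

end

section \<open>Root systems\<close>

lemma orthonormal_basis_exists:
  fixes G :: "'u::real_inner set"
  assumes "finite G" "span G = UNIV"
  shows "\<exists>E. finite E \<and> span E = (UNIV :: 'u set) \<and>
           (\<forall>e\<in>E. \<forall>e'\<in>E. inner e e' = (if e = e' then 1 else 0))"
proof -
  obtain C where C: "finite C" "span C = span G" "pairwise orthogonal C"
    using basis_orthogonal[OF assms(1)] by blast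
  \<comment> \<open>The orthogonal set may contain 0, which cannot be normalised; dropping it does
    not change the span.\<close>
  let ?n = "\<lambda>x. (1 / norm x) *\<^sub>R x" and ?C = "C - {0}"
  have "x \<in> span (?n ` ?C)" if "x \<in> ?C" for x
  proof -
    have "norm x *\<^sub>R ?n x \<in> span (?n ` ?C)"
      using that by (intro span_scale span_base) blast
    then show ?thesis using that by simp
  qed
  then have "?C \<subseteq> span (?n ` ?C)" by blast
  then have "C \<subseteq> span (?n ` ?C)" using span_zero by blast
  then have "span (?n ` ?C) = UNIV"
    using span_minimal[of C "span (?n ` ?C)"] subspace_span C(2) assms(2) by blast
  moreover have "inner (?n x) (?n y) = (if ?n x = ?n y then 1 else 0)" if "x \<in> ?C" "y \<in> ?C" for x y
  proof (cases "x = y")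
    case True
    then show ?thesis using that by (simp add: power2_norm_eq_inner[symmetric] power2_eq_square)
  next
    case False
    then have "inner x y = 0" using C(3) that by (auto simp: pairwise_def orthogonal_def)
    then have *: "inner (?n x) (?n y) = 0" by simp
    have "?n x \<noteq> ?n y"
    proof
      assume "?n x = ?n y"
      with * have "inner (?n x) (?n x) = 0" by simp
      with that show False by simp
    qed
    with * show ?thesis by simp
  qed
  ultimately show ?thesis
    using C(1) by (intro exI[of _ "?n ` ?C"]) blast
qed

locale rooted =
  fixes \<Phi> :: "('v::real_vector, 'u::real_inner) root_data"
    and Pos Simple :: "'v set" and c :: "'v \<Rightarrow> real"
  assumes rs: "root_system \<Phi>" and ps: "positive_system \<Phi> Pos Simple"
    and inv: "inner_invariant \<Phi>" and par: "param_invariant \<Phi> c"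
begin

abbreviation "R \<equiv> roots \<Phi>"
abbreviation "cr \<equiv> coroot \<Phi>"
abbreviation "pr \<equiv> pairing \<Phi>"
abbreviation "W \<equiv> weyl \<Phi>"
abbreviation "sr \<equiv> reflect \<Phi>"
abbreviation "csr \<equiv> coreflect \<Phi>"

lemma bil: "bilinear pr" using rs by (simp add: root_system_def)

lemmas pr_simps = bilinear_ladd[OF bil] bilinear_radd[OF bil] bilinear_lmul[OF bil]
  bilinear_rmul[OF bil] bilinear_lneg[OF bil] bilinear_rneg[OF bil] bilinear_lzero[OF bil]
  bilinear_rzero[OF bil] bilinear_lsub[OF bil] bilinear_rsub[OF bil]

lemma linear_pr: "linear (pr v)" using bil by (simp add: bilinear_def)

lemma pr_sum_left: "pr (\<Sum>i\<in>I. f i) u = (\<Sum>i\<in>I. pr (f i) u)"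
  using bil linear_sum[of "\<lambda>x. pr x u" f I] by (simp add: bilinear_def)

lemma finite_R: "finite R" using rs by (simp add: root_system_def)
lemma span_R: "span R = UNIV" using rs by (simp add: root_system_def)
lemma pr_coroot: "\<alpha> \<in> R \<Longrightarrow> pr \<alpha> (cr \<alpha>) = 2" using rs by (simp add: root_system_def)
lemma coroot_nz: "\<alpha> \<in> R \<Longrightarrow> cr \<alpha> \<noteq> 0" using pr_coroot[of \<alpha>] by (auto simp: pr_simps)
lemma root_nz: "\<alpha> \<in> R \<Longrightarrow> \<alpha> \<noteq> 0" using pr_coroot[of \<alpha>] by (auto simp: pr_simps)
lemma sr_root: "\<alpha> \<in> R \<Longrightarrow> \<beta> \<in> R \<Longrightarrow> sr \<alpha> \<beta> \<in> R"
  using rs unfolding root_system_def by blast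

lemma Pos_R: "\<alpha> \<in> Pos \<Longrightarrow> \<alpha> \<in> R" using ps by (auto simp: positive_system_def)
lemma Simple_Pos: "\<alpha> \<in> Simple \<Longrightarrow> \<alpha> \<in> Pos" using ps by (auto simp: positive_system_def)
lemma R_cases: "\<alpha> \<in> R \<Longrightarrow> \<alpha> \<in> Pos \<or> - \<alpha> \<in> Pos" using ps by (auto simp: positive_system_def)
lemma neg_Pos_R: "- \<alpha> \<in> Pos \<Longrightarrow> \<alpha> \<in> R"
  using ps unfolding positive_system_def by (metis UnI2 imageI minus_minus)
lemma Pos_not_neg: "\<alpha> \<in> Pos \<Longrightarrow> - \<alpha> \<notin> Pos"
  using ps unfolding positive_system_def by (metis IntI emptyE imageI minus_minus)
lemma neg_R: "\<alpha> \<in> R \<Longrightarrow> - \<alpha> \<in> R"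
  using R_cases[of \<alpha>] neg_Pos_R[of "- \<alpha>"] Pos_R by auto
lemma finite_Pos: "finite Pos"
  by (rule finite_subset[OF _ finite_R]) (auto intro: Pos_R)

lemma coroot_span: "\<exists>G. finite G \<and> span G = (UNIV :: 'u set)"
  using rs by (auto simp: root_system_def)

section \<open>An orthonormal basis, and roots viewed as vectors of
  \<open>V\<^sub>0\<^sup>\<or>\<close>\<close>

definition E :: "'u set" where
  "E = (SOME E. finite E \<and> span E = UNIV \<and>
     (\<forall>e\<in>E. \<forall>e'\<in>E. inner e e' = (if e = e' then 1 else 0)))"

lemma finite_E: "finite E" and span_E: "span E = UNIV"
  and inner_E: "e \<in> E \<Longrightarrow> e' \<in> E \<Longrightarrow> inner e e' = (if e = e' then 1 else 0)"
proof -
  have "\<exists>E. finite E \<and> span E = (UNIV :: 'u set) \<and>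
     (\<forall>e\<in>E. \<forall>e'\<in>E. inner e e' = (if e = e' then 1 else 0))"
    using coroot_span orthonormal_basis_exists by blast
  from someI_ex[OF this]
  show "finite E" "span E = UNIV" "e \<in> E \<Longrightarrow> e' \<in> E \<Longrightarrow> inner e e' = (if e = e' then 1 else 0)"
    unfolding E_def by blast+
qed

lemma expand_E: "u = (\<Sum>e\<in>E. inner u e *\<^sub>R e)"
proof -
  have "u \<in> span E" by (simp add: span_E)
  then show ?thesis
  proof (induction rule: span_induct_alt)
    case (step k x y)
    have "(\<Sum>e\<in>E. inner x e *\<^sub>R e) = (\<Sum>e\<in>E. if e = x then x else 0)"
      using step(1) by (intro sum.cong) (auto simp: inner_E)
    also have "\<dots> = x" using step(1) finite_E by simp
    finally have *: "(\<Sum>e\<in>E. inner x e *\<^sub>R e) = x" .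
    have "(\<Sum>e\<in>E. inner (k *\<^sub>R x + y) e *\<^sub>R e)
        = k *\<^sub>R (\<Sum>e\<in>E. inner x e *\<^sub>R e) + (\<Sum>e\<in>E. inner y e *\<^sub>R e)"
      by (simp add: inner_add_left scaleR_add_left sum.distrib scaleR_sum_right)
    with step(2) show ?case by (simp add: *)
  qed simp
qed

text \<open>The vector that represents the functional \<open>pr v\<close> for the inner product.
  This identification of the two spaces turns \<open>dual_inner\<close> into the given inner product
  and is equivariant for W.\<close>

definition vec :: "'v \<Rightarrow> 'u" where
  "vec v = (\<Sum>e\<in>E. pr v e *\<^sub>R e)"

lemma inner_vec: "inner (vec v) u = pr v u"
proof -
  have "pr v u = pr v (\<Sum>e\<in>E. inner u e *\<^sub>R e)" by (simp flip: expand_E)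
  also have "\<dots> = (\<Sum>e\<in>E. inner u e * pr v e)"
    by (simp add: linear_sum[OF linear_pr] linear_cmul[OF linear_pr])
  finally show ?thesis
    by (simp add: vec_def inner_sum_left inner_commute[of u] mult.commute)
qed

lemma inner_eqI: "(\<And>x. inner u x = inner u' x) \<Longrightarrow> u = (u' :: 'u)"
  by (metis inner_diff_left inner_eq_zero_iff right_minus_eq)

lemma vec_eqI: "(\<And>x. inner u x = pr v x) \<Longrightarrow> vec v = u"
  by (rule inner_eqI) (simp add: inner_vec)

lemma vec_scaleR [simp]: "vec (k *\<^sub>R v) = k *\<^sub>R vec v"
  by (rule vec_eqI) (simp add: inner_vec pr_simps)

lemma vec_minus [simp]: "vec (- v) = - vec v"
  by (rule vec_eqI) (simp add: inner_vec pr_simps)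

lemma vec_inj: "vec v = vec w \<Longrightarrow> v = w"
proof -
  assume "vec v = vec w"
  then have "pr v u = pr w u" for u by (metis inner_vec)
  then have "pr v = pr w" by blast
  then show "v = w" using rs unfolding root_system_def bij_betw_def by (auto dest: injD)
qed

section \<open>The Weyl group: isometry, faithfulness and finiteness\<close>

lemma w_refl_W: "\<alpha> \<in> R \<Longrightarrow> w_refl \<Phi> \<alpha> \<in> W"
  using weyl.refl[OF _ weyl.one, of \<alpha> \<Phi>] by (simp add: w_mult_def w_one_def)

lemma W_mult: "w \<in> W \<Longrightarrow> w' \<in> W \<Longrightarrow> w_mult w w' \<in> W"
proof (induction rule: weyl.induct)
  case one
  then show ?case by (simp add: w_mult_def w_one_def)
next
  case (refl \<alpha> w)
  then show ?case using weyl.refl[of \<alpha> \<Phi> "w_mult w w'"] by (simp add: w_mult_def o_assoc)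
qed

lemma csr_coroot: "\<alpha> \<in> R \<Longrightarrow> csr \<alpha> (cr \<alpha>) = - cr \<alpha>"
  by (simp add: coreflect_def pr_coroot scaleR_2)

lemma sr_self: "\<alpha> \<in> R \<Longrightarrow> sr \<alpha> \<alpha> = - \<alpha>"
  by (simp add: reflect_def pr_coroot scaleR_2)

lemma sr_sr: "\<alpha> \<in> R \<Longrightarrow> sr \<alpha> (sr \<alpha> v) = v"
  by (simp add: reflect_def pr_coroot pr_simps scaleR_2 algebra_simps)

lemma csr_csr: "\<alpha> \<in> R \<Longrightarrow> csr \<alpha> (csr \<alpha> v) = v"
  by (simp add: coreflect_def pr_coroot pr_simps scaleR_2 algebra_simps)

lemma w_inv_refl: "\<alpha> \<in> R \<Longrightarrow> w_inv (w_refl \<Phi> \<alpha>) = w_refl \<Phi> \<alpha>"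
  by (simp add: w_inv_def w_refl_def) (auto intro!: inv_equality simp: sr_sr csr_csr)

lemma W_linear: "w \<in> W \<Longrightarrow> linear (fst w) \<and> linear (snd w)"
proof (induction rule: weyl.induct)
  case one
  then show ?case by (simp add: w_one_def linear_id[unfolded id_def])
next
  case (refl \<alpha> w)
  have "linear (sr \<alpha>)" "linear (csr \<alpha>)"
    by (auto intro!: linearI simp: reflect_def coreflect_def pr_simps algebra_simps)
  with refl show ?case
    unfolding w_mult_def w_refl_def fst_conv snd_conv by (blast intro: linear_compose)
qed

lemma W_pairing: "w \<in> W \<Longrightarrow> pr (fst w v) (snd w u) = pr v u"
proof (induction arbitrary: v u rule: weyl.induct)
  case one
  then show ?case by (simp add: w_one_def)
next
  case (refl \<alpha> w)
  have "pr (sr \<alpha> v) (csr \<alpha> u) = pr v u" for v u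
    using refl(1) by (simp add: reflect_def coreflect_def pr_simps pr_coroot algebra_simps)
  with refl show ?case by (simp add: w_mult_def w_refl_def)
qed

lemma W_roots: "w \<in> W \<Longrightarrow> \<alpha> \<in> R \<Longrightarrow> fst w \<alpha> \<in> R"
  by (induction arbitrary: \<alpha> rule: weyl.induct) (simp_all add: w_one_def w_mult_def w_refl_def sr_root)

lemma W_bij: "w \<in> W \<Longrightarrow> bij (fst w) \<and> bij (snd w)"
proof (induction rule: weyl.induct)
  case one
  then show ?case by (simp add: w_one_def bij_id[unfolded id_def])
next
  case (refl \<alpha> w)
  have "bij (sr \<alpha>)" "bij (csr \<alpha>)"
    using refl(1) by (auto intro!: involuntory_imp_bij sr_sr csr_csr)
  with refl show ?case
    unfolding w_mult_def w_refl_def fst_conv snd_conv by (blast intro: bij_comp)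
qed

lemma W_inner: "w \<in> W \<Longrightarrow> inner (snd w x) (snd w y) = inner x y"
  using inv by (simp add: inner_invariant_def)

text \<open>Elements of W preserve both the pairing and the inner product, so it suffices to test
  against vectors of the form \<open>snd w u\<close>.\<close>

lemma vec_W: "w \<in> W \<Longrightarrow> vec (fst w v) = snd w (vec v)"
proof (rule vec_eqI)
  fix x assume w: "w \<in> W"
  obtain u where "x = snd w u" using W_bij[OF w] by (metis bij_pointE)
  then show "inner (snd w (vec v)) x = pr (fst w v) x"
    by (simp add: W_inner W_pairing w inner_vec)
qed

text \<open>The action on \<open>V\<^sub>0\<close> is recovered through the injective equivariant
  map \<open>vec\<close>. This is what makes \<open>weyl_proj\<close> well defined, since a pin
  element only shows its action on coroots.\<close>

lemma W_eqI: "w \<in> W \<Longrightarrow> w' \<in> W \<Longrightarrow> snd w = snd w' \<Longrightarrow> w = w'"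
  by (rule prod_eqI) (auto intro!: ext vec_inj simp: vec_W)

text \<open>An element of W is determined by the map it induces on the finite set of roots.\<close>

lemma finite_W: "finite W"
proof (rule finite_imageD)
  let ?r = "\<lambda>w. restrict (fst w) R"
  have "?r ` W \<subseteq> R \<rightarrow>\<^sub>E R" by (intro image_subsetI) (simp add: W_roots)
  then show "finite (?r ` W)" by (rule finite_subset) (rule finite_PiE[OF finite_R finite_R])
  show "inj_on ?r W"
  proof (rule inj_onI)
    fix w w' assume w: "w \<in> W" "w' \<in> W" and eq: "?r w = ?r w'"
    have on_R: "fst w \<alpha> = fst w' \<alpha>" if "\<alpha> \<in> R" for \<alpha>
      using fun_cong[OF eq, of \<alpha>] that by simp
    have "fst w v = fst w' v" for v
      by (rule linear_eq_on[of "fst w" "fst w'" v R]) (use w on_R in \<open>auto simp: W_linear span_R\<close>)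
    then have eq_vec: "snd w (vec v) = snd w' (vec v)" for v
      by (simp add: w flip: vec_W)
    \<comment> \<open>Perfectness of the pairing makes \<open>vec\<close> surjective, so agreement
      on \<open>vec v\<close> for all v is agreement everywhere.\<close>
    have "snd w u = snd w' u" for u
    proof -
      have "(\<lambda>x. inner u x) \<in> {f. linear f}"
        by (auto intro!: linearI simp: inner_add_right)
      moreover have "range (\<lambda>v u. pr v u) = {f. linear f}"
        using rs unfolding root_system_def by (elim conjE) (erule bij_betw_imp_surj_on)
      ultimately have "(\<lambda>x. inner u x) \<in> range (\<lambda>v u. pr v u)" by simp
      then obtain v where v: "(\<lambda>x. inner u x) = pr v" by auto
      have "vec v = u" by (rule vec_eqI) (use fun_cong[OF v] in simp)
      with eq_vec show ?thesis by blast
    qed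
    then have "snd w = snd w'" by (rule ext)
    then show "w = w'" by (rule W_eqI[OF w])
  qed
qed

text \<open>Every pair of dual bases gives this value, and \<open>E\<close> paired with itself is
  such a pair, so the choice in \<open>dual_inner\<close> is a genuine one.\<close>

lemma dual_inner_vec: "dual_inner \<Phi> v w = inner (vec v) (vec w)"
proof -
  have val: "(\<Sum>i<n. pr v (a i) * pr w (b i)) = inner (vec v) (vec w)" if ab: "dual_bases n a b" for n a b
  proof -
    have ab': "inj_on a {..<n}" "span (a ` {..<n}) = UNIV"
      "\<And>i j. i < n \<Longrightarrow> j < n \<Longrightarrow> inner (a i) (b j) = (if i = j then 1 else 0)"
      using ab by (auto simp: dual_bases_def)
    have "vec w \<in> span (a ` {..<n})" by (simp add: ab')
    then have "vec w = (\<Sum>i<n. inner (vec w) (b i) *\<^sub>R a i)"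
    proof (induction rule: span_induct_alt)
      case (step k x y)
      from step(1) obtain j where j: "j < n" "x = a j" by auto
      have "(\<Sum>i<n. inner x (b i) *\<^sub>R a i) = (\<Sum>i<n. if i = j then x else 0)"
        using j by (intro sum.cong) (auto simp: ab')
      also have "\<dots> = x" using j by simp
      finally have *: "(\<Sum>i<n. inner x (b i) *\<^sub>R a i) = x" .
      have "(\<Sum>i<n. inner (k *\<^sub>R x + y) (b i) *\<^sub>R a i)
          = k *\<^sub>R (\<Sum>i<n. inner x (b i) *\<^sub>R a i) + (\<Sum>i<n. inner y (b i) *\<^sub>R a i)"
        by (simp add: inner_add_left scaleR_add_left sum.distrib scaleR_sum_right)
      with step(2) show ?case by (simp add: *)
    qed simp
    then have "inner (vec v) (vec w) = inner (vec v) (\<Sum>i<n. inner (vec w) (b i) *\<^sub>R a i)"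
      by simp
    then show ?thesis by (simp add: inner_sum_right inner_vec mult.commute)
  qed
  obtain f where f: "bij_betw f {..<card E} E"
    using ex_bij_betw_nat_finite[OF finite_E] by (auto simp: atLeast0LessThan)
  have "independent E"
  proof (rule pairwise_orthogonal_independent)
    show "pairwise orthogonal E" by (auto simp: pairwise_def orthogonal_def inner_E)
    show "0 \<notin> E" using inner_E[of 0 0] by auto
  qed
  moreover have "inner (f i) (f j) = (if i = j then 1 else 0)" if "i < card E" "j < card E" for i j
  proof -
    have "f i \<in> E" "f j \<in> E" "f i = f j \<longleftrightarrow> i = j"
      using f that by (auto simp: bij_betw_def inj_on_def)
    then show ?thesis by (simp add: inner_E)
  qed
  ultimately have "dual_bases (card E) f f"
    using f span_E by (simp add: dual_bases_def bij_betw_def)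
  then have ex: "\<exists>p. case p of (n, a, b) \<Rightarrow> dual_bases n a (b :: nat \<Rightarrow> 'u)"
    by (intro exI[of _ "(card E, f, f)"]) simp
  define p where "p = (SOME (n, a, b). dual_bases n a (b :: nat \<Rightarrow> 'u))"
  have "case p of (n, a, b) \<Rightarrow> dual_bases n a b"
    unfolding p_def by (rule someI_ex) (fact ex)
  then show ?thesis
    unfolding dual_inner_def p_def[symmetric] by (cases p) (simp add: val)
qed

section \<open>Norms of roots, and roots as multiples of coroots\<close>

lemma dual_norm_vec: "dual_norm \<Phi> v = norm (vec v)"
  by (simp add: dual_norm_def dual_inner_vec norm_eq_sqrt_inner)

text \<open>The reflection is an isometry that negates the coroot. Comparing the inner product of x
  and the coroot with that of their images leaves an equation that determines (\<alpha>, x).\<close>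

lemma vec_coroot: "\<alpha> \<in> R \<Longrightarrow> vec \<alpha> = (2 / (norm (cr \<alpha>))\<^sup>2) *\<^sub>R cr \<alpha>"
proof (rule vec_eqI)
  fix x assume \<alpha>: "\<alpha> \<in> R"
  have "inner (csr \<alpha> x) (csr \<alpha> (cr \<alpha>)) = inner x (cr \<alpha>)"
    using W_inner[OF w_refl_W[OF \<alpha>]] by (simp add: w_refl_def)
  then have "- inner (csr \<alpha> x) (cr \<alpha>) = inner x (cr \<alpha>)"
    by (simp add: csr_coroot[OF \<alpha>])
  then have "pr \<alpha> x * (norm (cr \<alpha>))\<^sup>2 = 2 * inner (cr \<alpha>) x"
    by (simp add: coreflect_def inner_diff_left inner_diff_right power2_norm_eq_inner inner_commute)
  then show "inner ((2 / (norm (cr \<alpha>))\<^sup>2) *\<^sub>R cr \<alpha>) x = pr \<alpha> x"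
    using coroot_nz[OF \<alpha>] by (simp add: field_simps)
qed

lemma norm_vec: "\<alpha> \<in> R \<Longrightarrow> norm (vec \<alpha>) = 2 / norm (cr \<alpha>)"
  using coroot_nz[of \<alpha>] by (simp add: vec_coroot power2_eq_square)

lemma coroot_vec: "\<alpha> \<in> R \<Longrightarrow> cr \<alpha> = (2 / inner (vec \<alpha>) (vec \<alpha>)) *\<^sub>R vec \<alpha>"
  using coroot_nz[of \<alpha>] by (simp add: vec_coroot power2_norm_eq_inner[symmetric] field_simps power2_eq_square)

lemma vec_nz: "\<alpha> \<in> R \<Longrightarrow> vec \<alpha> \<noteq> 0"
  using coroot_nz[of \<alpha>] by (auto simp: vec_coroot)

lemma unit_coroot: "\<alpha> \<in> R \<Longrightarrow> vec \<alpha> = norm (vec \<alpha>) *\<^sub>R ((1 / norm (cr \<alpha>)) *\<^sub>R cr \<alpha>)"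
  by (simp add: norm_vec) (simp add: vec_coroot power2_eq_square)

lemma coroot_W: "w \<in> W \<Longrightarrow> \<alpha> \<in> R \<Longrightarrow> snd w (cr \<alpha>) = cr (fst w \<alpha>)"
  by (simp add: coroot_vec W_roots vec_W W_inner linear_cmul W_linear)

text \<open>By \<open>coroot_vec\<close> the coroot of \<open>k *\<^sub>R \<alpha>\<close> is that
  of \<alpha> divided by k, and the two factors cancel in the reflection.\<close>

lemma w_refl_scaleR:
  assumes "\<alpha> \<in> R" "k *\<^sub>R \<alpha> \<in> R"
  shows "w_refl \<Phi> (k *\<^sub>R \<alpha>) = w_refl \<Phi> \<alpha>"
proof -
  have "k \<noteq> 0" using root_nz[OF assms(2)] by auto
  then show ?thesis using assms(1)
    by (simp add: w_refl_def reflect_def coreflect_def fun_eq_iff coroot_vec[OF assms(2)] coroot_vec[OF assms(1)] pr_simps)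
qed

lemma w_refl_minus: "\<alpha> \<in> R \<Longrightarrow> w_refl \<Phi> (- \<alpha>) = w_refl \<Phi> \<alpha>"
  using w_refl_scaleR[of \<alpha> "-1"] neg_R by simp

lemma coroot_minus: "\<alpha> \<in> R \<Longrightarrow> cr (- \<alpha>) = - cr \<alpha>"
  by (simp add: coroot_vec neg_R)

lemma w_refl_conj:
  assumes w: "w \<in> W" and \<alpha>: "\<alpha> \<in> R"
  shows "w_mult (w_refl \<Phi> (fst w \<alpha>)) w = w_mult w (w_refl \<Phi> \<alpha>)"
proof -
  note lin = linear_diff[OF conjunct1[OF W_linear[OF w]]] linear_cmul[OF conjunct1[OF W_linear[OF w]]]
    linear_diff[OF conjunct2[OF W_linear[OF w]]] linear_cmul[OF conjunct2[OF W_linear[OF w]]]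
  show ?thesis
    by (simp add: w_mult_def w_refl_def fun_eq_iff reflect_def coreflect_def lin W_pairing[OF w]
        coroot_W[OF w \<alpha>, symmetric])
qed

lemma c_W: "w \<in> W \<Longrightarrow> \<alpha> \<in> R \<Longrightarrow> c (fst w \<alpha>) = c \<alpha>"
  using par by (simp add: param_invariant_def)

lemma c_sr: "\<alpha> \<in> R \<Longrightarrow> \<beta> \<in> R \<Longrightarrow> c (sr \<alpha> \<beta>) = c \<beta>"
  using c_W[OF w_refl_W] by (simp add: w_refl_def)

lemma c_minus: "\<alpha> \<in> R \<Longrightarrow> c (- \<alpha>) = c \<alpha>"
  using c_sr[of \<alpha> \<alpha>] by (simp add: sr_self)

text \<open>Simple reflections generate all reflections. As \<langle>\<beta>, \<beta>\<rangle> > 0,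
  some simple \<alpha> has (\<beta>, \<open>cr \<alpha>\<close>) > 0, and applying its reflection
  lowers the height. If the result is still positive, the reflection in \<beta> is a conjugate of an
  earlier one; otherwise \<beta> is a multiple of \<alpha>.\<close>

lemma reflection_induct [consumes 1, case_names simple mult]:
  assumes "\<beta> \<in> Pos"
    and simple: "\<And>\<alpha>. \<alpha> \<in> Simple \<Longrightarrow> P (w_refl \<Phi> \<alpha>)"
    and mult: "\<And>w w'. w \<in> W \<Longrightarrow> w' \<in> W \<Longrightarrow> P w \<Longrightarrow> P w' \<Longrightarrow> P (w_mult w w')"
  shows "P (w_refl \<Phi> \<beta>)"
proof -
  have indep: "independent Simple" and pos: "\<And>\<beta>. \<beta> \<in> Pos \<Longrightarrow>
      \<exists>k. (\<forall>\<delta>\<in>Simple. k \<delta> \<ge> (0::real)) \<and> \<beta> = (\<Sum>\<delta>\<in>Simple. k \<delta> *\<^sub>R \<delta>)"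
    using ps by (auto simp: positive_system_def)
  have fin: "finite Simple" by (rule finite_subset[OF _ finite_Pos]) (auto intro: Simple_Pos)
  define rep where "rep = representation Simple"
  have in_span: "\<beta> \<in> span Simple" if "\<beta> \<in> Pos" for \<beta>
  proof -
    obtain k where "\<beta> = (\<Sum>\<delta>\<in>Simple. k \<delta> *\<^sub>R \<delta>)" using pos[OF \<open>\<beta> \<in> Pos\<close>] by blast
    then show ?thesis by (simp only:) (intro span_sum span_scale span_base)
  qed
  have rep_pos: "rep \<beta> \<delta> \<ge> 0" if "\<beta> \<in> Pos" "\<delta> \<in> Simple" for \<beta> \<delta>
  proof -
    obtain k where k: "\<forall>\<delta>\<in>Simple. k \<delta> \<ge> (0::real)" "\<beta> = (\<Sum>\<delta>\<in>Simple. k \<delta> *\<^sub>R \<delta>)"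
      using pos[OF \<open>\<beta> \<in> Pos\<close>] by blast
    have "rep \<beta> \<delta> = (\<Sum>\<gamma>\<in>Simple. rep (k \<gamma> *\<^sub>R \<gamma>) \<delta>)"
      unfolding rep_def k(2) using indep
      by (subst representation_sum) (auto intro: span_base span_scale)
    also have "\<dots> = (\<Sum>\<gamma>\<in>Simple. if \<gamma> = \<delta> then k \<delta> else 0)"
      unfolding rep_def using indep
      by (intro sum.cong) (auto simp: representation_scale representation_basis span_base)
    finally show ?thesis using k that fin by simp
  qed
  have rep_sum: "\<beta> = (\<Sum>\<delta>\<in>Simple. rep \<beta> \<delta> *\<^sub>R \<delta>)" if "\<beta> \<in> Pos" for \<beta>
    unfolding rep_def using sum_representation_eq[OF indep in_span[OF that] fin] by simp
  have rep_sr: "rep (sr \<alpha> \<beta>) \<delta> = rep \<beta> \<delta> - (if \<delta> = \<alpha> then pr \<beta> (cr \<alpha>) else 0)"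
    if "\<alpha> \<in> Simple" "\<beta> \<in> Pos" for \<alpha> \<beta> \<delta>
    unfolding rep_def reflect_def using that indep in_span[OF that(2)]
    by (auto simp: representation_diff representation_scale representation_basis span_base span_scale)
  define ht where "ht \<beta> = (\<Sum>\<delta>\<in>Simple. rep \<beta> \<delta>)" for \<beta>
  show ?thesis using assms(1)
  \<comment> \<open>Heights are real numbers here, so the induction counts the positive roots of
    smaller height instead.\<close>
  proof (induction "card {\<gamma>\<in>Pos. ht \<gamma> < ht \<beta>}" arbitrary: \<beta> rule: less_induct)
    case less
    have \<beta>: "\<beta> \<in> Pos" "\<beta> \<in> R" using less.prems Pos_R by auto
    have "0 < inner (vec \<beta>) (vec \<beta>)" using vec_nz[OF \<beta>(2)] by simp
    also have "inner (vec \<beta>) (vec \<beta>) = inner (vec \<beta>) (\<Sum>\<delta>\<in>Simple. rep \<beta> \<delta> *\<^sub>R vec \<delta>)"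
    proof (rule arg_cong[of _ _ "inner (vec \<beta>)"], rule vec_eqI)
      fix x
      have "pr \<beta> x = pr (\<Sum>\<delta>\<in>Simple. rep \<beta> \<delta> *\<^sub>R \<delta>) x" using rep_sum[OF \<beta>(1)] by simp
      also have "\<dots> = (\<Sum>\<delta>\<in>Simple. rep \<beta> \<delta> * pr \<delta> x)"
        by (simp add: pr_sum_left pr_simps)
      finally show "inner (\<Sum>\<delta>\<in>Simple. rep \<beta> \<delta> *\<^sub>R vec \<delta>) x = pr \<beta> x"
        by (simp add: inner_sum_left inner_vec)
    qed
    finally have "0 < inner (vec \<beta>) (\<Sum>\<delta>\<in>Simple. rep \<beta> \<delta> *\<^sub>R vec \<delta>)" .
    then have "0 < (\<Sum>\<delta>\<in>Simple. rep \<beta> \<delta> * inner (vec \<beta>) (vec \<delta>))"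
      by (simp add: inner_sum_right)
    then have "\<exists>\<delta>\<in>Simple. rep \<beta> \<delta> * inner (vec \<beta>) (vec \<delta>) > 0"
      using sum_nonpos[of Simple "\<lambda>\<delta>. rep \<beta> \<delta> * inner (vec \<beta>) (vec \<delta>)"] by force
    then obtain \<alpha> where \<alpha>: "\<alpha> \<in> Simple" "rep \<beta> \<alpha> * inner (vec \<beta>) (vec \<alpha>) > 0" by blast
    have \<alpha>': "\<alpha> \<in> Pos" "\<alpha> \<in> R" using Simple_Pos \<alpha> Pos_R by auto
    have "inner (vec \<beta>) (vec \<alpha>) > 0"
      using \<alpha> rep_pos[OF \<beta>(1) \<alpha>(1)] by (simp add: zero_less_mult_iff)
    then have p: "pr \<beta> (cr \<alpha>) > 0"
      using vec_nz[OF \<alpha>'(2)] by (simp add: inner_vec[symmetric] coroot_vec[OF \<alpha>'(2)] del: inner_vec)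
    let ?\<beta> = "sr \<alpha> \<beta>"
    have R: "?\<beta> \<in> R" by (rule sr_root) (use \<alpha>' \<beta> in auto)
    show ?case
    proof (cases "?\<beta> \<in> Pos")
      case True
      have "ht ?\<beta> = ht \<beta> - pr \<beta> (cr \<alpha>)"
        unfolding ht_def using \<alpha>(1) \<beta>(1) fin by (simp add: rep_sr sum_subtractf)
      then have lt: "ht ?\<beta> < ht \<beta>" using p by simp
      have "{\<gamma>\<in>Pos. ht \<gamma> < ht ?\<beta>} \<subset> {\<gamma>\<in>Pos. ht \<gamma> < ht \<beta>}" using lt True by auto
      then have "card {\<gamma>\<in>Pos. ht \<gamma> < ht ?\<beta>} < card {\<gamma>\<in>Pos. ht \<gamma> < ht \<beta>}"
        using finite_Pos by (intro psubset_card_mono) auto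
      then have IH: "P (w_refl \<Phi> ?\<beta>)" using less.hyps True by blast
      have W: "w_refl \<Phi> \<alpha> \<in> W" "w_refl \<Phi> ?\<beta> \<in> W" using w_refl_W \<alpha>' R by auto
      have eq: "w_refl \<Phi> \<beta> = w_mult (w_refl \<Phi> \<alpha>) (w_mult (w_refl \<Phi> ?\<beta>) (w_refl \<Phi> \<alpha>))"
        using w_refl_conj[OF W(1) \<beta>(2)] \<alpha>'(2)
        by (simp add: w_mult_def w_refl_def fun_eq_iff sr_sr csr_csr)
      show ?thesis
        unfolding eq by (intro mult W W_mult IH simple \<alpha>(1))
    next
      case False
      then have neg: "- ?\<beta> \<in> Pos" using R_cases R by blast
      \<comment> \<open>The reflection changes only the coordinate at \<alpha>. Every other
        coordinate of \<beta> is nonnegative, and so is its negative as a coordinate of the positive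
        root \<open>- ?\<beta>\<close>.\<close>
      have "rep \<beta> \<delta> = 0" if "\<delta> \<in> Simple" "\<delta> \<noteq> \<alpha>" for \<delta>
      proof -
        have "rep (- ?\<beta>) \<delta> = - rep ?\<beta> \<delta>"
          unfolding rep_def using indep in_span[OF neg] representation_neg[of Simple "- ?\<beta>"] by simp
        with rep_pos[OF neg that(1)] rep_pos[OF \<beta>(1) that(1)] rep_sr[OF \<alpha>(1) \<beta>(1), of \<delta>] that
        show ?thesis by simp
      qed
      then have "(\<Sum>\<delta>\<in>Simple. rep \<beta> \<delta> *\<^sub>R \<delta>) = (\<Sum>\<delta>\<in>Simple. if \<delta> = \<alpha> then rep \<beta> \<alpha> *\<^sub>R \<alpha> else 0)"
        by (intro sum.cong) auto
      then have "\<beta> = rep \<beta> \<alpha> *\<^sub>R \<alpha>" using rep_sum[OF \<beta>(1)] \<alpha>(1) fin by simp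
      then show ?thesis using w_refl_scaleR[OF \<alpha>'(2), of "rep \<beta> \<alpha>"] \<beta>(2) simple[OF \<alpha>(1)] by simp
    qed
  qed
qed

end

lemma (in rooted) inversion_pairs_Pos: "inversion_pairs \<Phi> Pos \<subseteq> Pos \<times> Pos"
  by (auto simp: inversion_pairs_def)

text \<open>The pairs with \<open>s\<^sub>\<alpha>(\<beta>) > 0\<close> and those with \<open>s\<^sub>\<beta>(\<alpha>) > 0\<close> have opposite sums, by the
  substitution \<open>(\<alpha>, \<beta>) \<mapsto> (s\<^sub>\<alpha>(\<beta>), \<alpha>)\<close>, while the complementary sums agree. Hence both
  sums vanish, without any case analysis of rank two subsystems.\<close>

lemma (in rooted) sum_inversion_pairs:
  fixes g :: "'v \<Rightarrow> 'v \<Rightarrow> 'z::ab_group_add"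
  assumes vs: "vector_space (s :: complex \<Rightarrow> 'z \<Rightarrow> 'z)"
    and odd: "\<And>\<alpha> \<beta>. \<alpha> \<in> R \<Longrightarrow> \<beta> \<in> R \<Longrightarrow> g (- \<alpha>) \<beta> = - g \<alpha> \<beta>"
    and swap: "\<And>\<alpha> \<beta>. \<alpha> \<in> R \<Longrightarrow> \<beta> \<in> R \<Longrightarrow> g \<alpha> \<beta> = - g (sr \<alpha> \<beta>) \<alpha>"
  shows "(\<Sum>(\<alpha>, \<beta>)\<in>inversion_pairs \<Phi> Pos. g \<alpha> \<beta>) = (\<Sum>(\<alpha>, \<beta>)\<in>Pos \<times> Pos. g \<alpha> \<beta>)"
proof -
  interpret vector_space s by (fact vs)
  let ?g = "\<lambda>(\<alpha>, \<beta>). g \<alpha> \<beta>"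
  define Np where "Np = {(\<alpha>, \<beta>). \<alpha> \<in> Pos \<and> \<beta> \<in> Pos \<and> sr \<alpha> \<beta> \<in> Pos}"
  define Np' where "Np' = {(\<beta>, \<alpha>). \<alpha> \<in> Pos \<and> \<beta> \<in> Pos \<and> sr \<alpha> \<beta> \<in> Pos}"
  define Nm where "Nm = inversion_pairs \<Phi> Pos"
  define Nm' where "Nm' = {(\<beta>, \<alpha>). \<alpha> \<in> Pos \<and> \<beta> \<in> Pos \<and> - sr \<alpha> \<beta> \<in> Pos}"
  have Nm: "Nm = {(\<alpha>, \<beta>). \<alpha> \<in> Pos \<and> \<beta> \<in> Pos \<and> - sr \<alpha> \<beta> \<in> Pos}"
    by (simp add: Nm_def inversion_pairs_def)
  have dich: "sr \<alpha> \<beta> \<in> Pos \<longleftrightarrow> - sr \<alpha> \<beta> \<notin> Pos" if "\<alpha> \<in> Pos" "\<beta> \<in> Pos" for \<alpha> \<beta>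
    using R_cases[OF sr_root[OF Pos_R Pos_R, OF that]] Pos_not_neg by blast
  have split: "Pos \<times> Pos = Np \<union> Nm" "Pos \<times> Pos = Np' \<union> Nm'"
    "Np \<inter> Nm = {}" "Np' \<inter> Nm' = {}"
    using dich unfolding Np_def Np'_def Nm Nm'_def by auto
  have "finite (Np \<union> Nm)" "finite (Np' \<union> Nm')"
    using finite_Pos by (simp_all flip: split(1,2))
  then have fin: "finite Np" "finite Nm" "finite Np'" "finite Nm'"
    by simp_all
  have sr_minus: "sr \<alpha> (- \<gamma>) = - sr \<alpha> \<gamma>" for \<alpha> \<gamma>
    by (simp add: reflect_def pr_simps)
  have swap': "- g (sr \<alpha> \<beta>) \<alpha> = g \<alpha> \<beta>" if "\<alpha> \<in> Pos" "\<beta> \<in> Pos" for \<alpha> \<beta>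
    by (rule swap[symmetric]) (use that Pos_R in auto)
  have plus: "sum ?g Np = - sum ?g Np'"
    unfolding sum_negf[symmetric] Np_def Np'_def
    by (rule sum.reindex_bij_witness[where i = "\<lambda>(\<gamma>, \<alpha>). (\<alpha>, sr \<alpha> \<gamma>)" and j = "\<lambda>(\<alpha>, \<beta>). (sr \<alpha> \<beta>, \<alpha>)"])
      (auto simp: sr_sr Pos_R swap')
  have minus: "sum ?g Nm = sum ?g Nm'"
    unfolding Nm Nm'_def
    by (rule sum.reindex_bij_witness[where i = "\<lambda>(\<gamma>, \<alpha>). (\<alpha>, - sr \<alpha> \<gamma>)" and j = "\<lambda>(\<alpha>, \<beta>). (- sr \<alpha> \<beta>, \<alpha>)"])
      (auto simp: sr_sr Pos_R sr_minus odd sr_root swap')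
  have "sum ?g (Pos \<times> Pos) = sum ?g Np + sum ?g Nm" "sum ?g (Pos \<times> Pos) = sum ?g Np' + sum ?g Nm'"
    using sum.union_disjoint[OF fin(1,2) split(3), of ?g] sum.union_disjoint[OF fin(3,4) split(4), of ?g]
    by (simp_all flip: split(1,2))
  with plus minus have "sum ?g Np' = - sum ?g Np'" by simp
  \<comment> \<open>Complex scalars allow the factor 2 to be cancelled, so an element equal to its
    negative vanishes.\<close>
  then have "s 2 (sum ?g Np') = 0"
    using scale_left_distrib[of 1 1 "sum ?g Np'"] by (simp add: eq_neg_iff_add_eq_0)
  then have "sum ?g Np = 0" using plus by simp
  with \<open>sum ?g (Pos \<times> Pos) = sum ?g Np + sum ?g Nm\<close> show ?thesis by (simp add: Nm_def)
qed

section \<open>The Clifford algebra\<close>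

locale clifford =
  fixes K :: "('u::real_inner, 'k::ring_1) clifford_data"
  assumes clifford: "clifford_algebra K" and involutions: "clifford_involutions K"
begin

abbreviation "ks \<equiv> kscale K"

definition kr :: "'u \<Rightarrow> 'k" where "kr u = kvec K (u, 0)"

lemma presented: "presented_algebra ks UNIV clifford_rels (kvec K)"
  using clifford by (simp add: clifford_algebra_def)

lemma k_alg: "complex_algebra ks"
  using presented by (simp add: presented_algebra_def)

sublocale vector_space ks by (rule complex_algebraD[OF k_alg])

lemmas ks_mult = complex_algebraD(2,3)[OF k_alg]

lemma kvec_add: "kvec K (\<omega> + \<omega>') = kvec K \<omega> + kvec K \<omega>'"
proof -
  have "fgen \<omega> + fgen \<omega>' - fgen (\<omega> + \<omega>') \<in> clifford_rels"
    unfolding clifford_rels_def by blast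
  from presented_algebra_rel[OF presented this] show ?thesis
    by (simp add: free_eval_simps[OF k_alg])
qed

lemma kvec_scale: "kvec K (cpx_scale z \<omega>) = ks z (kvec K \<omega>)"
proof -
  have "fconst z * fgen \<omega> - fgen (cpx_scale z \<omega>) \<in> clifford_rels"
    unfolding clifford_rels_def by blast
  from presented_algebra_rel[OF presented this] show ?thesis
    by (simp add: free_eval_simps[OF k_alg] free_eval_mult[OF k_alg] ks_mult)
qed

lemma kvec_anticommute:
  "kvec K \<omega> * kvec K \<omega>' + kvec K \<omega>' * kvec K \<omega> = - ks (2 * cpx_form inner \<omega> \<omega>') 1"
proof -
  have "fgen \<omega> * fgen \<omega>' + fgen \<omega>' * fgen \<omega> + fconst (2 * cpx_form inner \<omega> \<omega>') \<in> clifford_rels"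
    unfolding clifford_rels_def by blast
  from presented_algebra_rel[OF presented this] show ?thesis
    by (simp add: free_eval_simps[OF k_alg] free_eval_mult[OF k_alg] eq_neg_iff_add_eq_0)
qed

text \<open>If \<open>kvec\<close> kills a vector, the Clifford relation makes it orthogonal to
  everything, since 1 is nonzero; its own real and imaginary parts serve as test vectors. Hence
  \<open>pin_proj\<close> has a unique value.\<close>

lemma kvec_inj: "kvec K \<omega> = kvec K \<omega>' \<Longrightarrow> \<omega> = \<omega>'"
proof -
  have zero: "\<omega> = 0" if "kvec K \<omega> = 0" for \<omega>
  proof -
    have "cpx_form inner \<omega> \<omega>' = 0" for \<omega>'
      using kvec_anticommute[of \<omega> \<omega>'] that by simp
    from this[of "(fst \<omega>, 0)"] this[of "(snd \<omega>, 0)"] show ?thesis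
      by (simp add: cpx_form_def complex_eq_iff prod_eq_iff)
  qed
  assume "kvec K \<omega> = kvec K \<omega>'"
  moreover have "kvec K (\<omega> - \<omega>') + kvec K \<omega>' = kvec K \<omega>"
    by (simp flip: kvec_add)
  ultimately show ?thesis using zero[of "\<omega> - \<omega>'"] by simp
qed

lemma kvec_decompose: "kvec K (u, v) = kr u + ks \<i> (kr v)"
  unfolding kr_def by (simp add: cpx_scale_def flip: kvec_scale kvec_add)

lemma kr_add: "kr (u + v) = kr u + kr v"
  unfolding kr_def by (simp flip: kvec_add)

lemma kr_scaleR: "kr (r *\<^sub>R u) = ks (of_real r) (kr u)"
  unfolding kr_def by (simp add: cpx_scale_def flip: kvec_scale)

lemma kr_minus: "kr (- u) = - kr u"
  using kr_scaleR[of "-1" u] by simp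

lemma kr_zero: "kr 0 = 0"
  using kr_scaleR[of 0 0] by simp

lemma kr_diff: "kr (u - v) = kr u - kr v"
  using kr_add[of u "- v"] by (simp add: kr_minus)

lemma kr_anticommute: "kr u * kr v + kr v * kr u = ks (of_real (- 2 * inner u v)) 1"
proof -
  have "cpx_form inner (u, 0) (v, 0) = of_real (inner u v)"
    by (simp add: cpx_form_def complex_eq_iff)
  with kvec_anticommute[of "(u, 0)" "(v, 0)"] show ?thesis by (simp add: kr_def)
qed

lemma kr_square: "kr u * kr u = ks (of_real (- inner u u)) 1"
proof -
  have "ks 2 (kr u * kr u) = kr u * kr u + kr u * kr u"
    using scale_left_distrib[of 1 1 "kr u * kr u"] by simp
  also have "\<dots> = ks 2 (ks (of_real (- inner u u)) 1)"
    using kr_anticommute[of u u] by simp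
  finally show ?thesis by (simp only: scale_cancel_left) simp
qed

text \<open>As n squares to -1, its inverse is -n, which is also its image under \<epsilon>. The two
  signs cancel, so this is the twisted conjugation by n, namely the reflection in the hyperplane
  orthogonal to n.\<close>

lemma kr_sandwich:
  assumes "inner n n = 1"
  shows "kr n * kr u * kr n = kr (u - (2 * inner n u) *\<^sub>R n)"
proof -
  have "kr u * kr n = ks (of_real (- 2 * inner n u)) 1 - kr n * kr u"
    using kr_anticommute[of n u] by (simp add: algebra_simps)
  then have "kr n * kr u * kr n = kr n * (ks (of_real (- 2 * inner n u)) 1 - kr n * kr u)"
    by (simp add: mult.assoc)
  also have "\<dots> = ks (of_real (- 2 * inner n u)) (kr n) - kr n * kr n * kr u"
    by (simp add: right_diff_distrib ks_mult mult.assoc)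
  also have "\<dots> = kr (u - (2 * inner n u) *\<^sub>R n)"
    by (simp add: kr_square assms kr_diff kr_scaleR ks_mult)
  finally show ?thesis .
qed

section \<open>The involutions and the pin group\<close>

lemma keps_simps:
  "keps K (a * b) = keps K a * keps K b" "keps K (a + b) = keps K a + keps K b"
  "keps K (ks z a) = ks z (keps K a)" "keps K 1 = 1" "keps K (kvec K \<omega>) = - kvec K \<omega>"
  using involutions unfolding clifford_involutions_def Vector_Spaces.linear_iff by blast+

lemma ktr_simps:
  "ktr K (a * b) = ktr K b * ktr K a" "ktr K (a + b) = ktr K a + ktr K b"
  "ktr K (ks z a) = ks z (ktr K a)" "ktr K 1 = 1" "ktr K (kvec K \<omega>) = - kvec K \<omega>"
  using involutions unfolding clifford_involutions_def Vector_Spaces.linear_iff by blast+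

lemma keps_minus: "keps K (- a) = - keps K a"
  using keps_simps(3)[of "-1" a] by simp

lemma ktr_minus: "ktr K (- a) = - ktr K a"
  using ktr_simps(3)[of "-1" a] by simp

lemma keps_keps: "keps K (keps K a) = a"
  using presented by (induction a rule: presented_algebra_induct) (simp_all add: keps_simps keps_minus)

lemma pinD:
  assumes "a \<in> pin K"
  shows "a * ktr K a = 1" "ktr K a * a = 1" "kvec K (pin_proj K a \<omega>) = keps K a * kvec K \<omega> * ktr K a"
proof -
  show "a * ktr K a = 1" "ktr K a * a = 1" using assms by (simp_all add: pin_def)
  have "keps K a * kvec K \<omega> * ktr K a \<in> range (kvec K)"
    using assms unfolding pin_def by blast
  then obtain \<omega>' where \<omega>': "kvec K \<omega>' = keps K a * kvec K \<omega> * ktr K a" by (metis imageE)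
  then have "pin_proj K a \<omega> = \<omega>'"
    unfolding pin_proj_def by (intro the_equality) (auto intro: kvec_inj)
  with \<omega>' show "kvec K (pin_proj K a \<omega>) = keps K a * kvec K \<omega> * ktr K a" by simp
qed

lemma pin_projI: "kvec K \<omega>' = keps K a * kvec K \<omega> * ktr K a \<Longrightarrow> pin_proj K a \<omega> = \<omega>'"
  unfolding pin_proj_def by (intro the_equality) (auto intro: kvec_inj)

lemma pin_mult:
  assumes a: "a \<in> pin K" and b: "b \<in> pin K"
  shows "a * b \<in> pin K" "pin_proj K (a * b) = pin_proj K a \<circ> pin_proj K b"
proof -
  have *: "keps K (a * b) * kvec K \<omega> * ktr K (a * b) = kvec K (pin_proj K a (pin_proj K b \<omega>))" for \<omega>
    by (simp add: pinD(3)[OF a] pinD(3)[OF b] keps_simps ktr_simps mult.assoc)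
  have "a * b * ktr K (a * b) = a * (b * ktr K b) * ktr K a"
    "ktr K (a * b) * (a * b) = ktr K b * (ktr K a * a) * b"
    by (simp_all add: ktr_simps mult.assoc)
  then show "a * b \<in> pin K"
    by (auto simp: pin_def * pinD(1,2)[OF a] pinD(1,2)[OF b])
  show "pin_proj K (a * b) = pin_proj K a \<circ> pin_proj K b"
    by (rule ext) (auto intro!: pin_projI simp: *)
qed

lemma pin_minus:
  assumes "a \<in> pin K"
  shows "- a \<in> pin K" "pin_proj K (- a) = pin_proj K a"
proof -
  show "- a \<in> pin K" using assms by (simp add: pin_def keps_minus ktr_minus)
  show "pin_proj K (- a) = pin_proj K a"
    by (simp add: fun_eq_iff pin_proj_def keps_minus ktr_minus)
qed

lemma pin_one: "1 \<in> pin K" "pin_proj K 1 = id"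
  by (auto simp: pin_def keps_simps ktr_simps intro!: ext pin_projI)

end

section \<open>The pin cover of the Weyl group\<close>

locale cover = rooted \<Phi> Pos Simple c + clifford K
  for \<Phi> :: "('v::real_vector, 'u::real_inner) root_data"
    and Pos Simple :: "'v set" and c :: "'v \<Rightarrow> real"
    and K :: "('u, 'k::ring_1) clifford_data"
begin

abbreviation "G \<equiv> weyl_cover \<Phi> K"
abbreviation "f \<equiv> f_elt \<Phi> K"
abbreviation "wp \<equiv> weyl_proj \<Phi> K"

definition unit :: "'v \<Rightarrow> 'u" where "unit \<alpha> = (1 / norm (cr \<alpha>)) *\<^sub>R cr \<alpha>"

lemma f_unit: "f \<alpha> = kr (unit \<alpha>)"
  by (simp add: f_elt_def kr_def unit_def)

lemma inner_unit: "\<alpha> \<in> R \<Longrightarrow> inner (unit \<alpha>) (unit \<alpha>) = 1"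
  using coroot_nz[of \<alpha>] by (simp add: unit_def power2_norm_eq_inner[symmetric] power2_eq_square)

lemma vec_unit: "\<alpha> \<in> R \<Longrightarrow> vec \<alpha> = dual_norm \<Phi> \<alpha> *\<^sub>R unit \<alpha>"
  unfolding dual_norm_vec unit_def by (rule unit_coroot)

lemma csr_unit: "\<alpha> \<in> R \<Longrightarrow> csr \<alpha> u = u - (2 * inner (unit \<alpha>) u) *\<^sub>R unit \<alpha>"
  using coroot_nz[of \<alpha>]
  by (simp add: coreflect_def inner_vec[symmetric] vec_coroot unit_def power2_eq_square del: inner_vec)

lemma unit_W: "w \<in> W \<Longrightarrow> \<alpha> \<in> R \<Longrightarrow> snd w (unit \<alpha>) = unit (fst w \<alpha>)"
proof -
  assume w: "w \<in> W" and \<alpha>: "\<alpha> \<in> R"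
  have "norm (snd w (cr \<alpha>)) = norm (cr \<alpha>)"
    by (simp add: norm_eq_sqrt_inner W_inner[OF w])
  then show ?thesis
    using W_linear[OF w] by (simp add: unit_def linear_cmul coroot_W[OF w \<alpha>, symmetric])
qed

lemma f_sandwich: "\<alpha> \<in> R \<Longrightarrow> f \<alpha> * kr u * f \<alpha> = kr (csr \<alpha> u)"
  by (simp add: f_unit kr_sandwich inner_unit csr_unit)

lemma f_square: "\<alpha> \<in> R \<Longrightarrow> f \<alpha> * f \<alpha> = - 1"
  by (simp add: f_unit kr_square inner_unit)

lemma f_minus: "\<alpha> \<in> R \<Longrightarrow> f (- \<alpha>) = - f \<alpha>"
  by (simp add: f_unit unit_def coroot_minus flip: kr_minus)

lemma f_pin:
  assumes "\<alpha> \<in> R"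
  shows "f \<alpha> \<in> pin K" "pin_proj K (f \<alpha>) = cpx_lift (csr \<alpha>)"
proof -
  have *: "keps K (f \<alpha>) * kvec K \<omega> * ktr K (f \<alpha>) = kvec K (cpx_lift (csr \<alpha>) \<omega>)" for \<omega>
  proof -
    obtain u v where \<omega>: "\<omega> = (u, v)" by (cases \<omega>)
    have "keps K (f \<alpha>) * kvec K \<omega> * ktr K (f \<alpha>) = f \<alpha> * kvec K \<omega> * f \<alpha>"
      unfolding f_elt_def by (simp add: keps_simps ktr_simps)
    also have "\<dots> = f \<alpha> * kr u * f \<alpha> + ks \<i> (f \<alpha> * kr v * f \<alpha>)"
      by (simp add: \<omega> kvec_decompose algebra_simps ks_mult)
    also have "\<dots> = kvec K (cpx_lift (csr \<alpha>) \<omega>)"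
      by (simp add: f_sandwich[OF assms] \<omega> cpx_lift_def kvec_decompose)
    finally show ?thesis .
  qed
  have "ktr K (f \<alpha>) = - f \<alpha>" by (simp add: f_elt_def ktr_simps)
  then have "f \<alpha> * ktr K (f \<alpha>) = 1" "ktr K (f \<alpha>) * f \<alpha> = 1"
    by (simp_all add: f_square[OF assms])
  with * show "f \<alpha> \<in> pin K" unfolding pin_def by blast
  show "pin_proj K (f \<alpha>) = cpx_lift (csr \<alpha>)"
    by (rule ext, rule pin_projI) (simp add: *)
qed

lemma weyl_projI:
  assumes "w \<in> W" "pin_proj K a = cpx_lift (snd w)"
  shows "wp a = w"
  unfolding weyl_proj_def
proof (rule the_equality)
  fix w' assume w': "w' \<in> W \<and> pin_proj K a = cpx_lift (snd w')"
  then have "cpx_lift (snd w') (u, 0) = cpx_lift (snd w) (u, 0)" for u using assms by metis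
  then show "w' = w" using w' assms by (intro W_eqI) (auto simp: cpx_lift_def)
qed (use assms in simp)

lemma coverD:
  assumes "a \<in> G"
  shows "a \<in> pin K" "wp a \<in> W" "pin_proj K a = cpx_lift (snd (wp a))"
proof -
  show "a \<in> pin K" using assms by (simp add: weyl_cover_def)
  obtain w where w: "w \<in> W" "pin_proj K a = cpx_lift (snd w)"
    using assms by (auto simp: weyl_cover_def)
  with weyl_projI[OF w] show "wp a \<in> W" "pin_proj K a = cpx_lift (snd (wp a))" by simp_all
qed

lemma coverI: "a \<in> pin K \<Longrightarrow> w \<in> W \<Longrightarrow> pin_proj K a = cpx_lift (snd w) \<Longrightarrow> a \<in> G \<and> wp a = w"
  by (auto simp: weyl_cover_def intro: weyl_projI)

lemma cover_mult:
  assumes "a \<in> G" "b \<in> G"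
  shows "a * b \<in> G" "wp (a * b) = w_mult (wp a) (wp b)"
proof -
  have "a * b \<in> G \<and> wp (a * b) = w_mult (wp a) (wp b)"
    using coverD[OF assms(1)] coverD[OF assms(2)]
    by (intro coverI pin_mult W_mult)
      (auto simp: pin_mult w_mult_def cpx_lift_def fun_eq_iff)
  then show "a * b \<in> G" "wp (a * b) = w_mult (wp a) (wp b)" by auto
qed

lemma cover_minus: "a \<in> G \<Longrightarrow> - a \<in> G \<and> wp (- a) = wp a"
  using coverD[of a] by (intro coverI pin_minus) (auto simp: pin_minus)

lemma cover_one: "1 \<in> G" "wp 1 = w_one"
  using coverI[OF pin_one(1) weyl.one] by (auto simp: pin_one w_one_def cpx_lift_def fun_eq_iff)

lemma cover_f: "\<alpha> \<in> R \<Longrightarrow> f \<alpha> \<in> G" "\<alpha> \<in> R \<Longrightarrow> wp (f \<alpha>) = w_refl \<Phi> \<alpha>"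
  using coverI[OF f_pin(1) w_refl_W, of \<alpha> \<alpha>] by (auto simp: f_pin w_refl_def)

text \<open>The definition of the projection p with the inverse moved to the other side. Passing a
  vector trades \<epsilon>(a) for a; \<open>cover_kr'\<close> is the image under \<epsilon>, where a
  is traded for \<epsilon>(a).\<close>

lemma cover_kr: "a \<in> G \<Longrightarrow> keps K a * kr u = kr (snd (wp a) u) * a"
proof -
  assume a: "a \<in> G"
  note a' = coverD[OF a]
  have "kr (snd (wp a) u) = keps K a * kr u * ktr K a"
    using pinD(3)[OF a'(1), of "(u, 0)"] a'(3) W_linear[OF a'(2)]
    by (simp add: cpx_lift_def kr_def linear_0)
  then show ?thesis by (simp add: mult.assoc pinD[OF a'(1)])
qed

lemma cover_kr': "a \<in> G \<Longrightarrow> a * kr u = kr (snd (wp a) u) * keps K a"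
proof -
  assume a: "a \<in> G"
  have "keps K (keps K a * kr u) = keps K (kr (snd (wp a) u) * a)"
    by (simp add: cover_kr[OF a])
  then show ?thesis by (simp add: keps_simps keps_keps kr_def)
qed

text \<open>Conjugating the reflected coroot gives \<open>f \<alpha> * f \<beta> * f \<alpha> = f
  (sr \<alpha> \<beta>)\<close>, and \<open>f \<alpha>\<close> squares to -1. This is the sign
  behind the cancellation in \<open>sum_inversion_pairs\<close>.\<close>

lemma f_swap: "\<alpha> \<in> R \<Longrightarrow> \<beta> \<in> R \<Longrightarrow> f \<alpha> * f \<beta> = - (f (sr \<alpha> \<beta>) * f \<alpha>)"
proof -
  assume ab: "\<alpha> \<in> R" "\<beta> \<in> R"
  have "f \<alpha> * f \<beta> * f \<alpha> = f (sr \<alpha> \<beta>)"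
    using unit_W[OF w_refl_W[OF ab(1)] ab(2)] f_sandwich[OF ab(1), of "unit \<beta>"]
    by (simp add: f_unit w_refl_def)
  then have "f (sr \<alpha> \<beta>) * f \<alpha> = f \<alpha> * f \<beta> * f \<alpha> * f \<alpha>" by simp
  also have "\<dots> = f \<alpha> * f \<beta> * (f \<alpha> * f \<alpha>)" by (simp only: mult.assoc)
  finally have "f (sr \<alpha> \<beta>) * f \<alpha> = f \<alpha> * f \<beta> * (f \<alpha> * f \<alpha>)" .
  then show ?thesis by (simp add: f_square[OF ab(1)])
qed

end

section \<open>The graded Hecke algebra\<close>

locale hecke = rooted \<Phi> Pos Simple c
  for \<Phi> :: "('v::real_vector, 'u::real_inner) root_data"
    and Pos Simple :: "'v set" and c :: "'v \<Rightarrow> real" +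
  fixes H :: "('v, 'u, 'h::ring_1) hecke_data"
  assumes graded: "graded_hecke_algebra \<Phi> Simple c H" and star: "hecke_star \<Phi> Pos c H"
begin

abbreviation "hs \<equiv> hscale H"
abbreviation "tw \<equiv> ht H"
abbreviation "star \<equiv> hstar H"

definition hp :: "'u \<Rightarrow> 'h" where "hp u = hpoly H (lin_fun \<Phi> (u, 0))"

lemma h_presented:
  "presented_algebra hs (hecke_gens \<Phi>) (hecke_rels \<Phi> Simple c) (case_hecke_gen tw (hpoly H))"
  using graded by (simp add: graded_hecke_algebra_def)

lemma h_alg: "complex_algebra hs"
  using h_presented by (simp add: presented_algebra_def)

sublocale H: vector_space hs by (rule complex_algebraD[OF h_alg])

lemmas hs_mult = complex_algebraD(2,3)[OF h_alg]

lemmas h_rel = presented_algebra_rel[OF h_presented]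
lemmas h_eval = free_eval_simps[OF h_alg] free_eval_mult[OF h_alg]

lemma tw_one: "tw w_one = 1"
proof -
  have "fgen (GenT w_one) - 1 \<in> hecke_rels \<Phi> Simple c" unfolding hecke_rels_def by blast
  from h_rel[OF this] show ?thesis by (simp add: h_eval)
qed

lemma tw_mult: "w \<in> W \<Longrightarrow> w' \<in> W \<Longrightarrow> tw (w_mult w w') = tw w * tw w'"
proof -
  assume "w \<in> W" "w' \<in> W"
  then have "fgen (GenT w) * fgen (GenT w') - fgen (GenT (w_mult w w')) \<in> hecke_rels \<Phi> Simple c"
    unfolding hecke_rels_def by blast
  from h_rel[OF this] show ?thesis by (simp add: h_eval)
qed

lemma hpoly_const: "hpoly H (\<lambda>_. z) = hs z 1"
proof -
  have "fgen (GenS (\<lambda>_. z)) - fconst z \<in> hecke_rels \<Phi> Simple c"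
    unfolding hecke_rels_def by blast
  from h_rel[OF this] show ?thesis by (simp add: h_eval)
qed

lemma hpoly_add:
  "p \<in> sym_alg \<Phi> \<Longrightarrow> q \<in> sym_alg \<Phi> \<Longrightarrow> hpoly H (\<lambda>\<nu>. p \<nu> + q \<nu>) = hpoly H p + hpoly H q"
proof -
  assume "p \<in> sym_alg \<Phi>" "q \<in> sym_alg \<Phi>"
  then have "fgen (GenS p) + fgen (GenS q) - fgen (GenS (\<lambda>\<nu>. p \<nu> + q \<nu>)) \<in> hecke_rels \<Phi> Simple c"
    unfolding hecke_rels_def by blast
  from h_rel[OF this] show ?thesis by (simp add: h_eval)
qed

lemma hpoly_mult:
  "p \<in> sym_alg \<Phi> \<Longrightarrow> q \<in> sym_alg \<Phi> \<Longrightarrow> hpoly H (\<lambda>\<nu>. p \<nu> * q \<nu>) = hpoly H p * hpoly H q"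
proof -
  assume "p \<in> sym_alg \<Phi>" "q \<in> sym_alg \<Phi>"
  then have "fgen (GenS p) * fgen (GenS q) - fgen (GenS (\<lambda>\<nu>. p \<nu> * q \<nu>)) \<in> hecke_rels \<Phi> Simple c"
    unfolding hecke_rels_def by blast
  from h_rel[OF this] show ?thesis by (simp add: h_eval)
qed

lemma hpoly_sum:
  assumes "\<And>i. i \<in> I \<Longrightarrow> p i \<in> sym_alg \<Phi>"
  shows "(\<lambda>\<nu>. \<Sum>i\<in>I. p i \<nu>) \<in> sym_alg \<Phi> \<and> hpoly H (\<lambda>\<nu>. \<Sum>i\<in>I. p i \<nu>) = (\<Sum>i\<in>I. hpoly H (p i))"
  using assms
  by (induction I rule: infinite_finite_induct)
    (simp_all add: hpoly_const hpoly_add sym_alg.const sym_alg.add)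

lemma cross:
  assumes "\<alpha> \<in> Simple"
  shows "hp u * tw (w_refl \<Phi> \<alpha>) = tw (w_refl \<Phi> \<alpha>) * hp (csr \<alpha> u) + hs (of_real (c \<alpha> * pr \<alpha> u)) 1"
proof -
  let ?\<omega> = "(u, 0)"
  have "fgen (GenS (lin_fun \<Phi> ?\<omega>)) * fgen (GenT (w_refl \<Phi> \<alpha>))
        - fgen (GenT (w_refl \<Phi> \<alpha>)) * fgen (GenS (lin_fun \<Phi> (cpx_lift (coreflect \<Phi> \<alpha>) ?\<omega>)))
        - fconst (of_real (c \<alpha>) * cpx_form (pairing \<Phi>) (\<alpha>, 0) ?\<omega>) \<in> hecke_rels \<Phi> Simple c"
    unfolding hecke_rels_def using assms by blast
  from h_rel[OF this]
  have "hp u * tw (w_refl \<Phi> \<alpha>) - tw (w_refl \<Phi> \<alpha>) * hpoly H (lin_fun \<Phi> (cpx_lift (csr \<alpha>) ?\<omega>))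
     = hs (of_real (c \<alpha>) * cpx_form pr (\<alpha>, 0) ?\<omega>) 1"
    by (simp add: h_eval hp_def)
  moreover have "cpx_lift (csr \<alpha>) ?\<omega> = (csr \<alpha> u, 0)"
    by (simp add: cpx_lift_def coreflect_def pr_simps)
  moreover have "cpx_form pr (\<alpha>, 0) ?\<omega> = of_real (pr \<alpha> u)"
    by (simp add: cpx_form_def complex_eq_iff pr_simps)
  ultimately show ?thesis by (simp add: hp_def algebra_simps)
qed

lemma hp_add: "hp (u + v) = hp u + hp v"
proof -
  have "lin_fun \<Phi> (u + v, 0) = (\<lambda>\<nu>. lin_fun \<Phi> (u, 0) \<nu> + lin_fun \<Phi> (v, 0) \<nu>)"
    by (simp add: lin_fun_def fun_eq_iff cpx_form_def complex_eq_iff pr_simps)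
  then show ?thesis unfolding hp_def by (simp add: hpoly_add sym_alg.lin)
qed

lemma hp_scaleR: "hp (r *\<^sub>R u) = hs (of_real r) (hp u)"
proof -
  have "lin_fun \<Phi> (r *\<^sub>R u, 0) = (\<lambda>\<nu>. of_real r * lin_fun \<Phi> (u, 0) \<nu>)"
    by (simp add: lin_fun_def fun_eq_iff cpx_form_def complex_eq_iff pr_simps)
  then show ?thesis unfolding hp_def
    by (simp add: hpoly_mult[OF sym_alg.const sym_alg.lin] hpoly_const hs_mult)
qed

lemma hp_commute: "hp u * hp v = hp v * hp u"
  unfolding hp_def hpoly_mult[OF sym_alg.lin sym_alg.lin, symmetric] by (simp only: mult.commute)

section \<open>The star operation and the skew part of a vector\<close>

lemma star_simps:
  "star (a + b) = star a + star b" "star (hs z a) = hs (cnj z) (star a)"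
  "star (a * b) = star b * star a" "w \<in> W \<Longrightarrow> star (tw w) = tw (w_inv w)"
  using star unfolding hecke_star_def by blast+

lemma star_minus: "star (- a) = - star a"
  using star_simps(2)[of "-1" a] by simp

lemma star_diff: "star (a - b) = star a - star b"
  using star_simps(1)[of a "- b"] by (simp add: star_minus)

lemma star_sum: "star (\<Sum>i\<in>I. g i) = (\<Sum>i\<in>I. star (g i))"
  using star_simps(2)[of 0 0]
  by (induction I rule: infinite_finite_induct) (simp_all add: star_simps)

lemma star_one: "star 1 = 1"
proof -
  have "w_inv w_one = (w_one :: ('v, 'u) weyl_elt)" unfolding w_inv_def w_one_def by simp
  then show ?thesis using star_simps(4)[OF weyl.one] by (simp add: tw_one)
qed

lemma star_refl: "\<beta> \<in> R \<Longrightarrow> star (tw (w_refl \<Phi> \<beta>)) = tw (w_refl \<Phi> \<beta>)"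
  by (simp add: star_simps w_refl_W w_inv_refl)

text \<open>By \<open>star_hp\<close> this is the sum of u and its star. It is self-adjoint because
  reflections are involutions.\<close>

definition T2 :: "'u \<Rightarrow> 'h" where
  "T2 u = (\<Sum>\<beta>\<in>Pos. hs (of_real (c \<beta> * pr \<beta> u)) (tw (w_refl \<Phi> \<beta>)))"

lemma star_hp: "star (hp u) = - hp u + T2 u"
  using star unfolding hecke_star_def hp_def T2_def by blast

lemma star_T2: "star (T2 u) = T2 u"
  unfolding T2_def star_sum by (rule sum.cong) (simp_all add: star_simps(2) star_refl Pos_R)

text \<open>By \<open>wt_double\<close> this is half of u minus its star. Written through
  \<open>T2\<close>, it displays the reflection terms that \<open>A\<close> collects.\<close>

definition wt :: "'u \<Rightarrow> 'h" where "wt u = hp u - hs (1/2) (T2 u)"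

lemma wt_add: "wt (u + v) = wt u + wt v"
  by (simp add: wt_def hp_add T2_def pr_simps distrib_left H.scale_left_distrib sum.distrib
      H.scale_right_distrib)

lemma wt_scaleR: "wt (r *\<^sub>R u) = hs (of_real r) (wt u)"
  by (simp add: wt_def hp_scaleR T2_def pr_simps H.scale_right_diff_distrib H.scale_sum_right mult_ac)

lemma wt_diff: "wt (u - v) = wt u - wt v"
  using wt_add[of u "(-1) *\<^sub>R v"] by (simp only: wt_scaleR) simp

lemma star_wt: "star (wt u) = - wt u"
proof -
  have "hs (1/2) (T2 u) + hs (1/2) (T2 u) = T2 u"
    using H.scale_left_distrib[of "1/2" "1/2" "T2 u"] by simp
  then show ?thesis
    by (simp add: wt_def star_diff star_simps(2) star_hp star_T2 algebra_simps)
qed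

lemma wt_double: "hs 2 (wt u) = hp u - star (hp u)"
  using H.scale_left_distrib[of 1 1 "hp u"]
  by (simp add: wt_def star_hp H.scale_right_diff_distrib)

text \<open>Applying \<open>*\<close> to the cross relation turns it into the statement that \<open>t\<^sub>s\<close> intertwines
  \<open>\<omega> - \<omega>\<^sup>*\<close> with \<open>s(\<omega>) - s(\<omega>)\<^sup>*\<close>, so that no information on how \<open>s\<close> permutes the positive
  roots is needed.\<close>

lemma wt_simple:
  assumes "\<alpha> \<in> Simple"
  shows "tw (w_refl \<Phi> \<alpha>) * wt u = wt (csr \<alpha> u) * tw (w_refl \<Phi> \<alpha>)"
proof -
  have \<alpha>: "\<alpha> \<in> R" using assms Simple_Pos Pos_R by blast
  let ?t = "tw (w_refl \<Phi> \<alpha>)" and ?r = "hs (of_real (c \<alpha> * pr \<alpha> u)) 1"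
  have "?t * star (hp u) = star (hp (csr \<alpha> u)) * ?t + ?r"
    using arg_cong[OF cross[OF assms, of u], of star]
    by (simp add: star_simps(1-3) star_refl[OF \<alpha>] star_one)
  moreover have "?t * hp u = hp (csr \<alpha> u) * ?t + ?r"
    using cross[OF assms, of "csr \<alpha> u"]
    by (simp add: csr_csr \<alpha>) (simp add: coreflect_def pr_simps pr_coroot \<alpha>)
  ultimately have "?t * hs 2 (wt u) = hs 2 (wt (csr \<alpha> u)) * ?t"
    by (simp add: wt_double algebra_simps)
  then have "hs 2 (?t * wt u) = hs 2 (wt (csr \<alpha> u) * ?t)" by (simp add: hs_mult)
  then show ?thesis by (simp only: H.scale_cancel_left) simp
qed

text \<open>The intertwining rule is multiplicative in w, so it spreads from simple reflections by
  \<open>reflection_induct\<close>; a negative root has the reflection of its opposite.\<close>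

lemma wt_refl:
  assumes "\<beta> \<in> R"
  shows "tw (w_refl \<Phi> \<beta>) * wt u = wt (csr \<beta> u) * tw (w_refl \<Phi> \<beta>)"
proof -
  have pos: "tw (w_refl \<Phi> \<beta>) * wt u = wt (snd (w_refl \<Phi> \<beta>) u) * tw (w_refl \<Phi> \<beta>)" if "\<beta> \<in> Pos" for \<beta> u
    using that
  proof (induction arbitrary: u rule: reflection_induct)
    case (simple \<alpha>)
    then show ?case by (simp add: wt_simple) (simp add: w_refl_def)
  next
    case (mult w w')
    have "tw (w_mult w w') * wt u = tw w * (wt (snd w' u) * tw w')"
      using mult by (simp add: tw_mult mult.assoc)
    also have "\<dots> = tw w * wt (snd w' u) * tw w'" by (simp only: mult.assoc)
    also have "\<dots> = wt (snd (w_mult w w') u) * tw (w_mult w w')"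
      using mult by (simp add: tw_mult mult.assoc) (simp add: w_mult_def)
    finally show ?case .
  qed
  show ?thesis
    using R_cases[OF assms] pos[of \<beta> u] pos[of "- \<beta>" u] w_refl_minus[OF assms] by (auto simp: w_refl_def)
qed

lemma wt_W: "w \<in> W \<Longrightarrow> tw w * wt u = wt (snd w u) * tw w"
proof (induction arbitrary: u rule: weyl.induct)
  case one
  then show ?case by (simp add: tw_one) (simp add: w_one_def)
next
  case (refl \<alpha> w)
  let ?s = "w_refl \<Phi> \<alpha>"
  have mult: "tw (w_mult ?s w) = tw ?s * tw w" using refl by (simp add: tw_mult w_refl_W)
  have "tw (w_mult ?s w) * wt u = tw ?s * wt (snd w u) * tw w"
    by (simp add: mult mult.assoc refl.IH)
  also have "\<dots> = wt (csr \<alpha> (snd w u)) * tw (w_mult ?s w)"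
    by (simp add: wt_refl[OF refl(1)] mult mult.assoc)
  finally show ?case by (simp add: w_mult_def w_refl_def)
qed

text \<open>The sum of the squares of an orthonormal basis is the polynomial \<langle>\<nu>,
  \<nu>\<rangle>. Its values show the W-invariance, so it acts through the central
  character.\<close>

lemma casimir:
  "(\<lambda>\<nu>. \<Sum>e\<in>E. lin_fun \<Phi> (e, 0) \<nu> * lin_fun \<Phi> (e, 0) \<nu>) \<in> sym_alg_inv \<Phi>" (is "?p \<in> _")
  "hpoly H (\<lambda>\<nu>. \<Sum>e\<in>E. lin_fun \<Phi> (e, 0) \<nu> * lin_fun \<Phi> (e, 0) \<nu>) = (\<Sum>e\<in>E. hp e * hp e)"
  "(\<Sum>e\<in>E. lin_fun \<Phi> (e, 0) \<nu> * lin_fun \<Phi> (e, 0) \<nu>) = cpx_form (dual_inner \<Phi>) \<nu> \<nu>"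
proof -
  have sym: "(\<lambda>\<nu>. lin_fun \<Phi> (e, 0) \<nu> * lin_fun \<Phi> (e, 0) \<nu>) \<in> sym_alg \<Phi>" for e
    by (intro sym_alg.mult sym_alg.lin)
  show "hpoly H ?p = (\<Sum>e\<in>E. hp e * hp e)"
    using hpoly_sum[of E "\<lambda>e \<nu>. lin_fun \<Phi> (e, 0) \<nu> * lin_fun \<Phi> (e, 0) \<nu>"] sym
    by (simp add: hpoly_mult sym_alg.lin hp_def)
  have di: "(\<Sum>e\<in>E. pr v e * pr w e) = dual_inner \<Phi> v w" for v w
    unfolding dual_inner_vec
    by (subst (1) vec_def) (simp add: inner_sum_left, simp add: inner_commute[of _ "vec w"] inner_vec)
  show val: "?p \<nu> = cpx_form (dual_inner \<Phi>) \<nu> \<nu>" for \<nu>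
    by (simp add: complex_eq_iff cpx_form_def lin_fun_def pr_simps di[symmetric] sum_subtractf
        sum.distrib sum_distrib_left mult.commute)
  have "cpx_form (dual_inner \<Phi>) (cpx_lift (fst w) \<nu>) (cpx_lift (fst w) \<nu>) = cpx_form (dual_inner \<Phi>) \<nu> \<nu>"
    if "w \<in> W" for w \<nu>
    by (simp add: cpx_form_def cpx_lift_def dual_inner_vec vec_W that W_inner)
  then have "?p \<circ> cpx_lift (fst w) = ?p" if "w \<in> W" for w
    unfolding fun_eq_iff o_apply val using that by blast
  moreover have "?p \<in> sym_alg \<Phi>" by (rule conjunct1[OF hpoly_sum]) (rule sym)
  ultimately show "?p \<in> sym_alg_inv \<Phi>" by (simp add: sym_alg_inv_def)
qed

end

section \<open>The Dirac operator\<close>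

text \<open>The calculation involves only two commuting actions on one space, so it is carried out
  for any such pair; X \<otimes> S is substituted at the end. Invariance of the form is asked for
  the vectors of \<open>E\<close> and extended to all real vectors in \<open>C_kr\<close>.\<close>

locale dirac = cover \<Phi> Pos Simple c K + hecke \<Phi> Pos Simple c H + T: vector_space sT
  for \<Phi> :: "('v::real_vector, 'u::real_inner) root_data"
    and Pos Simple :: "'v set" and c :: "'v \<Rightarrow> real"
    and K :: "('u, 'k::ring_1) clifford_data"
    and H :: "('v, 'u, 'h::ring_1) hecke_data"
    and sT :: "complex \<Rightarrow> 't::ab_group_add \<Rightarrow> 't" +
  fixes P :: "'h \<Rightarrow> 't \<Rightarrow> 't" and Q :: "'k \<Rightarrow> 't \<Rightarrow> 't" and C :: "'t \<Rightarrow> 't \<Rightarrow> complex"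
    and \<nu> :: "'v \<times> 'v"
  assumes P_module: "algebra_module hs sT P" and Q_module: "algebra_module ks sT Q"
    and PQ: "\<And>h k t. Q k (P h t) = P h (Q k t)"
    and pos: "pos_form sT C"
    and C_P: "\<And>h t u. C (P h t) u = C t (P (star h) u)"
    and C_Q: "\<And>e t u. e \<in> E \<Longrightarrow> C (Q (kr e) t) (Q (kr e) u) = C t u"
    and central: "\<And>p t. p \<in> sym_alg_inv \<Phi> \<Longrightarrow> P (hpoly H p) t = sT (p \<nu>) t"
begin

lemma P_lin: "P h (t + u) = P h t + P h u" "P h (sT z t) = sT z (P h t)"
  "P (h + h') t = P h t + P h' t" "P (hs z h) t = sT z (P h t)" "P (h * h') t = P h (P h' t)" "P 1 t = t"
  using P_module unfolding algebra_module_def Vector_Spaces.linear_iff by blast+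

lemma Q_lin: "Q k (t + u) = Q k t + Q k u" "Q k (sT z t) = sT z (Q k t)"
  "Q (k + k') t = Q k t + Q k' t" "Q (ks z k) t = sT z (Q k t)" "Q (k * k') t = Q k (Q k' t)" "Q 1 t = t"
  using Q_module unfolding algebra_module_def Vector_Spaces.linear_iff by blast+

lemma additive_rules:
  fixes F :: "'a::ab_group_add \<Rightarrow> 'b::ab_group_add"
  assumes "\<And>x y. F (x + y) = F x + F y"
  shows "F 0 = 0" "F (- x) = - F x" "F (x - y) = F x - F y" "F (\<Sum>i\<in>I. g i) = (\<Sum>i\<in>I. F (g i))"
proof -
  show z: "F 0 = 0" using assms[of 0 0] by simp
  show n: "F (- x) = - F x" for x
    using assms[of x "- x"] by (simp add: z eq_neg_iff_add_eq_0 add.commute)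
  show "F (x - y) = F x - F y" using assms[of x "- y"] by (simp add: n)
  show "F (\<Sum>i\<in>I. g i) = (\<Sum>i\<in>I. F (g i))"
    by (induction I rule: infinite_finite_induct) (simp_all add: z assms)
qed

lemmas P_rules = P_lin(1-4) additive_rules[of "P h" for h, OF P_lin(1)]
  additive_rules[of "\<lambda>h. P h t" for t, OF P_lin(3)]
lemmas Q_rules = Q_lin(1-4) additive_rules[of "Q k" for k, OF Q_lin(1)]
  additive_rules[of "\<lambda>k. Q k t" for t, OF Q_lin(3)]

definition D :: "'t \<Rightarrow> 't" where
  "D t = (\<Sum>e\<in>E. P (wt e) (Q (kr e) t))"

text \<open>By \<open>vec_unit\<close>, \<open>kr (vec \<beta>)\<close> is |\<beta>| times
  \<open>f \<beta>\<close>. This form is the one in which coordinates of \<beta> in the basis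
  \<open>E\<close> sum up directly.\<close>

definition A :: "'t \<Rightarrow> 't" where
  "A t = sT (1/2) (\<Sum>\<beta>\<in>Pos. sT (of_real (c \<beta>)) (P (tw (w_refl \<Phi> \<beta>)) (Q (kr (vec \<beta>)) t)))"

lemma D_add: "D (t + u) = D t + D u"
  by (simp add: D_def P_rules Q_rules sum.distrib)

lemma A_add: "A (t + u) = A t + A u"
  by (simp add: A_def P_rules Q_rules sum.distrib T.scale_right_distrib)

lemma D_scale: "D (sT z t) = sT z (D t)"
  by (simp add: D_def P_rules Q_rules T.scale_sum_right)

lemma expand_linear:
  assumes "\<And>u v. L (u + v) = L u + L v" "\<And>r u. L (r *\<^sub>R u) = sT (of_real r) (L u)"
  shows "(\<Sum>e\<in>E. sT (of_real (inner b e)) (L e)) = L b"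
proof -
  have "L b = L (\<Sum>e\<in>E. inner b e *\<^sub>R e)" by (simp flip: expand_E)
  then show ?thesis by (simp add: additive_rules[of L, OF assms(1)] assms(2))
qed

text \<open>The tensor formed by the sum of e \<otimes> e is the same for every orthonormal basis,
  and w maps \<open>E\<close> to another one. The proof expands \<open>snd w e\<close> in
  \<open>E\<close> and contracts again.\<close>

lemma expand_bilinear:
  assumes "\<And>u v x. L (u + v) x = L u x + L v x" "\<And>r u x. L (r *\<^sub>R u) x = sT (of_real r) (L u x)"
    and "\<And>u v x. L x (u + v) = L x u + L x v" "\<And>r u x. L x (r *\<^sub>R u) = sT (of_real r) (L x u)"
    and w: "w \<in> W"
  shows "(\<Sum>e\<in>E. L (snd w e) (snd w e)) = (\<Sum>e\<in>E. L e e)"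
proof -
  have lin: "linear (snd w)" using W_linear[OF w] by blast
  have "(\<Sum>e\<in>E. L (snd w e) (snd w e))
      = (\<Sum>e\<in>E. \<Sum>e'\<in>E. sT (of_real (inner (snd w e) e')) (L e' (snd w e)))"
    using expand_linear[of "\<lambda>u. L u x" for x, OF assms(1,2)] by simp
  also have "\<dots> = (\<Sum>e'\<in>E. \<Sum>e\<in>E. sT (of_real (inner (snd w e) e')) (L e' (snd w e)))"
    by (rule sum.swap)
  also have "\<dots> = (\<Sum>e'\<in>E. L e' e')"
  proof (rule sum.cong[OF HOL.refl])
    fix e' :: 'u
    obtain x where x: "e' = snd w x" using W_bij[OF w] by (metis bij_pointE)
    have "(\<Sum>e\<in>E. sT (of_real (inner (snd w e) e')) (L e' (snd w e)))
       = (\<Sum>e\<in>E. sT (of_real (inner x e)) (L e' (snd w e)))"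
      by (simp add: x W_inner[OF w] inner_commute)
    also have "\<dots> = L e' (snd w x)"
      by (rule expand_linear) (simp_all add: linear_add[OF lin] linear_cmul[OF lin] assms)
    finally show "(\<Sum>e\<in>E. sT (of_real (inner (snd w e) e')) (L e' (snd w e))) = L e' e'"
      by (simp add: x)
  qed
  finally show ?thesis .
qed

text \<open>The sum of (\<beta>, e) e over \<open>E\<close> is \<open>vec \<beta>\<close>, so the
  halves of \<open>T2\<close> subtracted in \<open>wt\<close> add up to \<open>A\<close>.\<close>

lemma D_plus_A: "D t + A t = (\<Sum>e\<in>E. P (hp e) (Q (kr e) t))"
proof -
  have "(\<Sum>e\<in>E. P (T2 e) (Q (kr e) t))
    = (\<Sum>\<beta>\<in>Pos. \<Sum>e\<in>E. sT (of_real (c \<beta> * pr \<beta> e)) (P (tw (w_refl \<Phi> \<beta>)) (Q (kr e) t)))"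
    unfolding T2_def by (simp add: P_rules) (rule sum.swap)
  also have "\<dots> = (\<Sum>\<beta>\<in>Pos. sT (of_real (c \<beta>)) (P (tw (w_refl \<Phi> \<beta>)) (Q (kr (vec \<beta>)) t)))"
  proof (rule sum.cong[OF HOL.refl])
    fix \<beta>
    let ?L = "\<lambda>u. P (tw (w_refl \<Phi> \<beta>)) (Q (kr u) t)"
    have "(\<Sum>e\<in>E. sT (of_real (inner (vec \<beta>) e)) (?L e)) = ?L (vec \<beta>)"
      by (rule expand_linear) (simp_all add: kr_add kr_scaleR P_rules Q_rules)
    moreover have "(\<Sum>e\<in>E. sT (of_real (c \<beta> * pr \<beta> e)) (?L e))
        = sT (of_real (c \<beta>)) (\<Sum>e\<in>E. sT (of_real (inner (vec \<beta>) e)) (?L e))"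
      by (simp add: inner_vec T.scale_sum_right)
    ultimately show "(\<Sum>e\<in>E. sT (of_real (c \<beta> * pr \<beta> e)) (?L e)) = sT (of_real (c \<beta>)) (?L (vec \<beta>))"
      by simp
  qed
  finally have "A t = sT (1/2) (\<Sum>e\<in>E. P (T2 e) (Q (kr e) t))" by (simp add: A_def)
  then show ?thesis
    by (simp add: D_def wt_def P_rules T.scale_sum_right sum_subtractf)
qed

lemma halve: "t + t = u + u \<Longrightarrow> t = (u :: 't)"
proof -
  assume "t + t = u + u"
  moreover have "sT 2 x = x + x" for x using T.scale_left_distrib[of 1 1 x] by simp
  ultimately have "sT 2 t = sT 2 u" by simp
  then show ?thesis by (simp only: T.scale_cancel_left) simp
qed

text \<open>The double sum is symmetrised: the Hecke factors commute and the Clifford factors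
  anticommute up to a scalar, so only the diagonal survives, where it gives -2 e e. Doubling first
  accounts for \<open>halve\<close>.\<close>

lemma D_plus_A_square:
  defines "D0 \<equiv> \<lambda>t. D t + A t"
  shows "D0 (D0 t) = - sT (cpx_form (dual_inner \<Phi>) \<nu> \<nu>) t"
proof (rule halve)
  let ?M = "\<lambda>e e'. P (hp e * hp e') (Q (kr e * kr e') t)"
  let ?z = "cpx_form (dual_inner \<Phi>) \<nu> \<nu>"
  have sq: "D0 (D0 t) = (\<Sum>e\<in>E. \<Sum>e'\<in>E. ?M e e')"
    unfolding D0_def D_plus_A by (simp add: P_rules Q_rules P_lin(5) Q_lin(5) PQ)
  have "D0 (D0 t) + D0 (D0 t) = (\<Sum>e\<in>E. \<Sum>e'\<in>E. ?M e e' + ?M e' e)"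
    unfolding sq using sum.swap[of "\<lambda>e e'. ?M e e'" E E] by (simp add: sum.distrib)
  also have "\<dots> = (\<Sum>e\<in>E. \<Sum>e'\<in>E. if e' = e then - sT 2 (P (hp e * hp e) t) else 0)"
  proof (intro sum.cong HOL.refl)
    fix e e' assume e: "e \<in> E" "e' \<in> E"
    have "?M e e' + ?M e' e = P (hp e * hp e') (Q (kr e * kr e' + kr e' * kr e) t)"
      by (simp add: hp_commute[of e' e] P_rules Q_rules)
    also have "\<dots> = sT (of_real (- 2 * inner e e')) (P (hp e * hp e') t)"
      by (simp only: kr_anticommute Q_lin P_lin)
    finally show "?M e e' + ?M e' e = (if e' = e then - sT 2 (P (hp e * hp e) t) else 0)"
      using e by (auto simp: inner_E)
  qed
  also have "\<dots> = - sT 2 (P (\<Sum>e\<in>E. hp e * hp e) t)"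
    by (simp add: finite_E P_rules T.scale_sum_right sum_negf)
  also have "P (\<Sum>e\<in>E. hp e * hp e) t = sT ?z t"
    using central[OF casimir(1), of t] unfolding casimir(2) by (simp add: casimir(3)[of \<nu>])
  also have "- sT 2 (sT ?z t) = - sT ?z t + - sT ?z t"
    using T.scale_left_distrib[of 1 1 "sT ?z t"] by simp
  finally show "D0 (D0 t) + D0 (D0 t) = - sT ?z t + - sT ?z t" .
qed

text \<open>The anticommutator vanishes for each root separately. Moving the reflection past
  \<open>wt e\<close> leaves a correction along the coroot, which contracts to 2
  \<open>wt (vec \<beta>)\<close>; exchanging the Clifford vectors leaves -2 times the same
  element.\<close>

lemma D_A_anticommute: "D (A t) + A (D t) = 0"
proof -
  have zero: "(\<Sum>e\<in>E. P (wt e) (Q (kr e) (P (tw (w_refl \<Phi> \<beta>)) (Q (kr (vec \<beta>)) t))))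
     + P (tw (w_refl \<Phi> \<beta>)) (Q (kr (vec \<beta>)) (\<Sum>e\<in>E. P (wt e) (Q (kr e) t))) = 0"
    (is "?X + ?Y = 0") if "\<beta> \<in> R" for \<beta>
  proof -
    let ?b = "vec \<beta>" and ?t = "tw (w_refl \<Phi> \<beta>)"
    have "?Y = (\<Sum>e\<in>E. P (?t * wt e) (Q (kr ?b * kr e) t))"
      by (simp add: P_rules Q_rules P_lin(5) Q_lin(5) PQ)
    also have "\<dots> = (\<Sum>e\<in>E. P (wt e * ?t) (Q (kr ?b * kr e) t))
        - (\<Sum>e\<in>E. sT (of_real (inner ?b e)) (P (wt (cr \<beta>) * ?t) (Q (kr ?b * kr e) t)))"
      by (simp add: wt_refl[OF that] coreflect_def wt_diff wt_scaleR hs_mult left_diff_distrib P_rules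
          inner_vec sum_subtractf)
    also have "(\<Sum>e\<in>E. sT (of_real (inner ?b e)) (P (wt (cr \<beta>) * ?t) (Q (kr ?b * kr e) t)))
        = P (wt (cr \<beta>) * ?t) (Q (kr ?b * kr ?b) t)"
      by (rule expand_linear) (simp_all add: kr_add kr_scaleR distrib_left ks_mult P_rules Q_rules)
    also have "\<dots> = sT (of_real (- inner ?b ?b)) (P (wt (cr \<beta>) * ?t) t)"
      by (simp only: kr_square Q_lin P_lin)
    \<comment> \<open>The square of \<open>kr ?b\<close> cancels the denominator in
      \<open>coroot_vec\<close>, leaving the constant 2.\<close>
    also have "\<dots> = sT (- 2) (P (wt ?b * ?t) t)"
      using vec_nz[OF that] by (simp add: coroot_vec[OF that] wt_scaleR hs_mult P_rules)
    finally have Y: "?Y = (\<Sum>e\<in>E. P (wt e * ?t) (Q (kr ?b * kr e) t)) - sT (- 2) (P (wt ?b * ?t) t)" .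
    have "?X = (\<Sum>e\<in>E. P (wt e * ?t) (Q (kr e * kr ?b) t))"
      by (simp add: P_rules Q_rules P_lin(5) Q_lin(5) PQ)
    then have "?X + (\<Sum>e\<in>E. P (wt e * ?t) (Q (kr ?b * kr e) t))
        = (\<Sum>e\<in>E. P (wt e * ?t) (Q (kr e * kr ?b + kr ?b * kr e) t))"
      by (simp add: P_rules Q_rules sum.distrib)
    also have "\<dots> = (\<Sum>e\<in>E. sT (- 2) (sT (of_real (inner ?b e)) (P (wt e * ?t) t)))"
      by (simp only: kr_anticommute Q_lin P_lin) (simp add: inner_commute)
    also have "\<dots> = sT (- 2) (\<Sum>e\<in>E. sT (of_real (inner ?b e)) (P (wt e * ?t) t))"
      by (simp only: T.scale_sum_right)
    also have "(\<Sum>e\<in>E. sT (of_real (inner ?b e)) (P (wt e * ?t) t)) = P (wt ?b * ?t) t"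
      by (rule expand_linear) (simp_all add: wt_add wt_scaleR distrib_right hs_mult P_rules)
    finally show ?thesis unfolding Y by (simp add: algebra_simps)
  qed
  have "D (A t) + A (D t) = sT (1/2) (\<Sum>\<beta>\<in>Pos. sT (of_real (c \<beta>))
     ((\<Sum>e\<in>E. P (wt e) (Q (kr e) (P (tw (w_refl \<Phi> \<beta>)) (Q (kr (vec \<beta>)) t))))
     + P (tw (w_refl \<Phi> \<beta>)) (Q (kr (vec \<beta>)) (\<Sum>e\<in>E. P (wt e) (Q (kr e) t)))))"
    unfolding T.scale_right_distrib sum.distrib
    by (simp add: A_def D_scale additive_rules[of D, OF D_add]) (simp add: D_def)
  then show ?thesis by (simp add: zero Pos_R)
qed

lemma D_square: "D (D t) = - sT (cpx_form (dual_inner \<Phi>) \<nu> \<nu>) t - A (A t)"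
proof -
  have "D (D t) + A (A t) + (D (A t) + A (D t)) = - sT (cpx_form (dual_inner \<Phi>) \<nu> \<nu>) t"
    using D_plus_A_square[of t] by (simp add: D_add A_add algebra_simps)
  then show ?thesis unfolding D_A_anticommute by (simp add: algebra_simps)
qed

text \<open>Two Clifford elements \<open>b\<close> and \<open>b'\<close> appear because
  \<open>D\<close> exchanges the actions of a and \<epsilon>(a). Applying it twice returns to a,
  which gives \<open>A_square_equivariant\<close>.\<close>

lemma D_equivariant:
  assumes w: "w \<in> W" and b: "\<And>u. b * kr u = kr (snd w u) * b'"
  shows "P (tw w) (Q b (D t)) = D (P (tw w) (Q b' t))"
proof -
  let ?y = "P (tw w) (Q b' t)"
  have "P (tw w) (Q b (D t)) = (\<Sum>e\<in>E. P (tw w * wt e) (Q (b * kr e) t))"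
    by (simp add: D_def P_rules Q_rules P_lin(5) Q_lin(5) PQ)
  also have "\<dots> = (\<Sum>e\<in>E. P (wt (snd w e)) (Q (kr (snd w e)) ?y))"
    by (simp add: wt_W[OF w] b P_lin(5) Q_lin(5) PQ)
  also have "\<dots> = D ?y"
    unfolding D_def
    by (rule expand_bilinear[OF _ _ _ _ w, of "\<lambda>u v. P (wt u) (Q (kr v) ?y)"])
      (simp_all add: wt_add wt_scaleR kr_add kr_scaleR P_rules Q_rules)
  finally show ?thesis .
qed

lemma A_square_equivariant:
  assumes a: "a \<in> G"
  shows "A (A (P (tw (wp a)) (Q a t))) = P (tw (wp a)) (Q a (A (A t)))"
proof -
  have W: "wp a \<in> W" using coverD[OF a] by simp
  have "D (D (P (tw (wp a)) (Q a t))) = D (P (tw (wp a)) (Q (keps K a) (D t)))"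
    by (simp add: D_equivariant[OF W cover_kr[OF a]])
  also have "\<dots> = P (tw (wp a)) (Q a (D (D t)))"
    by (simp add: D_equivariant[OF W cover_kr'[OF a]])
  finally show ?thesis by (simp add: D_square P_rules Q_rules)
qed

section \<open>Adjoints and the inequality\<close>

lemma herm: "hermitian_form sT C"
  using pos by (simp add: pos_form_def)

lemmas C_rules = hermitian_formD(1-4)[OF herm] hermitian_form_more[OF herm]

text \<open>An isometry whose square is -1 is skew-adjoint.\<close>

lemma C_kr_E: "e \<in> E \<Longrightarrow> C (Q (kr e) t) u = - C t (Q (kr e) u)"
proof -
  assume e: "e \<in> E"
  have "Q (kr e) (Q (kr e) u) = - u"
    using inner_E[OF e e] by (simp add: kr_square Q_rules Q_lin(6) flip: Q_lin(5))
  then have "C (Q (kr e) t) u = - C (Q (kr e) t) (Q (kr e) (Q (kr e) u))"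
    by (simp add: C_rules)
  then show ?thesis by (simp add: C_Q[OF e])
qed

lemma C_kr: "C (Q (kr b) t) u = - C t (Q (kr b) u)"
proof -
  have "Q (kr b) t = (\<Sum>e\<in>E. sT (of_real (inner b e)) (Q (kr e) t))" for t
    by (rule expand_linear[symmetric]) (simp_all add: kr_add kr_scaleR Q_rules)
  then show ?thesis by (simp add: C_rules C_kr_E sum_negf)
qed

text \<open>Each term is a product of two commuting skew operators, hence self-adjoint. In
  \<open>C_A\<close> one factor, a reflection, is self-adjoint, so the product is skew.\<close>

lemma C_D: "C (D t) u = C t (D u)"
  by (simp add: D_def C_rules C_P star_wt P_rules C_kr PQ)

lemma C_A: "C (A t) u = - C t (A u)"
  by (simp add: A_def C_rules C_P C_kr PQ star_refl Pos_R sum_negf)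

text \<open>Let r, a, d be the squared lengths of t, A t and D t. Pairing the eigenvalue equations
  with t gives z = a / r and \<langle>\<nu>, \<nu>\<rangle> = (a - d) / r, which shows both that
  they are real and that they differ by d / r \<ge> 0.\<close>

theorem dirac_inequality:
  assumes nz: "t \<noteq> 0" and eigen: "- A (A t) = sT z t"
  shows "z \<in> \<real>" "cpx_form (dual_inner \<Phi>) \<nu> \<nu> \<in> \<real>"
    "Re (cpx_form (dual_inner \<Phi>) \<nu> \<nu>) \<le> Re z"
proof -
  let ?n = "cpx_form (dual_inner \<Phi>) \<nu> \<nu>"
  define r where "r = Re (C t t)"
  have r: "r > 0" "C t t = of_real r"
    using pos nz hermitian_form_self[OF herm, of t] by (auto simp: pos_form_def r_def)
  define a where "a = Re (C (A t) (A t))"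
  define d where "d = Re (C (D t) (D t))"
  have d: "d \<ge> 0" "C (D t) (D t) = of_real d"
    using pos_form_nonneg[OF pos, of "D t"] hermitian_form_self[OF herm, of "D t"] by (auto simp: d_def)
  have "z * of_real r = C (- A (A t)) t" by (simp add: eigen C_rules r)
  also have "\<dots> = of_real a"
    using hermitian_form_self[OF herm, of "A t"] by (simp add: C_rules C_A a_def)
  finally have z: "z = of_real (a / r)" using r(1) by (simp add: field_simps)
  then show "z \<in> \<real>" by simp
  have "D (D t) = sT (z - ?n) t"
    using eigen by (simp add: D_square T.scale_left_diff_distrib)
  then have "of_real d = (z - ?n) * of_real r"
    using d(2) C_D[of "D t" t] by (simp add: C_rules r)
  also have "\<dots> = of_real a - ?n * of_real r"
    using r(1) by (simp add: z left_diff_distrib)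
  finally have "?n * of_real r = of_real (a - d)" by (simp add: algebra_simps)
  then have "?n = of_real (a - d) / of_real r" using r(1) by (simp add: nonzero_eq_divide_eq)
  then have n: "?n = of_real (a / r - d / r)" by (simp add: diff_divide_distrib)
  then show "?n \<in> \<real>" by (simp only: Reals_of_real)
  show "Re ?n \<le> Re z" unfolding n z using d(1) r(1) by simp
qed

end

section \<open>Modules on tensor products\<close>

lemma algebra_moduleD:
  assumes "algebra_module sc s Q"
  shows "vector_space s" "Vector_Spaces.linear s s (Q k)"
    "Q k (t + u) = Q k t + Q k u" "Q k (s z t) = s z (Q k t)"
    "Q (k + k') t = Q k t + Q k' t" "Q (sc z k) t = s z (Q k t)" "Q (k * k') t = Q k (Q k' t)" "Q 1 t = t"
  using assms unfolding algebra_module_def Vector_Spaces.linear_iff by blast+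

context tensor
begin

lemma linear_ident: "Vector_Spaces.linear sX sX (\<lambda>x. x)" "Vector_Spaces.linear sS sS (\<lambda>s. s)"
  by (simp_all add: Vector_Spaces.linear_iff X.vector_space_axioms S.vector_space_axioms)

lemma tensor_map_module_left:
  assumes "algebra_module sc sX \<pi>"
  shows "algebra_module sc sT (\<lambda>h. tensor_map sT tens (\<pi> h) (\<lambda>s. s))"
proof -
  note \<pi> = algebra_moduleD[OF assms]
  define P where "P h = tensor_map sT tens (\<pi> h) (\<lambda>s. s)" for h
  have lin: "Vector_Spaces.linear sT sT (P h)" for h
    unfolding P_def by (rule linear_tensor_map[OF \<pi>(2) linear_ident(2)])
  have add: "P h (t + u) = P h t + P h u" for h t u
    using lin[of h] by (simp add: Vector_Spaces.linear_iff)
  have pure: "P h (tens x s) = tens (\<pi> h x) s" for h x s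
    unfolding P_def by (rule tensor_map_tens[OF \<pi>(2) linear_ident(2)])
  have "P 1 t = t" for t
    by (induction t rule: tensor_induct) (simp_all add: pure add \<pi>)
  moreover have "P (a * b) t = P a (P b t)" for a b t
    by (induction t rule: tensor_induct) (simp_all add: pure add \<pi>)
  moreover have "P (a + b) t = P a t + P b t" for a b t
    by (induction t rule: tensor_induct) (simp_all add: pure add \<pi> tens_add_left)
  moreover have "P (sc z a) t = sT z (P a t)" for z a t
    by (induction t rule: tensor_induct)
      (simp_all add: pure add \<pi> tens_scale_left T.scale_right_distrib)
  ultimately show ?thesis
    unfolding algebra_module_def P_def[symmetric] using lin T.vector_space_axioms by blast
qed

lemma tensor_map_module_right:
  assumes "algebra_module sc sS \<gamma>"
  shows "algebra_module sc sT (\<lambda>k. tensor_map sT tens (\<lambda>x. x) (\<gamma> k))"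
proof -
  note \<gamma> = algebra_moduleD[OF assms]
  define P where "P k = tensor_map sT tens (\<lambda>x. x) (\<gamma> k)" for k
  have lin: "Vector_Spaces.linear sT sT (P h)" for h
    unfolding P_def by (rule linear_tensor_map[OF linear_ident(1) \<gamma>(2)])
  have add: "P h (t + u) = P h t + P h u" for h t u
    using lin[of h] by (simp add: Vector_Spaces.linear_iff)
  have pure: "P h (tens x s) = tens x (\<gamma> h s)" for h x s
    unfolding P_def by (rule tensor_map_tens[OF linear_ident(1) \<gamma>(2)])
  have "P 1 t = t" for t
    by (induction t rule: tensor_induct) (simp_all add: pure add \<gamma>)
  moreover have "P (a * b) t = P a (P b t)" for a b t
    by (induction t rule: tensor_induct) (simp_all add: pure add \<gamma>)
  moreover have "P (a + b) t = P a t + P b t" for a b t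
    by (induction t rule: tensor_induct) (simp_all add: pure add \<gamma> tens_add_right)
  moreover have "P (sc z a) t = sT z (P a t)" for z a t
    by (induction t rule: tensor_induct)
      (simp_all add: pure add \<gamma> tens_scale_right T.scale_right_distrib)
  ultimately show ?thesis
    unfolding algebra_module_def P_def[symmetric] using lin T.vector_space_axioms by blast
qed

lemma tensor_map_commute:
  assumes f: "Vector_Spaces.linear sX sX f" and g: "Vector_Spaces.linear sS sS g"
  shows "tensor_map sT tens f (\<lambda>s. s) (tensor_map sT tens (\<lambda>x. x) g t) = tensor_map sT tens f g t"
    and "tensor_map sT tens (\<lambda>x. x) g (tensor_map sT tens f (\<lambda>s. s) t) = tensor_map sT tens f g t"
proof -
  note lin = linear_tensor_map[OF f g] linear_tensor_map[OF f linear_ident(2)]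
    linear_tensor_map[OF linear_ident(1) g]
  note pure = tensor_map_tens[OF f g] tensor_map_tens[OF f linear_ident(2)]
    tensor_map_tens[OF linear_ident(1) g]
  show "tensor_map sT tens f (\<lambda>s. s) (tensor_map sT tens (\<lambda>x. x) g t) = tensor_map sT tens f g t"
    by (induction t rule: tensor_induct) (use lin in \<open>simp_all add: pure Vector_Spaces.linear_iff\<close>)
  show "tensor_map sT tens (\<lambda>x. x) g (tensor_map sT tens f (\<lambda>s. s) t) = tensor_map sT tens f g t"
    by (induction t rule: tensor_induct) (use lin in \<open>simp_all add: pure Vector_Spaces.linear_iff\<close>)
qed

text \<open>A tensor involves finitely many vectors of X. Finitely many operators move these to
  finitely many vectors, and the factor S is finite-dimensional, so all images share a
  finite-dimensional space even when X is large.\<close>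

lemma tensor_orbit_finite:
  assumes F: "finite F" "S.span F = UNIV" and A: "finite A"
    and lin: "\<And>f. f \<in> A \<Longrightarrow> Vector_Spaces.linear sX sX f"
  shows "\<exists>B. finite B \<and> (\<forall>f\<in>A. \<forall>g. Vector_Spaces.linear sS sS g \<longrightarrow> tensor_map sT tens f g t \<in> T.span B)"
proof (induction t rule: tensor_induct)
  case (pure x s)
  let ?B = "\<Union>f\<in>A. tens (f x) ` F"
  have "tensor_map sT tens f g (tens x s) \<in> T.span ?B"
    if f: "f \<in> A" and g: "Vector_Spaces.linear sS sS g" for f g
  proof -
    have "g s \<in> S.span F" by (simp add: F)
    then have "tens (f x) (g s) \<in> T.span ?B"
    proof (induction rule: S.span_induct_alt)
      case base
      then show ?case using tens_scale_right[of "f x" 0 0] by (simp add: T.span_zero)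
    next
      case (step c y z)
      then have "tens (f x) y \<in> ?B" using f by blast
      with step(2) show ?case
        by (simp add: tens_add_right tens_scale_right T.span_add T.span_scale T.span_base)
    qed
    then show ?thesis by (simp add: tensor_map_tens[OF lin[OF f] g])
  qed
  moreover have "finite ?B" using A F by simp
  ultimately show ?case by (intro exI[of _ ?B]) blast
next
  case (add t u)
  from add(1) obtain B where B: "finite B"
    "\<And>f g. f \<in> A \<Longrightarrow> Vector_Spaces.linear sS sS g \<Longrightarrow> tensor_map sT tens f g t \<in> T.span B"
    by blast
  from add(2) obtain B' where B': "finite B'"
    "\<And>f g. f \<in> A \<Longrightarrow> Vector_Spaces.linear sS sS g \<Longrightarrow> tensor_map sT tens f g u \<in> T.span B'"
    by blast
  have "tensor_map sT tens f g (t + u) \<in> T.span (B \<union> B')"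
    if "f \<in> A" "Vector_Spaces.linear sS sS g" for f g
  proof -
    have "tensor_map sT tens f g (t + u) = tensor_map sT tens f g t + tensor_map sT tens f g u"
      using linear_tensor_map[OF lin[OF that(1)] that(2)] by (simp add: Vector_Spaces.linear_iff)
    moreover have "T.span B \<subseteq> T.span (B \<union> B')" "T.span B' \<subseteq> T.span (B \<union> B')"
      by (simp_all add: T.span_mono)
    ultimately show ?thesis using B(2)[OF that] B'(2)[OF that] by (auto intro: T.span_add)
  qed
  then show ?case using B(1) B'(1) by (intro exI[of _ "B \<union> B'"]) simp
qed

end

section \<open>Clifford modules\<close>

text \<open>It is used twice: on S, to find a finite spanning set, and on X \<otimes> S, to make the
  form invariant.\<close>

locale clifford_rep = cover \<Phi> Pos Simple c K + V: vector_space sV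
  for \<Phi> :: "('v::real_vector, 'u::real_inner) root_data"
    and Pos Simple :: "'v set" and c :: "'v \<Rightarrow> real"
    and K :: "('u, 'k::ring_1) clifford_data"
    and sV :: "complex \<Rightarrow> 'w::ab_group_add \<Rightarrow> 'w" +
  fixes Q :: "'k \<Rightarrow> 'w \<Rightarrow> 'w"
  assumes Q_mod: "algebra_module ks sV Q"
begin

lemmas Q = algebra_moduleD[OF Q_mod]

lemma Q_minus: "Q (- k) t = - Q k t" "Q k (- t) = - Q k t"
  using Q(6)[of "-1" k t] Q(4)[of k "-1" t] by simp_all

lemma Q_square: "e \<in> E \<Longrightarrow> Q (kr e) (Q (kr e) t) = - t"
  by (simp add: kr_square inner_E Q_minus Q(8) flip: Q(7))

lemma Q_anti: "e \<in> E \<Longrightarrow> e' \<in> E \<Longrightarrow> e \<noteq> e' \<Longrightarrow> Q (kr e) (Q (kr e') t) = - Q (kr e') (Q (kr e) t)"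
proof -
  assume "e \<in> E" "e' \<in> E" "e \<noteq> e'"
  then have "kr e * kr e' = - (kr e' * kr e)"
    using kr_anticommute[of e e'] by (simp add: inner_E eq_neg_iff_add_eq_0)
  then show ?thesis by (simp add: Q_minus flip: Q(7))
qed

text \<open>Adjoin one basis vector e at a time, replacing F by the union of F and e F. The new span
  is stable under e because e squares to -1, and still stable under earlier vectors because they
  anticommute with e. In the end it is a nonzero submodule.\<close>

lemma finite_span_of_irreducible:
  assumes irr: "irreducible_under sV (range Q)"
  shows "\<exists>F. finite F \<and> V.span F = UNIV"
proof -
  obtain v :: 'w where v: "v \<noteq> 0" using irr unfolding irreducible_under_def by blast
  have img: "Q k ` V.span B = V.span (Q k ` B)" for k B
  proof -
    interpret Vector_Spaces.linear sV sV "Q k" by (rule Q(2))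
    show ?thesis by (rule span_image[symmetric])
  qed
  have stable: "Q k y \<in> V.span B'" if "y \<in> V.span B" "Q k ` B \<subseteq> V.span B'" for k y B B'
  proof -
    have "Q k y \<in> V.span (Q k ` B)" using that(1) by (simp flip: img)
    then show ?thesis using V.span_minimal[OF that(2) V.subspace_span] by blast
  qed
  have "\<exists>F. finite F \<and> v \<in> F \<and> (\<forall>e\<in>E'. \<forall>y\<in>V.span F. Q (kr e) y \<in> V.span F)" if "E' \<subseteq> E" for E'
    using finite_subset[OF that finite_E] that
  proof (induction rule: finite_induct)
    case empty
    show ?case by (rule exI[of _ "{v}"]) simp
  next
    case (insert e E')
    then obtain F where F: "finite F" "v \<in> F"
      "\<And>e' y. e' \<in> E' \<Longrightarrow> y \<in> V.span F \<Longrightarrow> Q (kr e') y \<in> V.span F" by blast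
    define F' where "F' = F \<union> Q (kr e) ` F"
    have e: "e \<in> E" using insert by blast
    have sub: "V.span F \<subseteq> V.span F'" "Q (kr e) ` V.span F \<subseteq> V.span F'"
      unfolding F'_def img by (simp_all add: V.span_mono)
    have gens: "Q (kr e') ` F' \<subseteq> V.span F'" if e': "e' \<in> insert e E'" for e'
    proof -
      have "Q (kr e') x \<in> V.span F' \<and> Q (kr e') (Q (kr e) x) \<in> V.span F'" if x: "x \<in> F" for x
      proof (cases "e' = e")
        case True
        have "x \<in> V.span F'" "Q (kr e) x \<in> V.span F'"
          using x sub V.span_base[of x F] by blast+
        then show ?thesis by (simp add: True Q_square[OF e] V.span_neg)
      next
        case False
        then have e'': "e' \<in> E'" "e' \<in> E" using e' insert by auto
        have "Q (kr e') x \<in> V.span F" using F(3)[OF e''(1) V.span_base[OF x]] .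
        then have "Q (kr e') x \<in> V.span F'" "Q (kr e) (Q (kr e') x) \<in> V.span F'"
          using sub by blast+
        then show ?thesis by (simp add: Q_anti[OF e''(2) e False] V.span_neg)
      qed
      then show ?thesis by (auto simp: F'_def)
    qed
    show ?case
    proof (intro exI[of _ F'] conjI ballI)
      show "finite F'" "v \<in> F'" using F(1,2) by (simp_all add: F'_def)
      show "Q (kr e') y \<in> V.span F'" if "e' \<in> insert e E'" "y \<in> V.span F'" for e' y
        by (rule stable[OF that(2) gens[OF that(1)]])
    qed
  qed
  from this[OF subset_refl] obtain F where F: "finite F" "v \<in> F"
    "\<And>e y. e \<in> E \<Longrightarrow> y \<in> V.span F \<Longrightarrow> Q (kr e) y \<in> V.span F" by blast
  have kr: "Q (kr u) y \<in> V.span F" if y: "y \<in> V.span F" for u y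
  proof -
    have "Q (sum g I) y = (\<Sum>i\<in>I. Q (g i) y)" for g and I :: "'u set"
      using Q(6)[of 0 0 y] by (induction I rule: infinite_finite_induct) (simp_all add: Q)
    moreover have "kr (sum g I) = (\<Sum>i\<in>I. kr (g i))" for g and I :: "'u set"
      by (induction I rule: infinite_finite_induct) (simp_all add: kr_zero kr_add)
    ultimately have "Q (kr (\<Sum>e\<in>E. inner u e *\<^sub>R e)) y = (\<Sum>e\<in>E. sV (of_real (inner u e)) (Q (kr e) y))"
      by (simp add: kr_scaleR Q)
    then show ?thesis using F(3)[OF _ y] by (simp flip: expand_E add: V.span_sum V.span_scale)
  qed
  \<comment> \<open>Stability passes from real vectors to complex ones by real and imaginary parts,
    and then to the whole algebra by its generation.\<close>
  have all: "\<forall>y\<in>V.span F. Q k y \<in> V.span F" for k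
    using presented
  proof (induction k rule: presented_algebra_induct)
    case (gen \<omega>)
    then show ?case
      by (cases \<omega> rule: prod.exhaust) (simp add: kvec_decompose Q kr V.span_add V.span_scale)
  qed (simp_all add: Q V.span_add V.span_scale)
  have "V.span F = {0} \<or> V.span F = UNIV"
    using irr all V.subspace_span[of F] unfolding irreducible_under_def by blast
  then have "V.span F = UNIV" using v V.span_base[OF F(2)] by auto
  with F(1) show ?thesis by blast
qed

text \<open>Averaging over the vectors of \<open>E\<close> in turn: adding the e-translate of the
  form makes it invariant under e, since e squares to -1, and keeps invariance under earlier
  vectors, since signs cancel in both arguments. Adjoints of \<open>P\<close> survive because
  \<open>P\<close> commutes with \<open>Q\<close>.\<close>

lemma invariant_form:
  assumes pos: "pos_form sV B"
    and adj: "\<And>h t u. B (P h t) u = B t (P (st h) u)"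
    and comm: "\<And>h k t. Q k (P h t) = P h (Q k t)"
  shows "\<exists>C. pos_form sV C \<and> (\<forall>h t u. C (P h t) u = C t (P (st h) u)) \<and>
           (\<forall>e\<in>E. \<forall>t u. C (Q (kr e) t) (Q (kr e) u) = C t u)"
proof -
  have "\<exists>C. pos_form sV C \<and> (\<forall>h t u. C (P h t) u = C t (P (st h) u)) \<and>
           (\<forall>e\<in>E'. \<forall>t u. C (Q (kr e) t) (Q (kr e) u) = C t u)" if "E' \<subseteq> E" for E'
    using finite_subset[OF that finite_E] that
  proof (induction rule: finite_induct)
    case empty
    then show ?case using pos adj by blast
  next
    case (insert e E')
    then obtain C where C: "pos_form sV C" "\<And>h t u. C (P h t) u = C t (P (st h) u)"
      "\<And>e' t u. e' \<in> E' \<Longrightarrow> C (Q (kr e') t) (Q (kr e') u) = C t u" by blast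
    have e: "e \<in> E" using insert by blast
    have herm: "hermitian_form sV C" using C(1) by (simp add: pos_form_def)
    note C_rules = hermitian_formD(1-4)[OF herm] hermitian_form_more(3,4)[OF herm]
    define C' where "C' t u = C t u + C (Q (kr e) t) (Q (kr e) u)" for t u
    have "C' (t + t') u = C' t u + C' t' u" "C' (sV z t) u = z * C' t u" for t t' u z
      by (simp_all add: C'_def C_rules Q distrib_left)
    moreover have "C' u t = cnj (C' t u)" for t u
      unfolding C'_def complex_cnj_add
      by (rule arg_cong2[of _ _ _ _ "(+)"]) (rule hermitian_formD(5)[OF herm])+
    moreover have "Re (C' t t) > 0" if "t \<noteq> 0" for t
    proof -
      have "Re (C t t) > 0" using C(1) that by (simp add: pos_form_def)
      then show ?thesis using pos_form_nonneg[OF C(1), of "Q (kr e) t"] by (simp add: C'_def)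
    qed
    ultimately have "pos_form sV C'" unfolding pos_form_def hermitian_form_def by blast
    moreover have "C' (P h t) u = C' t (P (st h) u)" for h t u
      by (simp add: C'_def C comm)
    moreover have "C' (Q (kr e') t) (Q (kr e') u) = C' t u" if e': "e' \<in> insert e E'" for e' t u
    proof (cases "e' = e")
      case True
      then show ?thesis by (simp add: C'_def Q_square[OF e] C_rules)
    next
      case False
      then have e'': "e' \<in> E'" "e' \<in> E" using e' insert by auto
      have "Q (kr e) (Q (kr e') x) = - Q (kr e') (Q (kr e) x)" for x
        using Q_anti[OF e e''(2)] False by simp
      then show ?thesis by (simp add: C'_def C_rules C(3)[OF e''(1)])
    qed
    ultimately show ?case by blast
  qed
  from this[OF subset_refl] show ?thesis .
qed

end

section \<open>Representations of the cover\<close>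

text \<open>The assumption \<open>genuine\<close> makes the group element -1 act as the scalar -1,
  so that signs in the Clifford algebra become signs in U. For the given U it follows from the
  embedding into X \<otimes> S.\<close>

locale cover_rep = cover \<Phi> Pos Simple c K + U: finite_span sU F
  for \<Phi> :: "('v::real_vector, 'u::real_inner) root_data"
    and Pos Simple :: "'v set" and c :: "'v \<Rightarrow> real"
    and K :: "('u, 'k::ring_1) clifford_data"
    and sU :: "complex \<Rightarrow> 'm::ab_group_add \<Rightarrow> 'm" and F :: "'m set" +
  fixes \<sigma> :: "'k \<Rightarrow> 'm \<Rightarrow> 'm"
  assumes rep: "group_rep G sU \<sigma>" and genuine: "\<And>u. \<sigma> (- 1) u = - u"
begin

abbreviation "dn \<equiv> dual_norm \<Phi>"

lemma \<sigma>_lin: "g \<in> G \<Longrightarrow> \<sigma> g (x + y) = \<sigma> g x + \<sigma> g y" "g \<in> G \<Longrightarrow> \<sigma> g (sU z x) = sU z (\<sigma> g x)"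
  using rep unfolding group_rep_def Vector_Spaces.linear_iff by blast+

lemma \<sigma>_mult: "g \<in> G \<Longrightarrow> h \<in> G \<Longrightarrow> \<sigma> (g * h) x = \<sigma> g (\<sigma> h x)"
  using rep unfolding group_rep_def by blast

lemma \<sigma>_one: "\<sigma> 1 x = x"
  using rep unfolding group_rep_def by blast

lemma \<sigma>_minus: "g \<in> G \<Longrightarrow> \<sigma> (- g) x = - \<sigma> g x"
  using \<sigma>_mult[of "- 1" g x] cover_minus[of 1] cover_one by (simp add: genuine)

lemma \<sigma>_sum: "g \<in> G \<Longrightarrow> \<sigma> g (\<Sum>i\<in>I. x i) = (\<Sum>i\<in>I. \<sigma> g (x i))"
  using \<sigma>_lin(2)[of g 0 0]
  by (induction I rule: infinite_finite_induct) (simp_all add: \<sigma>_lin)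

text \<open>The operator \<open>A\<close> expressed through the elements \<open>f \<beta>\<close> of
  the cover, so that it makes sense on U; intertwiners carry it to \<open>A\<close>.\<close>

definition AU :: "'m \<Rightarrow> 'm" where
  "AU x = sU (1/2) (\<Sum>\<beta>\<in>Pos. sU (of_real (c \<beta> * dn \<beta>)) (\<sigma> (f \<beta>) x))"

definition omega_term :: "'v \<Rightarrow> 'v \<Rightarrow> 'm \<Rightarrow> 'm" where
  "omega_term \<alpha> \<beta> x = sU (of_real (c \<alpha> * c \<beta> * dn \<alpha> * dn \<beta>)) (\<sigma> (f \<alpha> * f \<beta>) x)"

lemma f_G: "\<alpha> \<in> R \<Longrightarrow> \<beta> \<in> R \<Longrightarrow> f \<alpha> * f \<beta> \<in> G"
  by (simp add: cover_mult cover_f)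

lemma omega_act_sum:
  "group_alg_act sU \<sigma> (omega_cover \<Phi> Pos c K) x
    = sU (- 1/4) (\<Sum>(\<alpha>, \<beta>)\<in>inversion_pairs \<Phi> Pos. omega_term \<alpha> \<beta> x)"
  unfolding group_alg_act_lin_ext omega_cover_def
  by (auto simp: lin_ext_sum[OF U.vector_space_axioms] lin_ext_single[OF U.vector_space_axioms]
      U.scale_sum_right omega_term_def intro!: sum.cong)

text \<open>Over all pairs of positive roots the sum factors as the square of twice
  \<open>AU\<close>. The resulting 4 cancels against the -1/4 in \<Omega>, leaving the sign.\<close>

lemma omega_act: "group_alg_act sU \<sigma> (omega_cover \<Phi> Pos c K) x = - AU (AU x)"
proof -
  have dn_W: "dn (fst w \<alpha>) = dn \<alpha>" if "w \<in> W" for w \<alpha>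
    by (simp add: dual_norm_vec vec_W that norm_eq_sqrt_inner W_inner)
  have "(\<Sum>(\<alpha>, \<beta>)\<in>inversion_pairs \<Phi> Pos. omega_term \<alpha> \<beta> x) = (\<Sum>(\<alpha>, \<beta>)\<in>Pos \<times> Pos. omega_term \<alpha> \<beta> x)"
  proof (rule sum_inversion_pairs[OF U.vector_space_axioms])
    fix \<alpha> \<beta> assume R: "\<alpha> \<in> R" "\<beta> \<in> R"
    show "omega_term (- \<alpha>) \<beta> x = - omega_term \<alpha> \<beta> x"
      by (simp add: omega_term_def R c_minus f_minus \<sigma>_minus f_G dual_norm_vec)
    have "dn (sr \<alpha> \<beta>) = dn \<beta>" using dn_W[OF w_refl_W[OF R(1)]] by (simp add: w_refl_def)
    then show "omega_term \<alpha> \<beta> x = - omega_term (sr \<alpha> \<beta>) \<alpha> x"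
      by (simp add: omega_term_def f_swap[OF R] \<sigma>_minus f_G R sr_root c_sr mult_ac)
  qed
  also have "\<dots> = (\<Sum>\<alpha>\<in>Pos. \<Sum>\<beta>\<in>Pos. omega_term \<alpha> \<beta> x)"
    by (simp add: sum.cartesian_product)
  also have "\<dots> = sU 4 (AU (AU x))"
    unfolding AU_def
    by (simp add: \<sigma>_lin \<sigma>_sum \<sigma>_mult cover_f Pos_R U.scale_sum_right omega_term_def mult_ac)
  finally show ?thesis by (simp add: omega_act_sum)
qed

lemma AU_lin: "AU (x + y) = AU x + AU y" "AU (sU z x) = sU z (AU x)"
  by (simp_all add: AU_def \<sigma>_lin cover_f Pos_R U.scale_right_distrib sum.distrib U.scale_sum_right mult_ac)

text \<open>Diagonal pairs always occur, as a reflection negates its own root. Since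
  \<open>f \<alpha>\<close> squares to -1, their traces turn the -1/4 into the first, positive sum
  of \<open>c_scalar\<close>.\<close>

lemma omega_scalar:
  assumes scal: "\<And>x. group_alg_act sU \<sigma> (omega_cover \<Phi> Pos c K) x = sU z x"
    and nz: "v \<noteq> (0 :: 'm)"
  shows "c_scalar \<Phi> Pos c K sU \<sigma> = z"
proof -
  let ?I = "inversion_pairs \<Phi> Pos" and ?n = "endo_trace sU (\<lambda>x. x)"
  let ?J = "{(\<alpha>, \<beta>) \<in> ?I. \<alpha> \<noteq> \<beta>}"
  let ?tr = "\<lambda>(\<alpha>, \<beta>). of_real (c \<alpha> * c \<beta> * dn \<alpha> * dn \<beta>) * endo_trace sU (\<sigma> (f \<alpha> * f \<beta>))"
  have n: "?n \<noteq> 0" by (rule U.endo_trace_ident[OF nz])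
  have fin: "finite ?I" by (rule finite_subset[OF inversion_pairs_Pos]) (simp add: finite_Pos)
  have \<sigma>1: "\<sigma> 1 = (\<lambda>x. x)" by (rule ext) (rule \<sigma>_one)
  have I: "?I = (\<lambda>\<alpha>. (\<alpha>, \<alpha>)) ` Pos \<union> ?J"
    by (auto simp: inversion_pairs_def sr_self Pos_R)
  have diag: "?tr (\<alpha>, \<alpha>) = - (of_real ((c \<alpha>)\<^sup>2 * dual_inner \<Phi> \<alpha> \<alpha>) * ?n)" if "\<alpha> \<in> Pos" for \<alpha>
  proof -
    have "\<sigma> (f \<alpha> * f \<alpha>) = (\<lambda>x. sU (- 1) x)"
      by (simp add: f_square Pos_R that genuine fun_eq_iff)
    then have "endo_trace sU (\<sigma> (f \<alpha> * f \<alpha>)) = - ?n"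
      using U.endo_trace_scale[of "- 1" "\<lambda>x. x"] by simp
    moreover have "dual_inner \<Phi> \<alpha> \<alpha> = dn \<alpha> * dn \<alpha>"
      by (simp add: dual_inner_vec dual_norm_vec power2_norm_eq_inner[symmetric] power2_eq_square)
    ultimately show ?thesis by (simp add: power2_eq_square mult_ac)
  qed
  have "z * ?n = endo_trace sU (\<lambda>x. sU z x)" by (simp add: U.endo_trace_scale)
  also have "\<dots> = endo_trace sU (\<lambda>x. sU (- 1/4) (\<Sum>p\<in>?I. omega_term (fst p) (snd p) x))"
    unfolding scal[symmetric] omega_act_sum by (simp add: case_prod_beta)
  also have "\<dots> = - 1/4 * (\<Sum>p\<in>?I. ?tr p)"
    unfolding U.endo_trace_scale U.endo_trace_sum omega_term_def by (simp add: case_prod_beta)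
  also have "(\<Sum>p\<in>?I. ?tr p) = (\<Sum>p\<in>(\<lambda>\<alpha>. (\<alpha>, \<alpha>)) ` Pos. ?tr p) + (\<Sum>p\<in>?J. ?tr p)"
  proof -
    have "finite ?J" "finite ((\<lambda>\<alpha>. (\<alpha>, \<alpha>)) ` Pos)"
      using finite_Pos by (auto intro: finite_subset[OF _ fin])
    then show ?thesis by (subst I, intro sum.union_disjoint) auto
  qed
  also have "(\<Sum>p\<in>(\<lambda>\<alpha>. (\<alpha>, \<alpha>)) ` Pos. ?tr p) = (\<Sum>\<alpha>\<in>Pos. ?tr (\<alpha>, \<alpha>))"
    by (subst sum.reindex) (auto simp: inj_on_def)
  also have "\<dots> = - (\<Sum>\<alpha>\<in>Pos. of_real ((c \<alpha>)\<^sup>2 * dual_inner \<Phi> \<alpha> \<alpha>)) * ?n"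
    by (simp only: sum.cong[OF HOL.refl diag]) (simp add: sum_negf sum_distrib_right)
  finally have "z * ?n = 1/4 * (\<Sum>\<alpha>\<in>Pos. of_real ((c \<alpha>)\<^sup>2 * dual_inner \<Phi> \<alpha> \<alpha>)) * ?n
      - 1/4 * (\<Sum>p\<in>?J. ?tr p)"
    by (simp add: algebra_simps)
  then have "z = 1/4 * (\<Sum>\<alpha>\<in>Pos. of_real ((c \<alpha>)\<^sup>2 * dual_inner \<Phi> \<alpha> \<alpha>))
      - 1/4 * ((\<Sum>p\<in>?J. ?tr p) / ?n)"
    using n by (simp add: field_simps)
  also have "(\<Sum>p\<in>?J. ?tr p) / ?n = (\<Sum>p\<in>?J. case p of (\<alpha>, \<beta>) \<Rightarrow>
      of_real (c \<alpha> * c \<beta> * dn \<alpha> * dn \<beta>) * (endo_trace sU (\<sigma> (f \<alpha> * f \<beta>)) / endo_trace sU (\<sigma> 1)))"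
    by (auto simp: sum_divide_distrib \<sigma>1 intro!: sum.cong)
  finally show ?thesis unfolding c_scalar_def by simp
qed

end

section \<open>Intertwiners\<close>

lemma intertwiner_inj:
  assumes irr: "irreducible_rep G sU \<sigma>" and lin: "Vector_Spaces.linear sU sT \<phi>"
    and equiv: "\<And>g x. g \<in> G \<Longrightarrow> \<phi> (\<sigma> g x) = \<rho> g (\<phi> x)" and \<rho>0: "\<And>g. g \<in> G \<Longrightarrow> \<rho> g 0 = 0"
    and nz: "\<phi> \<noteq> (\<lambda>_. 0)"
  shows "inj \<phi>"
proof -
  interpret Vector_Spaces.linear sU sT \<phi> by (fact lin)
  let ?Y = "{x. \<phi> x = 0}"
  have "vs1.subspace ?Y" by (auto simp: vs1.subspace_def add scale)
  moreover have "h ` ?Y \<subseteq> ?Y" if "h \<in> \<sigma> ` G" for h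
    using that by (auto simp: equiv \<rho>0)
  ultimately have "?Y = {0} \<or> ?Y = UNIV"
    using irr unfolding irreducible_rep_def irreducible_under_def by blast
  moreover have "?Y \<noteq> UNIV" using nz by auto
  ultimately have "?Y = {0}" by blast
  then show ?thesis unfolding inj_iff_eq_0 by blast
qed

lemma irreducible_orbit_span:
  fixes \<sigma> :: "'k::ring_1 \<Rightarrow> 'm::ab_group_add \<Rightarrow> 'm"
  assumes irr: "irreducible_rep G sU \<sigma>" and one: "1 \<in> G"
    and mult: "\<And>g h. g \<in> G \<Longrightarrow> h \<in> G \<Longrightarrow> g * h \<in> G" and nz: "v \<noteq> 0"
  shows "module.span sU ((\<lambda>g. \<sigma> g v) ` G) = UNIV"
proof -
  have rep: "group_rep G sU \<sigma>" using irr by (simp add: irreducible_rep_def)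
  interpret vector_space sU using rep by (simp add: group_rep_def)
  let ?B = "(\<lambda>g. \<sigma> g v) ` G"
  have "h ` span ?B \<subseteq> span ?B" if h: "h \<in> \<sigma> ` G" for h
  proof -
    obtain g where g: "g \<in> G" "h = \<sigma> g" using h by blast
    interpret h: Vector_Spaces.linear sU sU h
      unfolding g(2) using rep g(1) by (simp add: group_rep_def)
    have "h ` ?B \<subseteq> ?B"
    proof (intro image_subsetI)
      fix y assume "y \<in> ?B"
      then obtain k where k: "k \<in> G" "y = \<sigma> k v" by blast
      then have "h y = \<sigma> (g * k) v" using rep g by (simp add: group_rep_def)
      then show "h y \<in> ?B" using mult g(1) k(1) by blast
    qed
    then show ?thesis by (simp add: h.span_image[symmetric] span_mono)
  qed
  then have "span ?B = {0} \<or> span ?B = UNIV"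
    using irr subspace_span[of ?B] unfolding irreducible_rep_def irreducible_under_def by blast
  moreover have "v \<in> span ?B"
  proof (rule span_base)
    have "v = \<sigma> 1 v" using rep by (simp add: group_rep_def)
    then show "v \<in> ?B" using one by (rule image_eqI)
  qed
  ultimately show ?thesis using nz by blast
qed

text \<open>A basis of the source stays independent under an injective map, so it is no larger than
  the finite set spanning the image.\<close>

lemma finite_span_of_inj:
  fixes sU :: "complex \<Rightarrow> 'm::ab_group_add \<Rightarrow> 'm"
  assumes lin: "Vector_Spaces.linear sU sT \<phi>" and inj: "inj \<phi>"
    and B: "finite B" "range \<phi> \<subseteq> module.span sT B"
  shows "\<exists>F. finite F \<and> module.span sU F = UNIV"
proof -
  interpret Vector_Spaces.linear sU sT \<phi> by (fact lin)
  obtain F where F: "vs1.independent F" "UNIV \<subseteq> vs1.span F"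
    using vs1.maximal_independent_subset[of UNIV] by blast
  have "vs2.independent (\<phi> ` F)"
    by (rule independent_injective_image[OF F(1)]) (rule inj_on_subset[OF inj], simp)
  then have "finite (\<phi> ` F)"
    using vs2.independent_span_bound[OF B(1), of "\<phi> ` F"] B(2) by blast
  then have "finite F" by (rule finite_imageD) (rule inj_on_subset[OF inj], simp)
  with F(2) show ?thesis by (intro exI[of _ F]) auto
qed

section \<open>Assembly on X \<otimes> S\<close>

theorem corollary3p6:
  fixes \<Phi> :: "('v::real_vector, 'u::real_inner) root_data"
    and Pos Simple :: "'v set"
    and c :: "'v \<Rightarrow> real"
    and H :: "('v, 'u, 'h::ring_1) hecke_data"
    and K :: "('u, 'k::ring_1) clifford_data"
    and sX :: "complex \<Rightarrow> 'x::ab_group_add \<Rightarrow> 'x" and \<pi> :: "'h \<Rightarrow> 'x \<Rightarrow> 'x"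
    and \<nu> :: "'v \<times> 'v"
    and sS :: "complex \<Rightarrow> 's::ab_group_add \<Rightarrow> 's" and \<gamma> :: "'k \<Rightarrow> 's \<Rightarrow> 's"
    and sT :: "complex \<Rightarrow> 't::ab_group_add \<Rightarrow> 't" and tens :: "'x \<Rightarrow> 's \<Rightarrow> 't"
    and sU :: "complex \<Rightarrow> 'm::ab_group_add \<Rightarrow> 'm" and \<sigma> :: "'k \<Rightarrow> 'm \<Rightarrow> 'm"
  assumes "root_system \<Phi>"
    and "positive_system \<Phi> Pos Simple"
    and "inner_invariant \<Phi>"
    and "param_invariant \<Phi> c"
    and "graded_hecke_algebra \<Phi> Simple c H"
    and "hecke_star \<Phi> Pos c H"
    and "irreducible_module (hscale H) sX \<pi>"
    and "unitary_module H sX \<pi>"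
    and "has_central_character \<Phi> H sX \<pi> \<nu>"
    and "clifford_algebra K"
    and "clifford_involutions K"
    and "irreducible_module (kscale K) sS \<gamma>"
    and "tensor_product sX sS sT tens"
    and "irreducible_rep (weyl_cover \<Phi> K) sU \<sigma>"
    and "\<exists>\<phi>\<in>intertwiners (weyl_cover \<Phi> K) sU \<sigma> sT (cover_act \<Phi> H K sT tens \<pi> \<gamma>). \<phi> \<noteq> (\<lambda>_. 0)"
  shows "(\<forall>u. group_alg_act sU \<sigma> (omega_cover \<Phi> Pos c K) u = sU (c_scalar \<Phi> Pos c K sU \<sigma>) u)
       \<and> cpx_form (dual_inner \<Phi>) \<nu> \<nu> \<in> \<real>
       \<and> c_scalar \<Phi> Pos c K sU \<sigma> \<in> \<real>
       \<and> Re (cpx_form (dual_inner \<Phi>) \<nu> \<nu>) \<le> Re (c_scalar \<Phi> Pos c K sU \<sigma>)"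
proof -
  interpret cover \<Phi> Pos Simple c K by unfold_locales fact+
  interpret hecke \<Phi> Pos Simple c H by unfold_locales fact+
  have X: "algebra_module hs sX \<pi>" and S: "algebra_module ks sS \<gamma>" and
    S_irr: "irreducible_under sS (range \<gamma>)"
    using \<open>irreducible_module hs sX \<pi>\<close> \<open>irreducible_module ks sS \<gamma>\<close>
    by (simp_all add: irreducible_module_def)
  note X' = algebra_moduleD[OF X] and S' = algebra_moduleD[OF S]
  have sT: "vector_space sT" using \<open>tensor_product sX sS sT tens\<close> by (simp add: tensor_product_def)
  interpret TP: tensor sX sS sT tens
    by (intro tensor.intro tensor_axioms.intro X'(1) S'(1) sT) fact
  \<comment> \<open>The two tensor factors act separately; \<open>PQ\<close> recovers the action of
    the cover as the product of both.\<close>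
  define P where "P h = tensor_map sT tens (\<pi> h) (\<lambda>s. s)" for h
  define Q where "Q k = tensor_map sT tens (\<lambda>x. x) (\<gamma> k)" for k
  have P: "algebra_module hs sT P" and Q: "algebra_module ks sT Q"
    using TP.tensor_map_module_left[OF X] TP.tensor_map_module_right[OF S]
    by (simp_all only: P_def[abs_def] Q_def[abs_def])
  note P' = algebra_moduleD[OF P] and Q' = algebra_moduleD[OF Q]
  have PQ: "P h (Q k t) = tensor_map sT tens (\<pi> h) (\<gamma> k) t" "Q k (P h t) = P h (Q k t)" for h k t
    unfolding P_def Q_def by (simp_all only: TP.tensor_map_commute[OF X'(2) S'(2)])

  interpret SK: clifford_rep \<Phi> Pos Simple c K sS \<gamma>
    by (intro clifford_rep.intro clifford_rep_axioms.intro S S'(1) cover_axioms)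
  interpret TK: clifford_rep \<Phi> Pos Simple c K sT Q
    by (intro clifford_rep.intro clifford_rep_axioms.intro Q Q'(1) cover_axioms)
  obtain FS where FS: "finite FS" "TP.S.span FS = UNIV"
    using SK.finite_span_of_irreducible[OF S_irr] by (elim exE conjE) (rule that)
  obtain B where B: "pos_form sX B" "\<And>h x y. B (\<pi> h x) y = B x (\<pi> (star h) y)"
    using \<open>unitary_module H sX \<pi>\<close> unfolding unitary_module_def pos_form_def by blast
  obtain C0 where C0: "pos_form sT C0" "\<And>h t u. C0 (P h t) u = C0 t (P (star h) u)"
  proof (rule TP.pos_form_tensor[OF B(1), of UNIV \<pi> star FS])
    fix C0 assume "pos_form sT C0" "\<And>h t u. h \<in> UNIV \<Longrightarrow> C0 (tensor_map sT tens (\<pi> h) (\<lambda>s. s) t) u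
        = C0 t (tensor_map sT tens (\<pi> (star h)) (\<lambda>s. s) u)"
    then show thesis by (intro that[of C0]) (simp_all add: P_def)
  qed (use X'(2) B(2) FS in simp_all)
  \<comment> \<open>\<open>C0\<close> has the right adjoints for the Hecke algebra; averaging adds
    invariance under the Clifford basis vectors.\<close>
  obtain C where C: "pos_form sT C" "\<And>h t u. C (P h t) u = C t (P (star h) u)"
    "\<And>e t u. e \<in> E \<Longrightarrow> C (Q (kr e) t) (Q (kr e) u) = C t u"
    using TK.invariant_form[of C0 P star, OF C0 PQ(2)] by (elim exE conjE) (rule that, blast+)
  have central: "P (hpoly H p) t = sT (p \<nu>) t" if "p \<in> sym_alg_inv \<Phi>" for p t
  proof (induction t rule: TP.tensor_induct)
    case (pure x s)
    have "\<pi> (hpoly H p) x = sX (p \<nu>) x"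
      using \<open>has_central_character \<Phi> H sX \<pi> \<nu>\<close> that by (simp add: has_central_character_def)
    then show ?case
      unfolding P_def TP.tensor_map_tens[OF X'(2) TP.linear_ident(2)] by (simp add: TP.tens_scale_left)
  qed (simp add: P' TP.T.scale_right_distrib)
  interpret Di: dirac \<Phi> Pos Simple c K H sT P Q C \<nu>
    by (intro dirac.intro dirac_axioms.intro cover_axioms hecke_axioms P'(1) P Q PQ(2) C central)

  have irr: "irreducible_rep G sU \<sigma>" by fact
  have rep: "group_rep G sU \<sigma>" using irr by (simp add: irreducible_rep_def)
  obtain \<phi> where \<phi>: "Vector_Spaces.linear sU sT \<phi>" "\<phi> \<noteq> (\<lambda>_. 0)"
    and equiv: "\<And>g x. g \<in> G \<Longrightarrow> \<phi> (\<sigma> g x) = P (tw (wp g)) (Q g (\<phi> x))"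
    using assms(15) by (auto simp: intertwiners_def cover_act_def PQ(1))
  interpret \<phi>: Vector_Spaces.linear sU sT \<phi> by (fact \<phi>(1))
  have inj: "inj \<phi>"
    by (rule intertwiner_inj[OF irr \<phi>(1) equiv _ \<phi>(2)]) (simp_all add: Di.P_rules Di.Q_rules)
  obtain v :: 'm where v: "v \<noteq> 0"
    using irr unfolding irreducible_rep_def irreducible_under_def by blast
  \<comment> \<open>Elements of the cover act on the factor X only through the finitely many
    \<open>tw w\<close>, which confines the orbit of \<open>\<phi> v\<close>.\<close>
  obtain BT where BT: "finite BT"
    "\<And>h g. h \<in> (\<lambda>w. \<pi> (tw w)) ` W \<Longrightarrow> Vector_Spaces.linear sS sS g \<Longrightarrow>
       tensor_map sT tens h g (\<phi> v) \<in> TP.T.span BT"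
  proof -
    have "\<exists>B. finite B \<and> (\<forall>h\<in>(\<lambda>w. \<pi> (tw w)) ` W. \<forall>g. Vector_Spaces.linear sS sS g \<longrightarrow>
        tensor_map sT tens h g (\<phi> v) \<in> TP.T.span B)"
      by (rule TP.tensor_orbit_finite[OF FS]) (use finite_W X'(2) in auto)
    then show thesis by (elim exE conjE) (rule that, blast+)
  qed
  have "\<phi> y \<in> TP.T.span BT" for y
  proof -
    have "y \<in> \<phi>.vs1.span ((\<lambda>g. \<sigma> g v) ` G)"
      by (simp add: irreducible_orbit_span[OF irr cover_one(1) cover_mult(1) v])
    then show ?thesis
    proof (induction rule: \<phi>.vs1.span_induct_alt)
      case (step z x y)
      then obtain g where g: "g \<in> G" "x = \<sigma> g v" by blast
      have "\<phi> x = tensor_map sT tens (\<pi> (tw (wp g))) (\<gamma> g) (\<phi> v)"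
        by (simp add: g equiv PQ(1))
      then have "\<phi> x \<in> TP.T.span BT" using coverD(2)[OF g(1)] BT(2) S'(2) by auto
      with step(2) show ?case by (simp add: \<phi>.add \<phi>.scale TP.T.span_add TP.T.span_scale)
    qed (simp add: \<phi>.zero TP.T.span_zero)
  qed
  then obtain F where F: "finite F" "\<phi>.vs1.span F = UNIV"
    using finite_span_of_inj[OF \<phi>(1) inj BT(1)] by (auto intro: that)
  \<comment> \<open>The element -1 lies over the identity of W and acts on S by -1; injectivity of
    \<phi> brings this back to U.\<close>
  have "\<sigma> (- 1) x = - x" for x
  proof -
    have "- 1 \<in> G" "wp (- 1) = w_one" using cover_minus[OF cover_one(1)] cover_one(2) by simp_all
    then have "\<phi> (\<sigma> (- 1) x) = \<phi> (- x)"
      by (simp add: equiv tw_one Di.P_lin(6) TK.Q_minus Di.Q_lin(6) \<phi>.neg)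
    then show ?thesis using inj by (simp add: inj_eq)
  qed
  then interpret U: cover_rep \<Phi> Pos Simple c K sU F \<sigma>
    by (intro cover_rep.intro cover_rep_axioms.intro cover_axioms finite_span.intro
        finite_span_axioms.intro \<phi>.vs1.vector_space_axioms F rep)

  have A_\<phi>: "Di.A (\<phi> x) = \<phi> (U.AU x)" for x
  proof -
    have "P (tw (w_refl \<Phi> \<beta>)) (Q (kr (vec \<beta>)) (\<phi> x)) = sT (of_real (dual_norm \<Phi> \<beta>)) (\<phi> (\<sigma> (f \<beta>) x))"
      if "\<beta> \<in> Pos" for \<beta>
    proof -
      have "\<beta> \<in> R" using that by (rule Pos_R)
      then have "kr (vec \<beta>) = ks (of_real (dual_norm \<Phi> \<beta>)) (f \<beta>)"
        using vec_unit[of \<beta>] by (metis kr_scaleR f_unit)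
      then show ?thesis using \<open>\<beta> \<in> R\<close> by (simp add: equiv cover_f Di.P_rules Di.Q_rules)
    qed
    then show ?thesis by (simp add: Di.A_def U.AU_def \<phi>.sum \<phi>.scale)
  qed
  \<comment> \<open>On the image of \<phi> this is the equivariance of the square of
    \<open>A\<close>; injectivity transfers it to U.\<close>
  have comm: "- U.AU (U.AU (\<sigma> g x)) = \<sigma> g (- U.AU (U.AU x))" if g: "g \<in> G" for g x
  proof -
    have "\<phi> (U.AU (U.AU (\<sigma> g x))) = \<phi> (\<sigma> g (U.AU (U.AU x)))"
      using Di.A_square_equivariant[OF g, of "\<phi> x"] by (simp add: A_\<phi> equiv[OF g] flip: A_\<phi>)
    then have "U.AU (U.AU (\<sigma> g x)) = \<sigma> g (U.AU (U.AU x))" using inj by (simp add: inj_eq)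
    then show ?thesis using U.\<sigma>_lin(2)[OF g, of "- 1" "U.AU (U.AU x)"] by simp
  qed
  obtain z where z: "\<And>x. - U.AU (U.AU x) = sU z x"
  proof (rule U.U.schur[of "\<sigma> ` G" "\<lambda>x. - U.AU (U.AU x)"])
    show "irreducible_under sU (\<sigma> ` G)" using irr by (simp add: irreducible_rep_def)
    show "Vector_Spaces.linear sU sU h" if "h \<in> \<sigma> ` G" for h
      using that rep by (auto simp: group_rep_def)
    show "Vector_Spaces.linear sU sU (\<lambda>x. - U.AU (U.AU x))"
      by (simp add: Vector_Spaces.linear_iff \<phi>.vs1.vector_space_axioms U.AU_lin)
  qed (use comm in auto)
  have act: "group_alg_act sU \<sigma> (omega_cover \<Phi> Pos c K) x = sU z x" for x
    by (simp add: U.omega_act z)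
  have scalar: "c_scalar \<Phi> Pos c K sU \<sigma> = z"
    by (rule U.omega_scalar[OF act v])
  have "\<phi> v \<noteq> 0" using inj v \<phi>.zero by (metis injD)
  moreover have "- Di.A (Di.A (\<phi> v)) = sT z (\<phi> v)"
    by (simp add: A_\<phi> flip: \<phi>.neg \<phi>.scale z)
  ultimately show ?thesis
    using Di.dirac_inequality[of "\<phi> v" z] act by (simp add: scalar)
qed

end
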